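(* Let $L\ge 2$, $N=2L$, and let $\mathcal S_N\subset\mathrm{End}(\mathcal H_N)$ be the Lie algebra generated by the operators $\mathcal A_{m,n},\mathcal B_{m,n},\mathcal C_{m,n}$ and $\mathcal E_{0,n},\mathcal E_{0,L},\mathcal E_{0,L+n},\mathcal E_{m,L},\mathcal E_{L+m,L}$, $1\le m,n\le L-1$, defined in the context. Then the image of the universal enveloping algebra $U\mathcal S_N$ in $\mathrm{End}(\mathcal H_N)$ (the unital associative subalgebra generated by $\mathcal S_N$) is isomorphic to $\pi_{\mathfrak{gl}}(JTL_N)$.
   Context: Periodic alternating $\mathfrak{gl}(1|1)$ spin chain: $\mathcal H_N=(\mathbb C^2)^{\otimes N}$, $N=2L$, with operators $f_j,f_j^\dagger$ ($1\le j\le N$) satisfying $\{f_j,f_{j'}\}=\{f_j^\dagger,f_{j'}^\dagger\}=0$, $\{f_j,f_{j'}^\dagger\}=(-1)^j\delta_{jj'}$ and generating $\mathrm{End}(\mathcal H_N)$. Set $f^{(\dagger)}_{N+1}=f^{(\dagger)}_1$, $e_j=(f_j+f_{j+1})(f_j^\dagger+f_{j+1}^\dagger)$ for $1\le j\le N$, and let $u^2$ be translation by two sites ($u^2f^{(\dagger)}_ju^{-2}=f^{(\dagger)}_{j+2}$, indices mod $N$). $\pi_{\mathfrak{gl}}(JTL_N)$ is the unital subalgebra of $\mathrm{End}(\mathcal H_N)$ generated by the $e_j$ and $u^{\pm2}$ (the image of the Jones–Temperley–Lieb algebra with loop weight $0$). Fermion modes: with $p_k=2\pi k/N$ ($L$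 even) or $(2k-1)\pi/N$ ($L$ odd), momenta mod $2\pi$, $\theta_p=N^{-1/2}\sum_k e^{-ikp}i^{-k}f_k$, $\theta^\dagger_p=N^{-1/2}\sum_k e^{ikp}i^{-k}f^\dagger_k$. For $p=m\pi/L$, $1\le m\le L-1$: $\chi^\dagger_p=\tfrac1{\sqrt2}(\sqrt{\tan\frac p2}\theta^\dagger_{p-\pi/2}+\sqrt{\cot\frac p2}\theta^\dagger_{p+\pi/2})$, $\chi_p=\tfrac1{\sqrt2}(\sqrt{\cot\frac p2}\theta_{p-\pi/2}+\sqrt{\tan\frac p2}\theta_{p+\pi/2})$, $\eta^\dagger_p=\tfrac1{\sqrt2}(\sqrt{\tan\frac p2}\theta^\dagger_{p-\pi/2}-\sqrt{\cot\frac p2}\theta^\dagger_{p+\pi/2})$, $\eta_p=\tfrac1{\sqrt2}(\sqrt{\cot\frac p2}\theta_{p-\pi/2}-\sqrt{\tan\frac p2}\theta_{p+\pi/2})$; and $\chi^\dagger_0=\theta^\dagger_{\pi/2}$, $\chi_0=\theta_{\pi/2}$, $\eta^\dagger_0=\theta^\dagger_{3\pi/2}$, $\eta_0=\theta_{3\pi/2}$. Put $\bar\eta^{(\dagger)}_p=\eta^{(\dagger)}_{\pi-p}$ for $p\ne0$, $\bar\eta^{(\dagger)}_0=\eta^{(\dagger)}_0$. For $0\le m,n\le L-1$, $p=m\pi/L$, $q=n\pi/L$: $\mathcal E_{m,n}=\chi^\dagger_p\chi_q$, $\mathcal E_{m,L+n}=\chi^\dagger_p\bar\eta_q$, $\mathcal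 E_{L+m,n}=\bar\eta^\dagger_p\chi_q$, $\mathcal E_{L+m,L+n}=\bar\eta^\dagger_p\bar\eta_q$. For $1\le m,n\le L-1$: $\mathcal A_{m,n}=\mathcal E_{m,n}-\mathcal E_{L+n,L+m}$, $\mathcal B_{m,n}=\mathcal E_{m,L+n}+\mathcal E_{n,L+m}$, $\mathcal C_{m,n}=\mathcal E_{L+m,n}+\mathcal E_{L+n,m}$. *)

theory Defs
  imports Complex_Main "Jordan_Normal_Form.Matrix"
begin

text \<open>Conventions. Throughout, L is the half-length, N = 2L sites, and the Hilbert space
is C^(2^N), basis vectors indexed by s < 2^N; bit (j-1) of s is the occupation of site j
(1 \<le> j \<le> N). Operators are complex (2^N x 2^N) matrices.\<close>

definition hdim :: "nat \<Rightarrow> nat" where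
  "hdim L = 2 ^ (2 * L)"

definition msum :: "nat \<Rightarrow> ('b \<Rightarrow> complex mat) \<Rightarrow> 'b set \<Rightarrow> complex mat" where
  "msum d F K = mat d d (\<lambda>ij. \<Sum>k\<in>K. F k $$ ij)"

text \<open>Jordan-Wigner annihilator c_j with {c_j, c_j^*} = 1.\<close>
definition cop :: "nat \<Rightarrow> nat \<Rightarrow> complex mat" where
  "cop L j = mat (hdim L) (hdim L) (\<lambda>(r, s).
     if bit s (j - 1) \<and> r = s - 2 ^ (j - 1)
     then (-1) ^ card {k. k < j - 1 \<and> bit s k} else 0)"

text \<open>f_j and f_j^dagger with {f_j, f_j'^dagger} = (-1)^j delta_jj'.\<close>
definition ff :: "nat \<Rightarrow> nat \<Rightarrow> complex mat" where
  "ff L j = cop L j"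

definition ffd :: "nat \<Rightarrow> nat \<Rightarrow> complex mat" where
  "ffd L j = ((-1) ^ j) \<cdot>\<^sub>m transpose_mat (cop L j)"

text \<open>Periodic next site (f_{N+1} = f_1) and shift by two sites, on indices 1..N.\<close>
definition nxt :: "nat \<Rightarrow> nat \<Rightarrow> nat" where
  "nxt L j = (if j = 2 * L then 1 else j + 1)"

definition shift2 :: "nat \<Rightarrow> nat \<Rightarrow> nat" where
  "shift2 L j = ((j + 1) mod (2 * L)) + 1"

definition ee :: "nat \<Rightarrow> nat \<Rightarrow> complex mat" where
  "ee L j = (ff L j + ff L (nxt L j)) * (ffd L j + ffd L (nxt L j))"

text \<open>Fermion modes (theta_p depends on p only modulo 2 pi).\<close>
definition theta :: "nat \<Rightarrow> real \<Rightarrow> complex mat" where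
  "theta L p = msum (hdim L)
     (\<lambda>k. (exp (- \<i> * of_nat k * of_real p) * (- \<i>) ^ k / of_real (sqrt (real (2 * L))))
           \<cdot>\<^sub>m ff L k) {1..2 * L}"

definition thetad :: "nat \<Rightarrow> real \<Rightarrow> complex mat" where
  "thetad L p = msum (hdim L)
     (\<lambda>k. (exp (\<i> * of_nat k * of_real p) * (- \<i>) ^ k / of_real (sqrt (real (2 * L))))
           \<cdot>\<^sub>m ffd L k) {1..2 * L}"

definition mom :: "nat \<Rightarrow> nat \<Rightarrow> real" where
  "mom L m = real m * pi / real L"

definition cr :: "real \<Rightarrow> complex" where
  "cr x = complex_of_real x"

definition chid :: "nat \<Rightarrow> nat \<Rightarrow> complex mat" where
  "chid L m = (if m = 0 then thetad L (pi / 2) else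
     (let p = mom L m in
       cr (1 / sqrt 2) \<cdot>\<^sub>m (cr (sqrt (tan (p / 2))) \<cdot>\<^sub>m thetad L (p - pi / 2)
                              + cr (sqrt (cot (p / 2))) \<cdot>\<^sub>m thetad L (p + pi / 2))))"

definition chi :: "nat \<Rightarrow> nat \<Rightarrow> complex mat" where
  "chi L m = (if m = 0 then theta L (pi / 2) else
     (let p = mom L m in
       cr (1 / sqrt 2) \<cdot>\<^sub>m (cr (sqrt (cot (p / 2))) \<cdot>\<^sub>m theta L (p - pi / 2)
                              + cr (sqrt (tan (p / 2))) \<cdot>\<^sub>m theta L (p + pi / 2))))"

definition etad :: "nat \<Rightarrow> nat \<Rightarrow> complex mat" where
  "etad L m = (if m = 0 then thetad L (3 * pi / 2) else
     (let p = mom L m in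
       cr (1 / sqrt 2) \<cdot>\<^sub>m (cr (sqrt (tan (p / 2))) \<cdot>\<^sub>m thetad L (p - pi / 2)
                              - cr (sqrt (cot (p / 2))) \<cdot>\<^sub>m thetad L (p + pi / 2))))"

definition eta :: "nat \<Rightarrow> nat \<Rightarrow> complex mat" where
  "eta L m = (if m = 0 then theta L (3 * pi / 2) else
     (let p = mom L m in
       cr (1 / sqrt 2) \<cdot>\<^sub>m (cr (sqrt (cot (p / 2))) \<cdot>\<^sub>m theta L (p - pi / 2)
                              - cr (sqrt (tan (p / 2))) \<cdot>\<^sub>m theta L (p + pi / 2))))"

text \<open>bar eta_p = eta_{pi - p} for p = m pi / L, m \<noteq> 0, i.e. index L - m.\<close>
definition etabd :: "nat \<Rightarrow> nat \<Rightarrow> complex mat" where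
  "etabd L m = (if m = 0 then etad L 0 else etad L (L - m))"

definition etab :: "nat \<Rightarrow> nat \<Rightarrow> complex mat" where
  "etab L m = (if m = 0 then eta L 0 else eta L (L - m))"

definition EE :: "nat \<Rightarrow> nat \<Rightarrow> nat \<Rightarrow> complex mat" where
  "EE L a b = (if a < L then chid L a else etabd L (a - L))
              * (if b < L then chi L b else etab L (b - L))"

definition AA :: "nat \<Rightarrow> nat \<Rightarrow> nat \<Rightarrow> complex mat" where
  "AA L m n = EE L m n - EE L (L + n) (L + m)"

definition BB :: "nat \<Rightarrow> nat \<Rightarrow> nat \<Rightarrow> complex mat" where
  "BB L m n = EE L m (L + n) + EE L n (L + m)"

definition CC :: "nat \<Rightarrow> nat \<Rightarrow> nat \<Rightarrow> complex mat" where
  "CC L m n = EE L (L + m) n + EE L (L + n) m"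

definition SN_gens :: "nat \<Rightarrow> complex mat set" where
  "SN_gens L =
     {AA L m n | m n. m \<in> {1..L-1} \<and> n \<in> {1..L-1}}
   \<union> {BB L m n | m n. m \<in> {1..L-1} \<and> n \<in> {1..L-1}}
   \<union> {CC L m n | m n. m \<in> {1..L-1} \<and> n \<in> {1..L-1}}
   \<union> {EE L 0 n | n. n \<in> {1..L-1}}
   \<union> {EE L 0 L}
   \<union> {EE L 0 (L + n) | n. n \<in> {1..L-1}}
   \<union> {EE L m L | m. m \<in> {1..L-1}}
   \<union> {EE L (L + m) L | m. m \<in> {1..L-1}}"

inductive_set lie_alg :: "complex mat set \<Rightarrow> complex mat set" for G where
  gen: "x \<in> G \<Longrightarrow> x \<in> lie_alg G"
| add: "x \<in> lie_alg G \<Longrightarrow> y \<in> lie_alg G \<Longrightarrow> x + y \<in> lie_alg G"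
| smult: "x \<in> lie_alg G \<Longrightarrow> c \<cdot>\<^sub>m x \<in> lie_alg G"
| bracket: "x \<in> lie_alg G \<Longrightarrow> y \<in> lie_alg G \<Longrightarrow> x * y - y * x \<in> lie_alg G"

inductive_set assoc_alg :: "nat \<Rightarrow> complex mat set \<Rightarrow> complex mat set" for d G where
  gen: "x \<in> G \<Longrightarrow> x \<in> assoc_alg d G"
| one: "1\<^sub>m d \<in> assoc_alg d G"
| add: "x \<in> assoc_alg d G \<Longrightarrow> y \<in> assoc_alg d G \<Longrightarrow> x + y \<in> assoc_alg d G"
| smult: "x \<in> assoc_alg d G \<Longrightarrow> c \<cdot>\<^sub>m x \<in> assoc_alg d G"
| mult: "x \<in> assoc_alg d G \<Longrightarrow> y \<in> assoc_alg d G \<Longrightarrow> x * y \<in> assoc_alg d G"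

text \<open>Generators of pi_gl(JTL_N): the e_j and u^{\<plusminus>2} (given as U, Uinv).\<close>
definition JTL_gens :: "nat \<Rightarrow> complex mat \<Rightarrow> complex mat \<Rightarrow> complex mat set" where
  "JTL_gens L U Uinv = {ee L j | j. j \<in> {1..2 * L}} \<union> {U, Uinv}"

definition alg_isomorphic :: "nat \<Rightarrow> complex mat set \<Rightarrow> complex mat set \<Rightarrow> bool" where
  "alg_isomorphic d A B \<longleftrightarrow> (\<exists>\<phi>. bij_betw \<phi> A B
     \<and> (\<forall>x\<in>A. \<forall>y\<in>A. \<phi> (x + y) = \<phi> x + \<phi> y)
     \<and> (\<forall>x\<in>A. \<forall>c. \<phi> (c \<cdot>\<^sub>m x) = c \<cdot>\<^sub>m \<phi> x)
     \<and> (\<forall>x\<in>A. \<forall>y\<in>A. \<phi> (x * y) = \<phi> x * \<phi> y)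
     \<and> \<phi> (1\<^sub>m d) = 1\<^sub>m d)"

end

theory Submission
  imports Defs
begin

text \<open>The two subalgebras coincide. Let \<open>w\<^sub>j\<close> be a formal basis indexed by the sites, and attach to
  \<open>w\<^sub>j\<close> both \<open>f\<^sub>j + f\<^bsub>j+1\<^esub>\<close> and \<open>(-1)\<^sup>j\<close> times its conjugate. With the form induced by the
  anticommutators, which is antisymmetric, the symmetric products \<open>w\<^sub>i w\<^sub>j\<close> act by quadratic
  operators that close under commutators like a (degenerate) symplectic Lie algebra, and
  \<open>e\<^sub>j\<close> is a multiple of \<open>w\<^sub>j w\<^sub>j\<close>. Neighbouring sites pair to 1, so the \<open>e\<^sub>j\<close> generate all
  \<open>w\<^sub>i w\<^sub>j\<close>. In a Fourier basis adapted to the modes, the same operators are, up to nonzero scalars,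
  the generators of \<open>S\<^sub>N\<close>, the vectors at momentum 0 and \<open>\<pi>\<close> spanning the radical.

  The translation multiplies the modes by phases. Such phases are implemented by
  products of quadratic polynomials in the commuting operators \<open>A\<^bsub>m,m\<^esub>\<close>, and since only scalars
  commute with all fermions, this product is a multiple of the translation.\<close>

section \<open>Jordan-Wigner operators\<close>

text \<open>The weights \<open>sqrt (tan (p / 2))\<close> and \<open>sqrt (cot (p / 2))\<close> come
  from the neighbour structure: summing or subtracting over two adjacent sites multiplies a plane
  wave, up to phases, by the cosine or the sine of half its momentum, and dividing by the square
  root of their product makes the modes canonical. For the translation, the obstacle is that the
  generators offer a difference \<open>AA L m m\<close> of two number operators instead of the
  single ones. The phases fit this: \<open>chid\<close> and \<open>etabd\<close> of equal index
  receive inverse phases, and the zero modes receive 1, since two steps at momentum 0 or \<pi> give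
  no phase. \<open>U\<close> is given only by its conjugation action, which determines it up to a
  scalar. Hence the comparison up to a multiple, and hence an inverse is carried along, so that
  \<open>Uinv\<close> is reached too.\<close>

definition jsign :: "nat \<Rightarrow> nat \<Rightarrow> complex" where
  "jsign j s = (\<Prod>k<j. if bit s k then - 1 else 1)"

text \<open>Creators and annihilators share this shape: flip bit \<open>j\<close>, apply the
  Jordan-Wigner string \<open>jsign\<close>, and weight by a function \<open>P\<close> of the
  occupation before the flip. With \<open>P\<close> as a parameter all anticommutators are treated
  together. Sites are counted from 0 here, whereas \<open>cop\<close> counts them from 1.\<close>

definition jw_op :: "nat \<Rightarrow> (bool \<Rightarrow> complex) \<Rightarrow> nat \<Rightarrow> complex mat" where
  "jw_op L P j = mat (hdim L) (hdim L)
     (\<lambda>(r, s). if r = flip_bit j s then P (bit s j) * jsign j s else 0)"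

lemma jsign_eq_card: "(- 1) ^ card {k. k < j \<and> bit s k} = jsign j s"
proof -
  have "{k. k < j \<and> bit s k} = {..<j} \<inter> {k. bit s k}" by auto
  then show ?thesis
    by (simp add: jsign_def prod.If_cases)
qed

lemma jsign_square: "jsign j s * jsign j s = 1"
  unfolding jsign_def by (simp flip: prod.distrib) (auto intro!: prod.neutral)

lemma jsign_flip_same: "jsign j (flip_bit j s) = jsign j s"
  unfolding jsign_def by (intro prod.cong) (auto simp: bit_flip_bit_iff)

lemma jsign_flip_higher: "i \<le> j \<Longrightarrow> jsign i (flip_bit j s) = jsign i s"
  unfolding jsign_def by (intro prod.cong) (auto simp: bit_flip_bit_iff)

lemma jsign_flip_lower: "j < i \<Longrightarrow> jsign i (flip_bit j s) = - jsign i s"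
proof -
  assume "j < i"
  then have j: "j \<in> {..<i}" by simp
  have "(\<Prod>k\<in>{..<i} - {j}. if bit (flip_bit j s) k then - 1 else 1 :: complex)
      = (\<Prod>k\<in>{..<i} - {j}. if bit s k then - 1 else 1)"
    by (intro prod.cong) (auto simp: bit_flip_bit_iff)
  then show ?thesis unfolding jsign_def prod.remove[OF finite_lessThan j]
    by (simp add: bit_flip_bit_iff)
qed

lemma flip_flip: "flip_bit j (flip_bit j (s::nat)) = s"
  by (rule bit_eqI) (auto simp: bit_flip_bit_iff)

lemma flip_commute: "flip_bit i (flip_bit j (s::nat)) = flip_bit j (flip_bit i s)"
  by (rule bit_eqI) (auto simp: bit_flip_bit_iff)

lemma flip_less:
  assumes "j < n" "s < 2 ^ n"
  shows "flip_bit j (s::nat) < 2 ^ n"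
proof -
  have "take_bit n (flip_bit j s) = flip_bit j s"
  proof (rule bit_eqI)
    fix k
    have "bit s k \<Longrightarrow> k < n" using assms(2)
      by (metis bit_take_bit_iff take_bit_nat_eq_self)
    then show "bit (take_bit n (flip_bit j s)) k = bit (flip_bit j s) k"
      using assms(1) by (auto simp: bit_take_bit_iff bit_flip_bit_iff)
  qed
  then show ?thesis by (metis take_bit_nat_less_exp)
qed

lemma flip_set_bit: "bit s j \<Longrightarrow> flip_bit j (s::nat) = s - 2 ^ j"
proof -
  assume b: "bit s j"
  have "int (unset_bit j s) = int s - int (2 ^ j)"
    using b by (simp add: of_nat_unset_bit_eq unset_bit_eq bit_of_nat_iff)
  moreover have "2 ^ j \<le> s"
    using b by (metis bit_take_bit_iff less_irrefl not_le take_bit_nat_eq_self)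
  ultimately have "int (unset_bit j s) = int (s - 2 ^ j)" by (simp only: of_nat_diff)
  then show ?thesis using b by (simp add: flip_bit_eq_if)
qed

lemma cop_eq_jw_op: "cop L j = jw_op L (\<lambda>b. if b then 1 else 0) (j - 1)"
  unfolding cop_def jw_op_def
  by (intro cong_mat) (auto simp: flip_set_bit jsign_eq_card)

text \<open>Transposition exchanges the occupations before and after the flip, hence the two values
  of \<open>P\<close>. The string survives unchanged because it does not see site \<open>j\<close>
  itself.\<close>

lemma cop_transpose_eq_jw_op: "transpose_mat (cop L j) = jw_op L (\<lambda>b. if b then 0 else 1) (j - 1)"
proof (rule eq_matI)
  fix r s assume "r < dim_row (jw_op L (\<lambda>b. if b then 0 else 1) (j - 1))"
     "s < dim_col (jw_op L (\<lambda>b. if b then 0 else 1) (j - 1))"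
  then have rs: "r < hdim L" "s < hdim L" by (auto simp: jw_op_def)
  have "s = flip_bit (j-1) r \<longleftrightarrow> r = flip_bit (j-1) s" by (metis flip_flip)
  then show "transpose_mat (cop L j) $$ (r,s) = jw_op L (\<lambda>b. if b then 0 else 1) (j - 1) $$ (r,s)"
    using rs by (auto simp: cop_eq_jw_op jw_op_def bit_flip_bit_iff jsign_flip_same)
qed (auto simp: cop_def jw_op_def)

lemma jw_op_carrier [simp]: "jw_op L P j \<in> carrier_mat (hdim L) (hdim L)"
  by (simp add: jw_op_def)

lemma jw_op_mult_index:
  assumes "i < 2 * L" "j < 2 * L" "r < hdim L" "s < hdim L"
  shows "(jw_op L P i * jw_op L Q j) $$ (r, s) =
    (if r = flip_bit i (flip_bit j s)
     then P (bit (flip_bit j s) i) * jsign i (flip_bit j s) * (Q (bit s j) * jsign j s) else 0)"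
proof -
  have fl: "flip_bit j s < hdim L" using assms flip_less by (simp add: hdim_def)
  have "(jw_op L P i * jw_op L Q j) $$ (r, s) =
     (\<Sum>t<hdim L. jw_op L P i $$ (r,t) * jw_op L Q j $$ (t,s))"
    using assms by (simp add: jw_op_def scalar_prod_def lessThan_atLeast0)
  also have "\<dots> = (\<Sum>t<hdim L. if t = flip_bit j s then jw_op L P i $$ (r,t) * (Q (bit s j) * jsign j s) else 0)"
    using assms by (intro sum.cong) (auto simp: jw_op_def)
  also have "\<dots> = jw_op L P i $$ (r,flip_bit j s) * (Q (bit s j) * jsign j s)"
    using fl by (simp)
  finally show ?thesis using assms fl by (simp add: jw_op_def)
qed

text \<open>Both orders reach the same basis state. Only the string of the higher site passes over
  the other site, so flipping the lower site before or after it changes the product by exactly one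
  sign, whatever the weights.\<close>

lemma jw_op_anticommute:
  assumes "i < 2 * L" "j < 2 * L" "i \<noteq> j"
  shows "jw_op L P i * jw_op L Q j + jw_op L Q j * jw_op L P i = 0\<^sub>m (hdim L) (hdim L)"
proof (rule eq_matI)
  fix r s assume "r < dim_row (0\<^sub>m (hdim L) (hdim L) :: complex mat)" "s < dim_col (0\<^sub>m (hdim L) (hdim L):: complex mat)"
  then have rs: "r < hdim L" "s < hdim L" by auto
  have dims: "dim_row (jw_op L Q j * jw_op L P i) = hdim L" "dim_col (jw_op L Q j * jw_op L P i) = hdim L"
    by (simp_all add: jw_op_def)
  show "(jw_op L P i * jw_op L Q j + jw_op L Q j * jw_op L P i) $$ (r,s) = 0\<^sub>m (hdim L) (hdim L) $$ (r,s)"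
    using assms rs dims
    by (cases "i < j")
       (auto simp: jw_op_mult_index jsign_flip_lower jsign_flip_higher bit_flip_bit_iff flip_commute[of i j] simp del: index_mult_mat)
qed (auto simp: jw_op_def)

text \<open>The string occurs twice and squares to 1, which leaves a statement about one site: the
  two hypotheses are the diagonal entries of the anticommutator of two off-diagonal 2 by 2
  matrices.\<close>

lemma jw_op_anticommute_same:
  assumes "j < 2 * L" and c: "P True * Q False + Q True * P False = c" "P False * Q True + Q False * P True = c"
  shows "jw_op L P j * jw_op L Q j + jw_op L Q j * jw_op L P j = c \<cdot>\<^sub>m 1\<^sub>m (hdim L)"
proof (rule eq_matI)
  fix r s assume "r < dim_row (c \<cdot>\<^sub>m 1\<^sub>m (hdim L))" "s < dim_col (c \<cdot>\<^sub>m 1\<^sub>m (hdim L))"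
  then have rs: "r < hdim L" "s < hdim L" by auto
  have dims: "dim_row (jw_op L Q j * jw_op L P j) = hdim L" "dim_col (jw_op L Q j * jw_op L P j) = hdim L"
    by (simp_all add: jw_op_def)
  show "(jw_op L P j * jw_op L Q j + jw_op L Q j * jw_op L P j) $$ (r,s) = (c \<cdot>\<^sub>m 1\<^sub>m (hdim L)) $$ (r,s)"
    using assms(1) c[symmetric] rs dims
    by (cases "bit s j")
       (auto simp: jw_op_mult_index jsign_flip_same bit_flip_bit_iff flip_flip jsign_square algebra_simps simp del: index_mult_mat)
qed (auto simp: jw_op_def)

text \<open>Commuting with the annihilators fixes the vacuum column of \<open>W\<close> up to a scalar, and the creators
  transport it to all other columns.\<close>
lemma jw_op_commutant_scalar:
  assumes W: "W \<in> carrier_mat (hdim L) (hdim L)"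
    and c1: "\<And>j. j \<in> {1..2 * L} \<Longrightarrow> W * cop L j = cop L j * W"
    and c2: "\<And>j. j \<in> {1..2 * L} \<Longrightarrow> W * transpose_mat (cop L j) = transpose_mat (cop L j) * W"
  shows "\<exists>c. W = c \<cdot>\<^sub>m 1\<^sub>m (hdim L)"
proof -
  let ?d = "hdim L"
  have right: "(W * jw_op L P j) $$ (r, s) = W $$ (r, flip_bit j s) * (P (bit s j) * jsign j s)"
    if "j < 2 * L" "r < ?d" "s < ?d" for j r s P
  proof -
    have fl: "flip_bit j s < ?d" using that flip_less by (simp add: hdim_def)
    have "(W * jw_op L P j) $$ (r, s) = (\<Sum>t<?d. W $$ (r,t) * jw_op L P j $$ (t,s))"
      using that W by (simp add: jw_op_def scalar_prod_def lessThan_atLeast0)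
    also have "\<dots> = (\<Sum>t<?d. if t = flip_bit j s then W $$ (r,t) * (P (bit s j) * jsign j s) else 0)"
      using that by (intro sum.cong) (auto simp: jw_op_def)
    finally show ?thesis using fl by simp
  qed
  have left: "(jw_op L P j * W) $$ (r, s) = P (\<not> bit r j) * jsign j r * W $$ (flip_bit j r, s)"
    if "j < 2 * L" "r < ?d" "s < ?d" for j r s P
  proof -
    have fl: "flip_bit j r < ?d" using that flip_less by (simp add: hdim_def)
    have "(jw_op L P j * W) $$ (r, s) = (\<Sum>t<?d. jw_op L P j $$ (r,t) * W $$ (t,s))"
      using that W by (simp add: jw_op_def scalar_prod_def lessThan_atLeast0)
    also have "\<dots> = (\<Sum>t<?d. if t = flip_bit j r then P (\<not> bit r j) * jsign j r * W $$ (t,s) else 0)"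
    proof (intro sum.cong refl)
      fix t assume "t \<in> {..<?d}"
      moreover have "r = flip_bit j t \<longleftrightarrow> t = flip_bit j r" by (metis flip_flip)
      ultimately show "jw_op L P j $$ (r,t) * W $$ (t,s) =
        (if t = flip_bit j r then P (\<not> bit r j) * jsign j r * W $$ (t,s) else 0)"
        using that by (auto simp: jw_op_def bit_flip_bit_iff jsign_flip_same)
    qed
    finally show ?thesis using fl by simp
  qed
  have nz: "jsign j s \<noteq> 0" for j s using jsign_square[of j s] by auto
  have bitlt: "k < 2 * L" if "bit s k" "s < ?d" for s k :: nat
    using that unfolding hdim_def by (metis bit_take_bit_iff take_bit_nat_eq_self)
  \<comment> \<open>The relation is read at \<open>?q\<close>, the state \<open>r\<close> with one
    occupied site emptied: the annihilator leads from \<open>r\<close> to \<open>?q\<close>, while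
    it kills the vacuum.\<close>
  have vac: "W $$ (r, 0) = 0" if r: "r < ?d" "r \<noteq> 0" for r
  proof -
    obtain j where j: "bit r j" using r(2) by (metis bit_eqI bit_0_eq bot_apply bot_bool_def)
    have jl: "j < 2 * L" using bitlt[OF j r(1)] .
    let ?A = "\<lambda>b. if b then 1 else 0 :: complex"
    let ?q = "flip_bit j r"
    have q: "?q < ?d" using r jl flip_less by (simp add: hdim_def)
    have z: "0 < ?d" by (simp add: hdim_def)
    have "(jw_op L ?A j * W) $$ (?q, 0) = (W * jw_op L ?A j) $$ (?q, 0)"
      using c1[of "Suc j"] jl by (simp add: cop_eq_jw_op)
    then show ?thesis using left[OF jl q z, of ?A] right[OF jl q z, of ?A] j nz
      by (simp add: bit_flip_bit_iff flip_flip)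
  qed
  \<comment> \<open>Emptying an occupied site of \<open>s\<close> gives a smaller number, so strong
    induction applies. If site \<open>j\<close> is empty in \<open>r\<close>, the creator cannot
    reach \<open>r\<close> and the entry vanishes; otherwise the induction hypothesis at
    \<open>flip_bit j r\<close> decides.\<close>
  have col: "W $$ (r, s) = (if r = s then W $$ (0,0) else 0)" if "s < ?d" "r < ?d" for r s
    using that
  proof (induction s arbitrary: r rule: less_induct)
    case (less s)
    show ?case
    proof (cases "s = 0")
      case True then show ?thesis using vac less.prems by auto
    next
      case False
      then obtain j where j: "bit s j" by (metis bit_eqI bit_0_eq bot_apply bot_bool_def)
      have jl: "j < 2 * L" using bitlt[OF j] less.prems by blast
      let ?C = "\<lambda>b. if b then 0 else 1 :: complex"
      let ?q = "flip_bit j s"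
      have q: "?q < ?d" using less.prems jl flip_less by (simp add: hdim_def)
      have lt: "?q < s" using flip_set_bit[OF j] False by simp
      have fr: "flip_bit j r < ?d" using less.prems jl flip_less by (simp add: hdim_def)
      have "(jw_op L ?C j * W) $$ (r, ?q) = (W * jw_op L ?C j) $$ (r, ?q)"
        using c2[of "Suc j"] jl by (simp add: cop_transpose_eq_jw_op)
      then have e: "?C (\<not> bit r j) * jsign j r * W $$ (flip_bit j r, ?q) = W $$ (r, s) * jsign j s"
        using left[OF jl less.prems(2) q, of ?C] right[OF jl less.prems(2) q, of ?C] j
        by (simp add: bit_flip_bit_iff flip_flip jsign_flip_same)
      have "flip_bit j r = flip_bit j s \<longleftrightarrow> r = s" by (metis flip_flip)
      then have "W $$ (flip_bit j r, ?q) = (if r = s then W $$ (0,0) else 0)"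
        using less.IH[OF lt q fr] by simp
      then show ?thesis using e nz[of j s] j by (auto split: if_splits)
    qed
  qed
  have "W = W $$ (0,0) \<cdot>\<^sub>m 1\<^sub>m ?d"
  proof (rule eq_matI)
    fix r s assume "r < dim_row (W $$ (0,0) \<cdot>\<^sub>m 1\<^sub>m ?d)" "s < dim_col (W $$ (0,0) \<cdot>\<^sub>m 1\<^sub>m ?d)"
    then show "W $$ (r,s) = (W $$ (0,0) \<cdot>\<^sub>m 1\<^sub>m ?d) $$ (r,s)"
      using col[of s r] by simp
  qed (use W in auto)
  then show ?thesis by blast
qed

section \<open>Linear combinations of fermions\<close>

definition lin_ff :: "nat \<Rightarrow> (nat \<Rightarrow> complex) \<Rightarrow> complex mat" where
  "lin_ff L a = msum (hdim L) (\<lambda>k. a k \<cdot>\<^sub>m ff L k) {1..2 * L}"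

definition lin_ffd :: "nat \<Rightarrow> (nat \<Rightarrow> complex) \<Rightarrow> complex mat" where
  "lin_ffd L a = msum (hdim L) (\<lambda>k. a k \<cdot>\<^sub>m ffd L k) {1..2 * L}"

text \<open>The scalar to which the anticommutator of \<open>lin_ff L a\<close> and
  \<open>lin_ffd L b\<close> evaluates. It is bilinear, without conjugation, and carries the
  alternating sign of the chain.\<close>

definition pairing :: "nat \<Rightarrow> (nat \<Rightarrow> complex) \<Rightarrow> (nat \<Rightarrow> complex) \<Rightarrow> complex" where
  "pairing L a b = (\<Sum>k\<in>{1..2 * L}. (- 1) ^ k * a k * b k)"

lemma ff_eq_jw_op: "ff L k = jw_op L (\<lambda>b. if b then 1 else 0) (k - 1)"
  by (simp add: ff_def cop_eq_jw_op)

lemma ffd_eq_jw_op: "ffd L k = (- 1) ^ k \<cdot>\<^sub>m jw_op L (\<lambda>b. if b then 0 else 1) (k - 1)"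
  by (simp add: ffd_def cop_transpose_eq_jw_op)

lemma ff_carrier [simp]: "ff L k \<in> carrier_mat (hdim L) (hdim L)"
  by (simp add: ff_def cop_eq_jw_op)

lemma ffd_carrier [simp]: "ffd L k \<in> carrier_mat (hdim L) (hdim L)"
  by (simp add: ffd_def cop_transpose_eq_jw_op)

lemma msum_carrier [simp]: "msum d F K \<in> carrier_mat d d"
  by (simp add: msum_def)

lemma lin_ff_carrier [simp]: "lin_ff L a \<in> carrier_mat (hdim L) (hdim L)"
  by (simp add: lin_ff_def)

lemma lin_ffd_carrier [simp]: "lin_ffd L a \<in> carrier_mat (hdim L) (hdim L)"
  by (simp add: lin_ffd_def)

lemma msum_mult_index:
  assumes "\<And>k. k \<in> K \<Longrightarrow> F k \<in> carrier_mat d d" "\<And>k. k \<in> K \<Longrightarrow> G k \<in> carrier_mat d d"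
    and "r < d" "s < d"
  shows "(msum d (\<lambda>k. a k \<cdot>\<^sub>m F k) K * msum d (\<lambda>k. b k \<cdot>\<^sub>m G k) K) $$ (r, s)
    = (\<Sum>k\<in>K. \<Sum>l\<in>K. a k * b l * (F k * G l) $$ (r, s))"
proof -
  have e: "(a k \<cdot>\<^sub>m F k) $$ (r, t) = a k * F k $$ (r, t)" "(b k \<cdot>\<^sub>m G k) $$ (t, s) = b k * G k $$ (t, s)"
    if "k \<in> K" "t < d" for k t
    using that assms(3,4) carrier_matD[OF assms(1)] carrier_matD[OF assms(2)] by auto
  have "(msum d (\<lambda>k. a k \<cdot>\<^sub>m F k) K * msum d (\<lambda>k. b k \<cdot>\<^sub>m G k) K) $$ (r, s)
     = (\<Sum>t<d. (\<Sum>k\<in>K. a k * F k $$ (r,t)) * (\<Sum>l\<in>K. b l * G l $$ (t,s)))"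
    using assms(3,4) by (simp add: msum_def scalar_prod_def lessThan_atLeast0 e del: index_smult_mat)
  also have "\<dots> = (\<Sum>t<d. \<Sum>k\<in>K. \<Sum>l\<in>K. a k * b l * (F k $$ (r,t) * G l $$ (t,s)))"
    by (simp add: sum_product algebra_simps)
  also have "\<dots> = (\<Sum>k\<in>K. \<Sum>l\<in>K. \<Sum>t<d. a k * b l * (F k $$ (r,t) * G l $$ (t,s)))"
    by (subst sum.swap, intro sum.cong refl, rule sum.swap)
  also have "\<dots> = (\<Sum>k\<in>K. \<Sum>l\<in>K. a k * b l * (F k * G l) $$ (r, s))"
  proof (intro sum.cong refl)
    fix k l assume "k \<in> K" "l \<in> K"
    then show "(\<Sum>t<d. a k * b l * (F k $$ (r,t) * G l $$ (t,s))) = a k * b l * (F k * G l) $$ (r, s)"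
      using assms(3,4) carrier_matD[OF assms(1)[of k]] carrier_matD[OF assms(2)[of l]]
      by (simp add: scalar_prod_def lessThan_atLeast0 sum_distrib_left)
  qed
  finally show ?thesis .
qed

lemma msum_anticommutator:
  assumes "\<And>k. k \<in> K \<Longrightarrow> F k \<in> carrier_mat d d" "\<And>k. k \<in> K \<Longrightarrow> G k \<in> carrier_mat d d"
    and "\<And>k l. k \<in> K \<Longrightarrow> l \<in> K \<Longrightarrow> F k * G l + G l * F k = h k l \<cdot>\<^sub>m 1\<^sub>m d"
  shows "msum d (\<lambda>k. a k \<cdot>\<^sub>m F k) K * msum d (\<lambda>k. b k \<cdot>\<^sub>m G k) K
       + msum d (\<lambda>k. b k \<cdot>\<^sub>m G k) K * msum d (\<lambda>k. a k \<cdot>\<^sub>m F k) K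
       = (\<Sum>k\<in>K. \<Sum>l\<in>K. a k * b l * h k l) \<cdot>\<^sub>m 1\<^sub>m d" (is "?X * ?Y + ?Y * ?X = ?c \<cdot>\<^sub>m _")
proof (rule eq_matI)
  fix r s assume "r < dim_row (?c \<cdot>\<^sub>m 1\<^sub>m d)" "s < dim_col (?c \<cdot>\<^sub>m 1\<^sub>m d)"
  then have rs: "r < d" "s < d" by auto
  have e: "(F k * G l) $$ (r,s) + (G l * F k) $$ (r,s) = h k l * 1\<^sub>m d $$ (r,s)" if "k \<in> K" "l \<in> K" for k l
  proof -
    have "(F k * G l + G l * F k) $$ (r,s) = h k l * 1\<^sub>m d $$ (r,s)"
      using assms(3)[OF that] rs by simp
    then show ?thesis
      using assms(1)[OF that(1)] assms(2)[OF that(2)] rs by (simp del: index_mult_mat(1))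
  qed
  have "(?X * ?Y + ?Y * ?X) $$ (r,s) = (?X * ?Y) $$ (r,s) + (?Y * ?X) $$ (r,s)"
    using rs by (subst index_add_mat) (auto simp: msum_def)
  also have "\<dots> = (\<Sum>k\<in>K. \<Sum>l\<in>K. a k * b l * (F k * G l) $$ (r, s))
       + (\<Sum>l\<in>K. \<Sum>k\<in>K. b l * a k * (G l * F k) $$ (r, s))"
    using assms(1,2) rs by (simp only: msum_mult_index)
  also have "(\<Sum>l\<in>K. \<Sum>k\<in>K. b l * a k * (G l * F k) $$ (r, s))
      = (\<Sum>k\<in>K. \<Sum>l\<in>K. b l * a k * (G l * F k) $$ (r, s))"
    by (rule sum.swap)
  also have "(\<Sum>k\<in>K. \<Sum>l\<in>K. a k * b l * (F k * G l) $$ (r, s)) + \<dots>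
     = (\<Sum>k\<in>K. \<Sum>l\<in>K. a k * b l * ((F k * G l) $$ (r, s) + (G l * F k) $$ (r,s)))"
    by (simp only: sum.distrib[symmetric] distrib_left mult.commute)
  also have "\<dots> = (\<Sum>k\<in>K. \<Sum>l\<in>K. a k * b l * (h k l * 1\<^sub>m d $$ (r,s)))"
    by (intro sum.cong refl) (simp only: e)
  also have "\<dots> = ?c * 1\<^sub>m d $$ (r,s)"
    by (simp only: sum_distrib_right mult.assoc)
  finally show "(?X * ?Y + ?Y * ?X) $$ (r,s) = (?c \<cdot>\<^sub>m 1\<^sub>m d) $$ (r,s)"
    using rs by simp
qed (auto simp: msum_def)

lemma zero_smult_one: "0 \<cdot>\<^sub>m 1\<^sub>m d = (0\<^sub>m d d :: complex mat)"
  by (rule eq_matI) auto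

lemma ff_anticommute:
  assumes "k \<in> {1..2 * L}" "l \<in> {1..2 * L}"
  shows "ff L k * ff L l + ff L l * ff L k = 0 \<cdot>\<^sub>m 1\<^sub>m (hdim L)"
proof (cases "k = l")
  case True
  with assms show ?thesis by (simp add: ff_eq_jw_op) (subst jw_op_anticommute_same[where c = 0], auto)
next
  case False
  with assms show ?thesis
    by (simp add: ff_eq_jw_op zero_smult_one) (subst jw_op_anticommute, auto)
qed

lemma smult_smult_mat: "x \<cdot>\<^sub>m (y \<cdot>\<^sub>m A) = (x * y :: complex) \<cdot>\<^sub>m A"
  by (rule eq_matI) auto

lemma smult_anticommutator:
  assumes "A \<in> carrier_mat d d" "B \<in> carrier_mat d d"
    and "A * B + B * A = c \<cdot>\<^sub>m 1\<^sub>m d"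
  shows "(x \<cdot>\<^sub>m A) * (y \<cdot>\<^sub>m B) + (y \<cdot>\<^sub>m B) * (x \<cdot>\<^sub>m A) = (x * y * c) \<cdot>\<^sub>m (1\<^sub>m d :: complex mat)"
proof -
  have "(x \<cdot>\<^sub>m A) * (y \<cdot>\<^sub>m B) = (x * y) \<cdot>\<^sub>m (A * B)" "(y \<cdot>\<^sub>m B) * (x \<cdot>\<^sub>m A) = (x * y) \<cdot>\<^sub>m (B * A)"
    using assms(1,2) by (simp_all add: mult_smult_distrib[of _ d d _ d] smult_smult_mat mult.commute
       mult_smult_assoc_mat[of _ d d _ d])
  then have "(x \<cdot>\<^sub>m A) * (y \<cdot>\<^sub>m B) + (y \<cdot>\<^sub>m B) * (x \<cdot>\<^sub>m A) = (x * y) \<cdot>\<^sub>m (A * B + B * A)"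
    using assms(1,2) by (intro eq_matI) (auto simp: algebra_simps simp del: index_mult_mat(1))
  then show ?thesis by (simp add: assms(3) smult_smult_mat)
qed

lemma smult_1_id: "1 \<cdot>\<^sub>m A = (A :: complex mat)"
  by (rule eq_matI) auto

lemma ffd_anticommute:
  assumes "k \<in> {1..2 * L}" "l \<in> {1..2 * L}"
  shows "ffd L k * ffd L l + ffd L l * ffd L k = 0 \<cdot>\<^sub>m 1\<^sub>m (hdim L)"
proof -
  let ?B = "\<lambda>k. jw_op L (\<lambda>b. if b then 0 else 1) (k - 1)"
  have "?B k * ?B l + ?B l * ?B k = 0 \<cdot>\<^sub>m 1\<^sub>m (hdim L)"
  proof (cases "k = l")
    case True
    with assms show ?thesis by (simp) (subst jw_op_anticommute_same[where c = 0], auto)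
  next
    case False
    with assms show ?thesis
      by (simp add: zero_smult_one) (subst jw_op_anticommute, auto)
  qed
  from smult_anticommutator[OF _ _ this, of "(-1)^k" "(-1)^l"] show ?thesis
    by (simp add: ffd_eq_jw_op)
qed

lemma ff_ffd_anticommute:
  assumes "k \<in> {1..2 * L}" "l \<in> {1..2 * L}"
  shows "ff L k * ffd L l + ffd L l * ff L k = (if k = l then (-1) ^ k else 0) \<cdot>\<^sub>m 1\<^sub>m (hdim L)"
proof -
  let ?A = "jw_op L (\<lambda>b. if b then 1 else 0) (k - 1)"
  let ?B = "jw_op L (\<lambda>b. if b then 0 else 1) (l - 1)"
  have "?A * ?B + ?B * ?A = (if k = l then 1 else 0) \<cdot>\<^sub>m 1\<^sub>m (hdim L)"
  proof (cases "k = l")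
    case True
    with assms show ?thesis by simp (subst jw_op_anticommute_same[where c = 1], auto)
  next
    case False
    with assms show ?thesis
      by (simp add: zero_smult_one) (subst jw_op_anticommute, auto)
  qed
  from smult_anticommutator[OF _ _ this, of 1 "(-1)^l"] show ?thesis
    by (auto simp: ffd_eq_jw_op ff_eq_jw_op smult_1_id)
qed

lemma lin_ff_anticommute: "lin_ff L a * lin_ff L b + lin_ff L b * lin_ff L a = 0\<^sub>m (hdim L) (hdim L)"
  unfolding lin_ff_def
  by (subst msum_anticommutator[where h = "\<lambda>_ _. 0"]) (auto simp: ff_anticommute zero_smult_one)

lemma lin_ffd_anticommute: "lin_ffd L a * lin_ffd L b + lin_ffd L b * lin_ffd L a = 0\<^sub>m (hdim L) (hdim L)"
  unfolding lin_ffd_def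
  by (subst msum_anticommutator[where h = "\<lambda>_ _. 0"]) (auto simp: ffd_anticommute zero_smult_one)

lemma lin_ff_lin_ffd_anticommute: "lin_ff L a * lin_ffd L b + lin_ffd L b * lin_ff L a = pairing L a b \<cdot>\<^sub>m 1\<^sub>m (hdim L)"
proof -
  have "(\<Sum>k\<in>{1..2*L}. \<Sum>l\<in>{1..2*L}. a k * b l * (if k = l then (-1) ^ k else 0)) = pairing L a b"
    unfolding pairing_def by (intro sum.cong refl) (simp add: if_distrib[of "times _"] cong: if_cong)
  then show ?thesis unfolding lin_ff_def lin_ffd_def
    by (subst msum_anticommutator[where h = "\<lambda>k l. if k = l then (-1) ^ k else 0"])
       (auto simp: ff_ffd_anticommute)
qed

lemma lin_ff_index: "r < hdim L \<Longrightarrow> s < hdim L \<Longrightarrow> lin_ff L a $$ (r, s) = (\<Sum>k\<in>{1..2 * L}. a k * ff L k $$ (r, s))"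
  unfolding lin_ff_def msum_def using ff_carrier[of L] by (auto intro!: sum.cong simp: carrier_matD[OF ff_carrier])

lemma lin_ffd_index: "r < hdim L \<Longrightarrow> s < hdim L \<Longrightarrow> lin_ffd L a $$ (r, s) = (\<Sum>k\<in>{1..2 * L}. a k * ffd L k $$ (r, s))"
  unfolding lin_ffd_def msum_def using ffd_carrier[of L] by (auto intro!: sum.cong simp: carrier_matD[OF ffd_carrier])

lemma lin_ff_dim [simp]: "dim_row (lin_ff L a) = hdim L" "dim_col (lin_ff L a) = hdim L"
  by (simp_all add: carrier_matD[OF lin_ff_carrier])

lemma lin_ffd_dim [simp]: "dim_row (lin_ffd L a) = hdim L" "dim_col (lin_ffd L a) = hdim L"
  by (simp_all add: carrier_matD[OF lin_ffd_carrier])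

lemma lin_ff_add: "lin_ff L (\<lambda>k. a k + b k) = lin_ff L a + lin_ff L b"
  by (rule eq_matI) (auto simp: lin_ff_index sum.distrib algebra_simps)

lemma lin_ffd_add: "lin_ffd L (\<lambda>k. a k + b k) = lin_ffd L a + lin_ffd L b"
  by (rule eq_matI) (auto simp: lin_ffd_index sum.distrib algebra_simps)

lemma lin_ff_smult: "lin_ff L (\<lambda>k. c * a k) = c \<cdot>\<^sub>m lin_ff L a"
  by (rule eq_matI) (auto simp: lin_ff_index sum_distrib_left algebra_simps)

lemma lin_ffd_smult: "lin_ffd L (\<lambda>k. c * a k) = c \<cdot>\<^sub>m lin_ffd L a"
  by (rule eq_matI) (auto simp: lin_ffd_index sum_distrib_left algebra_simps)

lemma lin_ff_cong: "(\<And>k. k \<in> {1..2 * L} \<Longrightarrow> a k = b k) \<Longrightarrow> lin_ff L a = lin_ff L b"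
  by (rule eq_matI) (auto simp: lin_ff_index intro!: sum.cong)

lemma lin_ffd_cong: "(\<And>k. k \<in> {1..2 * L} \<Longrightarrow> a k = b k) \<Longrightarrow> lin_ffd L a = lin_ffd L b"
  by (rule eq_matI) (auto simp: lin_ffd_index intro!: sum.cong)

lemma lin_ff_delta: "j \<in> {1..2 * L} \<Longrightarrow> lin_ff L (\<lambda>k. if k = j then 1 else 0) = ff L j"
  by (rule eq_matI) (auto simp: lin_ff_index carrier_matD[OF ff_carrier] if_distrib[of "\<lambda>x. x * _"] cong: if_cong)

lemma lin_ffd_delta: "j \<in> {1..2 * L} \<Longrightarrow> lin_ffd L (\<lambda>k. if k = j then 1 else 0) = ffd L j"
  by (rule eq_matI) (auto simp: lin_ffd_index carrier_matD[OF ffd_carrier] if_distrib[of "\<lambda>x. x * _"] cong: if_cong)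

section \<open>Algebra of square matrices with scalar anticommutators\<close>

lemma matrix_distrib:
  fixes A B C :: "complex mat"
  assumes "A \<in> carrier_mat d d" "B \<in> carrier_mat d d" "C \<in> carrier_mat d d"
  shows "(A + B) * C = A * C + B * C" "A * (B + C) = A * B + A * C"
    "(A - B) * C = A * C - B * C" "A * (B - C) = A * B - A * C"
    "(A * B) * C = A * (B * C)"
  using assms
  by (simp_all add: add_mult_distrib_mat[of _ d d _ _ d] mult_add_distrib_mat[of _ d d _ d]
      minus_mult_distrib_mat[of _ d d _ _ d] mult_minus_distrib_mat[of _ d d _ d])

lemma matrix_smult:
  fixes A B :: "complex mat"
  assumes "A \<in> carrier_mat d d" "B \<in> carrier_mat d d"
  shows "(c \<cdot>\<^sub>m A) * B = c \<cdot>\<^sub>m (A * B)" "A * (c \<cdot>\<^sub>m B) = c \<cdot>\<^sub>m (A * B)"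
  using assms by (simp_all add: mult_smult_distrib[of _ d d _ d] mult_smult_assoc_mat[of _ d d _ d])

lemma anticommute_swap:
  fixes A B :: "complex mat"
  assumes "A \<in> carrier_mat d d" "B \<in> carrier_mat d d" "A * B + B * A = c \<cdot>\<^sub>m 1\<^sub>m d"
  shows "A * B = c \<cdot>\<^sub>m 1\<^sub>m d - B * A"
proof -
  have "A * B = (A * B + B * A) - B * A"
    using assms(1,2) by (intro eq_matI) (auto simp del: index_mult_mat(1))
  then show ?thesis by (simp add: assms(3))
qed

text \<open>Moving the inner factors past each other leaves one contraction in each product. The
  remaining quartic term is \<open>C * A * (D * B)\<close> both times, since exchanging
  \<open>A\<close> with \<open>C\<close> and \<open>B\<close> with \<open>D\<close> costs two signs,
  so it cancels in the difference.\<close>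

lemma commutator_bilinear:
  fixes A B C D :: "complex mat"
  assumes c: "A \<in> carrier_mat d d" "B \<in> carrier_mat d d" "C \<in> carrier_mat d d" "D \<in> carrier_mat d d"
    and BC: "B * C + C * B = b \<cdot>\<^sub>m 1\<^sub>m d" and DA: "D * A + A * D = a \<cdot>\<^sub>m 1\<^sub>m d"
    and AC: "A * C + C * A = 0\<^sub>m d d" and BD: "B * D + D * B = 0\<^sub>m d d"
  shows "(A * B) * (C * D) - (C * D) * (A * B) = b \<cdot>\<^sub>m (A * D) - a \<cdot>\<^sub>m (C * B)"
proof -
  note ring = matrix_distrib[where d = d] matrix_smult[where d = d] left_mult_one_mat[where nr = d and nc = d] right_mult_one_mat[where nr = d and nc = d] mult_carrier_mat[where n = d and nr = d and nc = d]
  have AC': "A * C = (- 1) \<cdot>\<^sub>m (C * A)" and BD': "B * D = (- 1) \<cdot>\<^sub>m (D * B)"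
    using anticommute_swap[OF c(1,3), of 0] anticommute_swap[OF c(2,4), of 0] AC BD c
    by (auto simp: zero_smult_one intro!: eq_matI simp del: index_mult_mat(1))
  have "(A * B) * (C * D) = A * (B * C) * D" using c by (simp add: ring)
  also have "\<dots> = b \<cdot>\<^sub>m (A * D) - A * C * (B * D)"
    using c by (simp add: anticommute_swap[OF _ _ BC] ring)
  also have "A * C * (B * D) = C * A * (D * B)"
    unfolding AC' BD' using c by (simp add: ring smult_smult_mat smult_1_id)
  finally have 1: "(A * B) * (C * D) = b \<cdot>\<^sub>m (A * D) - C * A * (D * B)" .
  have "(C * D) * (A * B) = C * (D * A) * B" using c by (simp add: ring)
  also have "\<dots> = a \<cdot>\<^sub>m (C * B) - C * A * (D * B)"
    using c by (simp add: anticommute_swap[OF _ _ DA] ring)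
  finally show ?thesis unfolding 1 using c by (intro eq_matI) (auto simp del: index_mult_mat(1))
qed

section \<open>Quadratic operators and the symplectic form\<close>

lemma assoc_alg_diff: "x \<in> assoc_alg d G \<Longrightarrow> y \<in> assoc_alg d G \<Longrightarrow> x - y \<in> assoc_alg d G"
proof -
  assume a: "x \<in> assoc_alg d G" "y \<in> assoc_alg d G"
  have "x - y = x + (- 1) \<cdot>\<^sub>m y" by (rule eq_matI) auto
  then show ?thesis using a by (metis assoc_alg.add assoc_alg.smult)
qed

lemma assoc_alg_scale_cancel:
  assumes "c \<cdot>\<^sub>m x \<in> assoc_alg d G" "c \<noteq> 0"
  shows "x \<in> assoc_alg d G"
  using assoc_alg.smult[OF assms(1), of "1 / c"] assms(2) by (simp add: smult_smult_mat smult_1_id)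

lemma assoc_alg_subset:
  assumes "\<And>x. x \<in> G \<Longrightarrow> x \<in> assoc_alg d H"
  shows "assoc_alg d G \<subseteq> assoc_alg d H"
proof
  fix x assume "x \<in> assoc_alg d G"
  then show "x \<in> assoc_alg d H" by induction (auto intro: assms assoc_alg.intros)
qed

text \<open>Brackets are differences of products, so closing the generators under them first adds
  nothing to the associative algebra. From here on only \<open>SN_gens\<close> has to be
  considered.\<close>

lemma assoc_alg_lie_alg: "assoc_alg d (lie_alg G) = assoc_alg d G"
proof
  have "x \<in> assoc_alg d G" if "x \<in> lie_alg G" for x
    using that by induction (auto intro: assoc_alg.intros assoc_alg_diff)
  then show "assoc_alg d (lie_alg G) \<subseteq> assoc_alg d G" by (rule assoc_alg_subset)
  show "assoc_alg d G \<subseteq> assoc_alg d (lie_alg G)"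
    by (rule assoc_alg_subset) (auto intro: assoc_alg.gen lie_alg.gen)
qed

definition prev_site :: "nat \<Rightarrow> nat \<Rightarrow> nat" where
  "prev_site L k = (if k = 1 then 2 * L else k - 1)"

text \<open>Here \<open>a\<close> holds coordinates in the formal basis \<open>w\<^sub>j\<close>.
  The fermion at site \<open>k\<close> occurs in the vectors of site \<open>k\<close> and of the
  preceding site, whence its coefficient.\<close>

definition neighbour_sum :: "nat \<Rightarrow> (nat \<Rightarrow> complex) \<Rightarrow> nat \<Rightarrow> complex" where
  "neighbour_sum L a k = a k + a (prev_site L k)"

text \<open>The sign \<open>(-1) ^ j\<close> attached to the conjugate fermions alternates, so two
  consecutive vectors contribute to a common site with opposite signs. This persists across the
  boundary because the number of sites is even.\<close>

definition neighbour_diff :: "nat \<Rightarrow> (nat \<Rightarrow> complex) \<Rightarrow> nat \<Rightarrow> complex" where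
  "neighbour_diff L a k = (- 1) ^ k * (a k - a (prev_site L k))"

definition sform :: "nat \<Rightarrow> (nat \<Rightarrow> complex) \<Rightarrow> (nat \<Rightarrow> complex) \<Rightarrow> complex" where
  "sform L a b = pairing L (neighbour_sum L a) (neighbour_diff L b)"

definition sym_quad :: "nat \<Rightarrow> (nat \<Rightarrow> complex) \<Rightarrow> (nat \<Rightarrow> complex) \<Rightarrow> complex mat" where
  "sym_quad L a b = lin_ff L (neighbour_sum L a) * lin_ffd L (neighbour_diff L b) + lin_ff L (neighbour_sum L b) * lin_ffd L (neighbour_diff L a)"

definition delta :: "nat \<Rightarrow> nat \<Rightarrow> complex" where
  "delta j k = (if k = j then 1 else 0)"

lemma prev_site_range: "k \<in> {1..2 * L} \<Longrightarrow> prev_site L k \<in> {1..2 * L}"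
  by (auto simp: prev_site_def)

lemma sum_prev_site: "(\<Sum>k\<in>{1..2 * L}. g (prev_site L k)) = (\<Sum>k\<in>{1..2 * L}. g k)"
  by (rule sum.reindex_bij_witness[where i = "nxt L" and j = "prev_site L"])
     (auto simp: prev_site_def nxt_def split: if_splits)

text \<open>The sign in \<open>pairing\<close> cancels that in \<open>neighbour_diff\<close>. When
  the two orders are added, the mixed terms cancel and \<open>2 * (a k * b k)\<close> minus its
  translate by one site remains, which sums to 0 around the ring.\<close>

lemma sform_antisym: "sform L a b = - sform L b a"
proof -
  have sq: "(- 1) ^ k * x * ((- 1) ^ k * y) = x * (y :: complex)" for k x y
    by (simp flip: power_mult_distrib add: algebra_simps)
  have e: "sform L a b = (\<Sum>k\<in>{1..2 * L}. (a k + a (prev_site L k)) * (b k - b (prev_site L k)))" for a b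
    unfolding sform_def pairing_def neighbour_sum_def neighbour_diff_def by (simp only: sq)
  have "sform L a b + sform L b a = (\<Sum>k\<in>{1..2 * L}. 2 * (a k * b k)) - (\<Sum>k\<in>{1..2 * L}. 2 * (a (prev_site L k) * b (prev_site L k)))"
    unfolding e sum.distrib[symmetric] sum_subtractf[symmetric] by (intro sum.cong) (auto simp: algebra_simps)
  also have "\<dots> = 0" using sum_prev_site[where g = "\<lambda>k. 2 * (a k * b k)"] by simp
  finally show ?thesis by (simp add: eq_neg_iff_add_eq_0)
qed

lemma sym_quad_carrier [simp]: "sym_quad L a b \<in> carrier_mat (hdim L) (hdim L)"
  by (simp add: sym_quad_def mult_carrier_mat[where n = "hdim L"])

lemma sym_quad_commute: "sym_quad L a b = sym_quad L b a"
  unfolding sym_quad_def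
  by (rule comm_add_mat) (auto simp: mult_carrier_mat[where n = "hdim L"])

lemma neighbour_sum_linear: "neighbour_sum L (\<lambda>k. a k + b k) = (\<lambda>k. neighbour_sum L a k + neighbour_sum L b k)" "neighbour_sum L (\<lambda>k. c * a k) = (\<lambda>k. c * neighbour_sum L a k)"
  by (auto simp: neighbour_sum_def algebra_simps)

lemma neighbour_diff_linear: "neighbour_diff L (\<lambda>k. a k + b k) = (\<lambda>k. neighbour_diff L a k + neighbour_diff L b k)" "neighbour_diff L (\<lambda>k. c * a k) = (\<lambda>k. c * neighbour_diff L a k)"
  by (auto simp: neighbour_diff_def algebra_simps)

lemma sym_quad_add: "sym_quad L (\<lambda>k. a k + b k) c = sym_quad L a c + sym_quad L b c"
  unfolding sym_quad_def neighbour_sum_linear neighbour_diff_linear lin_ff_add lin_ffd_add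
  by (simp add: matrix_distrib[where d = "hdim L"] matrix_smult[where d = "hdim L"], intro eq_matI) (auto simp del: index_mult_mat(1))

lemma sym_quad_smult: "sym_quad L (\<lambda>k. x * a k) c = x \<cdot>\<^sub>m sym_quad L a c"
  unfolding sym_quad_def neighbour_sum_linear neighbour_diff_linear lin_ff_smult lin_ffd_smult
  by (simp add: matrix_distrib[where d = "hdim L"] matrix_smult[where d = "hdim L"], intro eq_matI) (auto simp: algebra_simps simp del: index_mult_mat(1))

lemma sym_quad_cong:
  assumes "\<And>k. k \<in> {1..2 * L} \<Longrightarrow> a k = b k"
  shows "sym_quad L a c = sym_quad L b c"
proof -
  have "lin_ff L (neighbour_sum L a) = lin_ff L (neighbour_sum L b)" "lin_ffd L (neighbour_diff L a) = lin_ffd L (neighbour_diff L b)"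
    by (intro lin_ff_cong lin_ffd_cong; simp only: neighbour_sum_def neighbour_diff_def assms prev_site_range)+
  then show ?thesis by (simp add: sym_quad_def)
qed

lemma sym_quad_self: "sym_quad L a a = 2 \<cdot>\<^sub>m (lin_ff L (neighbour_sum L a) * lin_ffd L (neighbour_diff L a))"
  unfolding sym_quad_def by (rule eq_matI) auto

text \<open>Each of the two products in \<open>sym_quad L a b\<close> has two contractions with
  \<open>c\<close>. Antisymmetry of \<open>sform\<close> gives the four terms the signs with which
  they regroup into symmetric products. The second factor is a square because the
  \<open>ee L j\<close> are multiples of squares.\<close>

lemma sym_quad_commutator:
  "sym_quad L a b * sym_quad L c c - sym_quad L c c * sym_quad L a b = (- 2 * sform L b c) \<cdot>\<^sub>m sym_quad L a c + (- 2 * sform L a c) \<cdot>\<^sub>m sym_quad L b c"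
proof -
  let ?d = "hdim L"
  let ?A = "\<lambda>x. lin_ff L (neighbour_sum L x)" and ?B = "\<lambda>x. lin_ffd L (neighbour_diff L x)"
  note ring = matrix_distrib[where d = ?d] matrix_smult[where d = ?d] mult_carrier_mat[where n = ?d and nr = ?d and nc = ?d]
  have AB: "?A x * ?B y + ?B y * ?A x = sform L x y \<cdot>\<^sub>m 1\<^sub>m ?d" for x y
    unfolding sform_def by (rule lin_ff_lin_ffd_anticommute)
  have BA: "?B y * ?A x + ?A x * ?B y = sform L x y \<cdot>\<^sub>m 1\<^sub>m ?d" for x y
    using AB[of x y] by (subst comm_add_mat[of _ ?d ?d]) (auto simp: ring)
  have q: "(?A x * ?B y) * (?A c * ?B c) - (?A c * ?B c) * (?A x * ?B y)
     = (sform L c y) \<cdot>\<^sub>m (?A x * ?B c) - sform L x c \<cdot>\<^sub>m (?A c * ?B y)" for x y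
    by (rule commutator_bilinear[OF lin_ff_carrier lin_ffd_carrier lin_ff_carrier lin_ffd_carrier BA BA lin_ff_anticommute lin_ffd_anticommute])
  define P Q R where "P = ?A a * ?B b" and "Q = ?A b * ?B a" and "R = ?A c * ?B c"
  have c: "P \<in> carrier_mat ?d ?d" "Q \<in> carrier_mat ?d ?d" "R \<in> carrier_mat ?d ?d"
    by (simp_all add: P_def Q_def R_def ring)
  have "sym_quad L a b * sym_quad L c c - sym_quad L c c * sym_quad L a b = 2 \<cdot>\<^sub>m ((P * R - R * P) + (Q * R - R * Q))"
    unfolding sym_quad_self sym_quad_def[of L a b] P_def[symmetric] Q_def[symmetric] R_def[symmetric]
    using c by (simp add: ring) (intro eq_matI; auto simp: algebra_simps simp del: index_mult_mat(1))
  also have "\<dots> = (- 2 * sform L b c) \<cdot>\<^sub>m sym_quad L a c + (- 2 * sform L a c) \<cdot>\<^sub>m sym_quad L b c"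
    unfolding P_def Q_def R_def q sform_antisym[of L c] sym_quad_def
    by (intro eq_matI) (auto simp: algebra_simps simp del: index_mult_mat(1))
  finally show ?thesis .
qed

text \<open>Coefficient vectors are functions on all of \<open>nat\<close>, while the operators see
  only the sites of the ring; \<open>cong\<close> bridges the two. The zero vector that starts the
  induction is 0 times \<open>delta 1\<close>, for which a site must exist.\<close>

lemma coefficient_induct:
  assumes cong: "\<And>a b. (\<And>k. k \<in> {1..2 * L} \<Longrightarrow> a k = b k) \<Longrightarrow> P a \<Longrightarrow> P b"
    and add: "\<And>a b. P a \<Longrightarrow> P b \<Longrightarrow> P (\<lambda>k. a k + b k)"
    and smult: "\<And>c a. P a \<Longrightarrow> P (\<lambda>k. c * a k)"
    and base: "\<And>j. j \<in> {1..2 * L} \<Longrightarrow> P (delta j)"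
    and "L > 0"
  shows "P a"
proof -
  have "P (\<lambda>k. if k \<in> S then a k else 0)" if "finite S" "S \<subseteq> {1..2 * L}" for S
    using that
  proof (induction S)
    case empty
    have "P (\<lambda>k. 0 * delta 1 k)" by (intro smult base) (use \<open>L > 0\<close> in auto)
    then show ?case by (simp)
  next
    case (insert j S)
    then have "P (\<lambda>k. (if k \<in> S then a k else 0) + a j * delta j k)"
      using add smult base by auto
    moreover have "(\<lambda>k. (if k \<in> S then a k else 0) + a j * delta j k) = (\<lambda>k. if k \<in> insert j S then a k else 0)"
      using insert.hyps by (auto simp: delta_def)
    ultimately show ?case by simp
  qed
  from this[of "{1..2 * L}"] show ?thesis by (auto intro: cong[rotated])
qed

lemma neighbour_sum_delta: "j \<in> {1..2 * L} \<Longrightarrow> k \<in> {1..2 * L} \<Longrightarrow> L > 0 \<Longrightarrow> neighbour_sum L (delta j) k = delta j k + delta (nxt L j) k"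
  by (auto simp: neighbour_sum_def delta_def prev_site_def nxt_def)

lemma neighbour_diff_delta: "j \<in> {1..2 * L} \<Longrightarrow> k \<in> {1..2 * L} \<Longrightarrow> L > 0 \<Longrightarrow>
    neighbour_diff L (delta j) k = (- 1) ^ j * (delta j k + delta (nxt L j) k)"
  by (auto simp: neighbour_diff_def delta_def prev_site_def nxt_def)

lemma delta_generator:
  assumes "j \<in> {1..2 * L}" "L > 0"
  shows "lin_ff L (neighbour_sum L (delta j)) * lin_ffd L (neighbour_diff L (delta j)) = (- 1) ^ j \<cdot>\<^sub>m ee L j"
proof -
  have n: "nxt L j \<in> {1..2 * L}" using assms by (auto simp: nxt_def)
  have 1: "lin_ff L (neighbour_sum L (delta j)) = ff L j + ff L (nxt L j)"
    using assms n lin_ff_cong[OF neighbour_sum_delta[OF assms(1) _ assms(2)]]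
    by (simp add: lin_ff_add) (simp add: lin_ff_delta delta_def[abs_def])
  have 2: "lin_ffd L (neighbour_diff L (delta j)) = (-1) ^ j \<cdot>\<^sub>m (ffd L j + ffd L (nxt L j))"
    using assms n lin_ffd_cong[OF neighbour_diff_delta[OF assms(1) _ assms(2)]]
    by (simp add: lin_ffd_add lin_ffd_smult) (simp add: lin_ffd_delta delta_def[abs_def])
  show ?thesis unfolding 1 2 ee_def by (subst matrix_smult(2)[where d = "hdim L"]) auto
qed

text \<open>The two vectors overlap in the single site \<open>Suc j\<close>, where the signs
  multiply to 1. On a ring of two sites they would overlap twice, hence
  \<open>L \<ge> 2\<close>.\<close>

lemma sform_delta_adjacent:
  assumes "1 \<le> j" "j < 2 * L" "L \<ge> 2"
  shows "sform L (delta j) (delta (Suc j)) = 1"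
proof -
  have "sform L (delta j) (delta (Suc j)) = (\<Sum>k\<in>{1..2 * L}. if k = Suc j then 1 else 0)"
    unfolding sform_def pairing_def
  proof (intro sum.cong refl)
    fix k assume k: "k \<in> {1..2 * L}"
    then show "(- 1) ^ k * neighbour_sum L (delta j) k * neighbour_diff L (delta (Suc j)) k = (if k = Suc j then 1 else 0)"
      using assms by (simp add: neighbour_sum_delta neighbour_diff_delta) (auto simp: delta_def nxt_def simp flip: power_add split: if_splits)
  qed
  also have "\<dots> = 1" using assms by simp
  finally show ?thesis .
qed

lemma sym_quad_in_assoc_alg:
  assumes "L \<ge> 2" and gens: "\<And>j. j \<in> {1..2 * L} \<Longrightarrow> ee L j \<in> assoc_alg (hdim L) G"
  shows "sym_quad L a b \<in> assoc_alg (hdim L) G"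
proof -
  let ?S = "assoc_alg (hdim L) G"
  have diag: "sym_quad L (delta j) (delta j) \<in> ?S" if "j \<in> {1..2 * L}" for j
    unfolding sym_quad_self using that assms(1) by (simp add: delta_generator) (intro assoc_alg.smult gens, simp)
  \<comment> \<open>Bracketing with the square of \<open>c\<close> replaces \<open>b\<close> by
    \<open>c\<close>, up to a multiple of \<open>sym_quad L b c\<close>, which is subtracted
    again.\<close>
  have advance: "sym_quad L a c \<in> ?S" if "sym_quad L a b \<in> ?S" "sym_quad L c c \<in> ?S" "sym_quad L b c \<in> ?S" "sform L b c = 1" for a b c
  proof -
    have "(- 2 * sform L b c) \<cdot>\<^sub>m sym_quad L a c + (- 2 * sform L a c) \<cdot>\<^sub>m sym_quad L b c \<in> ?S"
      unfolding sym_quad_commutator[symmetric] using that(1,2) by (intro assoc_alg_diff assoc_alg.mult)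
    then have "((- 2 * sform L b c) \<cdot>\<^sub>m sym_quad L a c + (- 2 * sform L a c) \<cdot>\<^sub>m sym_quad L b c) - (- 2 * sform L a c) \<cdot>\<^sub>m sym_quad L b c \<in> ?S"
      using that by (blast intro: assoc_alg.smult assoc_alg_diff)
    moreover have "((- 2 * sform L b c) \<cdot>\<^sub>m sym_quad L a c + (- 2 * sform L a c) \<cdot>\<^sub>m sym_quad L b c) - (- 2 * sform L a c) \<cdot>\<^sub>m sym_quad L b c
        = (- 2) \<cdot>\<^sub>m sym_quad L a c"
      using that(4) by (intro eq_matI) (auto simp: carrier_matD[OF sym_quad_carrier])
    ultimately have "(- 2) \<cdot>\<^sub>m sym_quad L a c \<in> ?S" by simp
    then show ?thesis by (rule assoc_alg_scale_cancel) simp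
  qed
  \<comment> \<open>For two squares both terms of the commutator formula coincide, which gives the
    factor -4.\<close>
  have adj: "sym_quad L (delta j) (delta (Suc j)) \<in> ?S" if "1 \<le> j" "j < 2 * L" for j
  proof -
    have j: "j \<in> {1..2 * L}" "Suc j \<in> {1..2 * L}" using that by auto
    have s: "sform L (delta j) (delta (Suc j)) = 1" using that assms(1) by (rule sform_delta_adjacent)
    have "sym_quad L (delta j) (delta j) * sym_quad L (delta (Suc j)) (delta (Suc j))
       - sym_quad L (delta (Suc j)) (delta (Suc j)) * sym_quad L (delta j) (delta j) = (- 4) \<cdot>\<^sub>m sym_quad L (delta j) (delta (Suc j))"
      unfolding sym_quad_commutator s by (intro eq_matI) (auto simp: carrier_matD[OF sym_quad_carrier])
    then have "(- 4) \<cdot>\<^sub>m sym_quad L (delta j) (delta (Suc j)) \<in> ?S"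
      using diag[OF j(1)] diag[OF j(2)] by (metis assoc_alg.mult assoc_alg_diff)
    then show ?thesis by (rule assoc_alg_scale_cancel) simp
  qed
  \<comment> \<open>Starting from the square at \<open>i\<close>, the second slot is moved along the
    ring one site at a time.\<close>
  have le: "sym_quad L (delta i) (delta j) \<in> ?S" if "i \<le> j" "1 \<le> i" "j \<le> 2 * L" for i j
    using that
  proof (induction j rule: dec_induct)
    case base then show ?case using diag by auto
  next
    case (step j)
    show ?case
      by (rule advance[where b = "delta j"])
        (use step assms(1) in \<open>auto intro: diag adj sform_delta_adjacent\<close>)
  qed
  have dd: "sym_quad L (delta i) (delta j) \<in> ?S" if "i \<in> {1..2 * L}" "j \<in> {1..2 * L}" for i j
    using le[of i j] le[of j i] that sym_quad_commute[of L "delta i" "delta j"] by (cases "i \<le> j") auto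
  have lin: "sym_quad L a c \<in> ?S" if "\<And>j. j \<in> {1..2 * L} \<Longrightarrow> sym_quad L (delta j) c \<in> ?S" for a c
  proof (rule coefficient_induct[where P = "\<lambda>a. sym_quad L a c \<in> ?S" and L = L])
    show "sym_quad L b c \<in> ?S" if "\<And>k. k \<in> {1..2 * L} \<Longrightarrow> a k = b k" "sym_quad L a c \<in> ?S" for a b
      using sym_quad_cong[OF that(1), where c = c] that(2) by simp
  qed (use that assms(1) in \<open>auto simp: sym_quad_add sym_quad_smult intro: assoc_alg.intros\<close>)
  \<comment> \<open>Linearity is available in the first slot only; symmetry carries it over to the
    second.\<close>
  have "sym_quad L (delta j) b \<in> ?S" if "j \<in> {1..2 * L}" for j
    using lin[of "delta j" b] dd that sym_quad_commute by metis
  then show ?thesis by (rule lin)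
qed

section \<open>Fourier coefficients\<close>

text \<open>Plane wave of momentum \<open>pi * n / L\<close>. The factor \<open>i^(-k)\<close> in
  the modes shifts momenta by \<open>pi / 2\<close>, which places the coefficients on this integer
  grid for even and odd \<open>L\<close> alike.\<close>

definition wave :: "nat \<Rightarrow> int \<Rightarrow> nat \<Rightarrow> complex" where
  "wave L n k = cis (- (pi * of_int n * of_nat k / of_nat L))"

lemma wave_mult: "wave L n k * wave L m k = wave L (n + m) k"
  by (simp add: wave_def cis_mult add_divide_distrib algebra_simps)

lemma wave_half: "L > 0 \<Longrightarrow> wave L (int L) k = (- 1) ^ k"
proof -
  assume "L > 0"
  then have "wave L (int L) k = cis (- pi) ^ k" by (simp add: wave_def Complex.DeMoivre mult.commute)
  then show ?thesis by (simp add: complex_eq_iff cis.code)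
qed

lemma wave_period: "L > 0 \<Longrightarrow> wave L (n + 2 * int L) k = wave L n k"
  using wave_mult[of L n k "2 * int L"] wave_mult[of L "int L" k "int L"] wave_half[of L k]
  by (simp flip: power_add mult_2)

lemma wave_0: "wave L 0 k = 1"
  by (simp add: wave_def)

lemma wave_prev_site:
  assumes "L > 0" "k \<in> {1..2 * L}"
  shows "wave L n (prev_site L k) = cis (pi * of_int n / of_nat L) * wave L n k"
proof (cases "k = 1")
  case True
  have "cis (- (2 * pi * of_int n)) = 1" using cis_multiple_2pi[of "- of_int n"] by simp
  then show ?thesis using True assms by (simp add: prev_site_def wave_def cis_mult algebra_simps)
next
  case False
  then have "real (k - 1) = real k - 1" using assms by auto
  then have "- (pi * of_int n * real (k - 1) / real L) = pi * of_int n / real L + - (pi * of_int n * real k / real L)"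
    by (simp add: diff_divide_distrib algebra_simps)
  then show ?thesis using False by (simp add: prev_site_def wave_def cis_mult)
qed

text \<open>A step by one site leaves the sum around the ring unchanged and also multiplies it by
  \<open>?z\<close>; unless \<open>?z\<close> is 1, the sum is 0.\<close>

lemma sum_wave:
  assumes "L > 0"
  shows "(\<Sum>k\<in>{1..2 * L}. wave L n k) = (if 2 * int L dvd n then of_nat (2 * L) else 0)"
proof (cases "2 * int L dvd n")
  case True
  then obtain j where j: "n = 2 * int L * j" by (auto simp: dvd_def)
  have "wave L n k = 1" for k
  proof -
    have "- (pi * of_int n * of_nat k / of_nat L) = 2 * pi * of_int (- j * int k)"
      using assms by (simp add: j field_simps)
    then show ?thesis unfolding wave_def by (simp only: cis_multiple_2pi Ints_of_int)
  qed
  with True show ?thesis by simp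
next
  case False
  let ?z = "cis (pi * of_int n / of_nat L)"
  have "?z \<noteq> 1"
  proof
    assume "?z = 1"
    then obtain j :: int where "pi * of_int n / of_nat L = of_int j * 2 * pi"
      by (metis cis.sel(1) cos_one_2pi_int one_complex.sel(1))
    then have "of_int n = (of_int (2 * int L * j) :: real)" using assms by (simp add: field_simps)
    then show False using False by (simp only: of_int_eq_iff) simp
  qed
  moreover have "(\<Sum>k\<in>{1..2 * L}. wave L n k) = ?z * (\<Sum>k\<in>{1..2 * L}. wave L n k)"
  proof -
    have "(\<Sum>k\<in>{1..2 * L}. wave L n k) = (\<Sum>k\<in>{1..2 * L}. wave L n (prev_site L k))"
      by (rule sum_prev_site[symmetric])
    also have "\<dots> = (\<Sum>k\<in>{1..2 * L}. ?z * wave L n k)"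
      by (intro sum.cong refl wave_prev_site assms)
    also have "\<dots> = ?z * (\<Sum>k\<in>{1..2 * L}. wave L n k)"
      by (simp only: sum_distrib_left)
    finally show ?thesis .
  qed
  ultimately show ?thesis using False by simp
qed

text \<open>The alternating sign is itself the wave of index \<open>L\<close>, so the orthogonality
  relation of plane waves appears shifted by \<open>L\<close>.\<close>

lemma pairing_wave:
  assumes "L > 0"
  shows "pairing L (wave L n) (wave L m) = (if 2 * int L dvd n + m + int L then of_nat (2 * L) else 0)"
  unfolding pairing_def
  using assms by (simp add: wave_half[symmetric] wave_mult add.commute add.left_commute flip: sum_wave)

lemma pairing_linear:
  "pairing L (\<lambda>k. a k + b k) c = pairing L a c + pairing L b c"
  "pairing L c (\<lambda>k. a k + b k) = pairing L c a + pairing L c b"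
  "pairing L (\<lambda>k. x * a k) c = x * pairing L a c"
  "pairing L c (\<lambda>k. x * a k) = x * pairing L c a"
  by (simp_all add: pairing_def sum.distrib sum_distrib_left algebra_simps)

lemma fourier_induct:
  assumes "L > 0"
    and cong: "\<And>a b. (\<And>k. k \<in> {1..2 * L} \<Longrightarrow> a k = b k) \<Longrightarrow> P a \<Longrightarrow> P b"
    and add: "\<And>a b. P a \<Longrightarrow> P b \<Longrightarrow> P (\<lambda>k. a k + b k)"
    and smult: "\<And>c a. P a \<Longrightarrow> P (\<lambda>k. c * a k)"
    and base: "\<And>n. n \<in> {1..2 * L} \<Longrightarrow> P (wave L (int n))"
  shows "P a"
proof (rule coefficient_induct[where P = P and L = L, OF cong add smult])
  fix j assume j: "j \<in> {1..2 * L}"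
  have S: "P (\<lambda>k. \<Sum>n\<in>S. c n * wave L (int n) k)" if "finite S" "S \<subseteq> {1..2 * L}" for S c
    using that
  proof (induction S)
    case empty
    have "P (\<lambda>k. 0 * wave L (int 1) k)" by (intro smult base) (use \<open>L > 0\<close> in auto)
    then show ?case by simp
  next
    case (insert n S)
    then have "P (\<lambda>k. c n * wave L (int n) k + (\<Sum>n\<in>S. c n * wave L (int n) k))"
      by (intro add smult base) auto
    then show ?case using insert.hyps by simp
  qed
  show "P (delta j)"
  proof (rule cong)
    \<comment> \<open>Finite Fourier inversion writes the unit vector at \<open>j\<close> as an
      average of waves.\<close>
    show "P (\<lambda>k. 1 / of_nat (2 * L) * (\<Sum>n\<in>{1..2 * L}. wave L (- int j) n * wave L (int n) k))"
      by (intro smult S) auto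
    fix k assume k: "k \<in> {1..2 * L}"
    have "wave L (int n) k = wave L (int k) n" for n
      by (simp add: wave_def algebra_simps)
    then have e: "(\<Sum>n\<in>{1..2 * L}. wave L (- int j) n * wave L (int n) k) = (\<Sum>n\<in>{1..2 * L}. wave L (int k - int j) n)"
      by (simp add: wave_mult)
    have "2 * int L dvd int k - int j \<longleftrightarrow> k = j"
    proof
      assume d: "2 * int L dvd int k - int j"
      have "\<bar>int k - int j\<bar> < 2 * int L" using j k by auto
      then show "k = j" using dvd_imp_le_int[OF _ d] by force
    qed simp
    then show "1 / of_nat (2 * L) * (\<Sum>n\<in>{1..2 * L}. wave L (- int j) n * wave L (int n) k) = delta j k"
      unfolding e sum_wave[OF \<open>L > 0\<close>] using \<open>L > 0\<close> by (simp add: delta_def)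
  qed
qed (use assms in auto)

section \<open>Mode coefficients and their pairings\<close>

definition cot_root :: "nat \<Rightarrow> nat \<Rightarrow> complex" where "cot_root L m = cr (sqrt (cot (mom L m / 2)))"
definition tan_root :: "nat \<Rightarrow> nat \<Rightarrow> complex" where "tan_root L m = cr (sqrt (tan (mom L m / 2)))"

text \<open>One formula for four families: \<open>\<sigma>\<close> is 1 for chi and -1 for bar eta,
  and \<open>n\<close> is positive for \<open>chi\<close> and \<open>etabd\<close>, negative for
  \<open>chid\<close> and \<open>etab\<close>. The prefactor joins the \<open>1 / sqrt 2\<close> of
  the modes with the normalisation of \<open>theta\<close>.\<close>

definition mode_coeff :: "nat \<Rightarrow> complex \<Rightarrow> int \<Rightarrow> nat \<Rightarrow> complex" where
  "mode_coeff L \<sigma> n k = 1 / (cr (sqrt 2) * cr (sqrt (2 * real L)))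
     * (cot_root L (nat \<bar>n\<bar>) * wave L n k + \<sigma> * tan_root L (nat \<bar>n\<bar>) * wave L (n + int L) k)"

lemma half_mom:
  assumes "m \<in> {1..L - 1}"
  shows "0 < mom L m / 2" "mom L m / 2 < pi / 2"
  using assms by (auto simp: mom_def field_simps)

lemma half_mom_trig:
  assumes "m \<in> {1..L - 1}"
  shows "0 < sin (mom L m / 2)" "0 < cos (mom L m / 2)" "0 < tan (mom L m / 2)"
  using half_mom[OF assms] by (auto intro: sin_gt_zero_02 cos_gt_zero tan_gt_zero sin_gt_zero)

lemma cot_root_tan_root: "m \<in> {1..L - 1} \<Longrightarrow> cot_root L m * tan_root L m = 1"
  using half_mom_trig[of m L]
  by (simp add: cot_root_def tan_root_def cr_def cot_def tan_def flip: of_real_mult real_sqrt_mult)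

lemma half_mom_reflect: "m \<in> {1..L - 1} \<Longrightarrow> mom L (L - m) / 2 = pi / 2 - mom L m / 2"
  by (auto simp: mom_def field_simps of_nat_diff)

text \<open>Passing from \<open>p\<close> to \<open>pi - p\<close> reflects \<open>p / 2\<close>
  about \<open>pi / 4\<close>, which exchanges tangent and cotangent. This is what lets the barred
  modes be written with index \<open>m\<close> instead of \<open>L - m\<close>.\<close>

lemma cot_root_reflect: "m \<in> {1..L - 1} \<Longrightarrow> cot_root L (L - m) = tan_root L m" "m \<in> {1..L - 1} \<Longrightarrow> tan_root L (L - m) = cot_root L m"
  unfolding cot_root_def tan_root_def by (simp_all only: half_mom_reflect) (simp_all add: cot_def tan_def sin_diff cos_diff)

text \<open>The mixed wave products contribute when the indices are opposite, the unmixed ones when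
  \<open>\<bar>n + n'\<bar> = int L\<close>. In the second case the indices are reflections of each
  other and the roots are swapped, so every surviving weight is \<open>cot_root\<close> times
  \<open>tan_root\<close>, that is 1, and the prefactors leave one half.\<close>

lemma pairing_mode_coeff:
  assumes "L > 0" "nat \<bar>n\<bar> \<in> {1..L - 1}" "nat \<bar>n'\<bar> \<in> {1..L - 1}"
  shows "pairing L (mode_coeff L \<sigma> n) (mode_coeff L \<tau> n')
     = (if n + n' = 0 then (\<sigma> + \<tau>) / 2 else if \<bar>n + n'\<bar> = int L then (1 + \<sigma> * \<tau>) / 2 else 0)"
proof -
  define N where "N = 1 / (cr (sqrt 2) * cr (sqrt (2 * real L)))"
  have N: "N * N * of_nat (2 * L) = 1 / 2"
    using assms(1) by (simp add: N_def cr_def field_simps flip: of_real_mult) simp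
  \<comment> \<open>This bound turns divisibility by \<open>2 * int L\<close> into the few
    equalities that follow.\<close>
  have s: "\<bar>n + n'\<bar> < 2 * int L" using assms(2,3) unfolding atLeastAtMost_iff by arith
  have d1: "2 * int L dvd n + n' + 2 * int L \<longleftrightarrow> n + n' = 0"
    using s dvd_imp_le_int[of "n + n'" "2 * int L"] by force
  have d2: "2 * int L dvd n + n' + int L \<longleftrightarrow> \<bar>n + n'\<bar> = int L"
  proof
    assume "2 * int L dvd n + n' + int L"
    then obtain j where j: "n + n' + int L = 2 * int L * j" by (auto simp: dvd_def)
    have "2 * int L * j < 2 * int L * 2" "2 * int L * (-1) < 2 * int L * j"
      unfolding j[symmetric] using s assms(1) by linarith+
    then have "j = 0 \<or> j = 1" using assms(1) by (simp only: mult_less_cancel_left_pos) auto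
    then show "\<bar>n + n'\<bar> = int L" using j by auto
  next
    assume "\<bar>n + n'\<bar> = int L"
    then have "n + n' + int L = 0 \<or> n + n' + int L = 2 * int L" by linarith
    then show "2 * int L dvd n + n' + int L" by auto
  qed
  have d3: "2 * int L dvd n + n' + 3 * int L \<longleftrightarrow> 2 * int L dvd n + n' + int L"
    using dvd_add_left_iff[of "2 * int L" "2 * int L" "n + n' + int L"] by (simp add: algebra_simps)
  have r: "cot_root L (nat \<bar>n'\<bar>) = tan_root L (nat \<bar>n\<bar>) \<and> tan_root L (nat \<bar>n'\<bar>) = cot_root L (nat \<bar>n\<bar>)" if "\<bar>n + n'\<bar> = int L"
  proof -
    have "nat \<bar>n'\<bar> = L - nat \<bar>n\<bar>"
      using that assms(2,3) unfolding atLeastAtMost_iff by arith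
    then show ?thesis using cot_root_reflect assms by simp
  qed
  have i: "nat \<bar>n'\<bar> = nat \<bar>n\<bar>" if "n + n' = 0" using that by auto
  have "pairing L (mode_coeff L \<sigma> n) (mode_coeff L \<tau> n') = N * N *
    (cot_root L (nat \<bar>n\<bar>) * cot_root L (nat \<bar>n'\<bar>) * pairing L (wave L n) (wave L n')
   + \<tau> * cot_root L (nat \<bar>n\<bar>) * tan_root L (nat \<bar>n'\<bar>) * pairing L (wave L n) (wave L (n' + int L))
   + \<sigma> * tan_root L (nat \<bar>n\<bar>) * cot_root L (nat \<bar>n'\<bar>) * pairing L (wave L (n + int L)) (wave L n')
   + \<sigma> * \<tau> * tan_root L (nat \<bar>n\<bar>) * tan_root L (nat \<bar>n'\<bar>) * pairing L (wave L (n + int L)) (wave L (n' + int L)))"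
    unfolding mode_coeff_def[abs_def] N_def[symmetric] pairing_linear by (simp add: algebra_simps)
  also have "\<dots> = (N * N * of_nat (2 * L)) *
     (if n + n' = 0 then (\<tau> + \<sigma>) * (cot_root L (nat \<bar>n\<bar>) * tan_root L (nat \<bar>n\<bar>))
      else if \<bar>n + n'\<bar> = int L then (1 + \<sigma> * \<tau>) * (cot_root L (nat \<bar>n\<bar>) * tan_root L (nat \<bar>n\<bar>)) else 0)"
  proof -
    have e: "n + (n' + int L) + int L = n + n' + 2 * int L" "n + int L + n' + int L = n + n' + 2 * int L"
      "n + int L + (n' + int L) + int L = n + n' + 3 * int L" by auto
    show ?thesis
      unfolding pairing_wave[OF assms(1)] e d3 d2 d1
      using r i assms(1) by (auto simp: algebra_simps)
  qed
  finally show ?thesis using N cot_root_tan_root[OF assms(2)] by (simp add: add.commute)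
qed

section \<open>Mode operators\<close>

lemma cis_power_i: "(- \<i>) ^ k = cis (- (of_nat k * pi / 2))"
proof -
  have "- \<i> = cis (- (pi / 2))" by (simp add: complex_eq_iff)
  then show ?thesis by (simp only: Complex.DeMoivre) (simp add: algebra_simps)
qed

lemma theta_eq_lin_ff: "theta L p = lin_ff L (\<lambda>k. 1 / cr (sqrt (2 * real L)) * cis (- (of_nat k * (p + pi / 2))))"
proof -
  have "exp (- \<i> * of_nat k * of_real p) * (- \<i>) ^ k = cis (- (of_nat k * (p + pi / 2)))" for k
  proof -
    have "exp (- \<i> * of_nat k * of_real p) = cis (- (of_nat k * p))" by (simp add: cis_conv_exp algebra_simps)
    then show ?thesis by (simp add: cis_power_i cis_mult algebra_simps)
  qed
  then show ?thesis by (simp add: theta_def lin_ff_def cr_def)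
qed

lemma thetad_eq_lin_ffd: "thetad L p = lin_ffd L (\<lambda>k. 1 / cr (sqrt (2 * real L)) * cis (of_nat k * (p - pi / 2)))"
proof -
  have "exp (\<i> * of_nat k * of_real p) * (- \<i>) ^ k = cis (of_nat k * (p - pi / 2))" for k
  proof -
    have "exp (\<i> * of_nat k * of_real p) = cis (of_nat k * p)" by (simp add: cis_conv_exp algebra_simps)
    then show ?thesis by (simp add: cis_power_i cis_mult algebra_simps)
  qed
  then show ?thesis by (simp add: thetad_def lin_ffd_def cr_def)
qed

lemma theta_wave:
  assumes "L > 0"
  shows "theta L (mom L m - pi / 2) = 1 / cr (sqrt (2 * real L)) \<cdot>\<^sub>m lin_ff L (wave L (int m))"
    "theta L (mom L m + pi / 2) = 1 / cr (sqrt (2 * real L)) \<cdot>\<^sub>m lin_ff L (wave L (int m + int L))"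
    "thetad L (mom L m - pi / 2) = 1 / cr (sqrt (2 * real L)) \<cdot>\<^sub>m lin_ffd L (wave L (int L - int m))"
    "thetad L (mom L m + pi / 2) = 1 / cr (sqrt (2 * real L)) \<cdot>\<^sub>m lin_ffd L (wave L (- int m))"
proof -
  have e: "- (of_nat k * (mom L m - pi / 2 + pi / 2)) = - (pi * of_int (int m) * of_nat k / of_nat L)"
    "- (of_nat k * (mom L m + pi / 2 + pi / 2)) = - (pi * of_int (int m + int L) * of_nat k / of_nat L)"
    "of_nat k * (mom L m - pi / 2 - pi / 2) = - (pi * of_int (int L - int m) * of_nat k / of_nat L)"
    "of_nat k * (mom L m + pi / 2 - pi / 2) = - (pi * of_int (- int m) * of_nat k / of_nat L)" for k
    using assms by (simp_all add: mom_def add_divide_distrib diff_divide_distrib algebra_simps)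
  show "theta L (mom L m - pi / 2) = 1 / cr (sqrt (2 * real L)) \<cdot>\<^sub>m lin_ff L (wave L (int m))"
    "theta L (mom L m + pi / 2) = 1 / cr (sqrt (2 * real L)) \<cdot>\<^sub>m lin_ff L (wave L (int m + int L))"
    "thetad L (mom L m - pi / 2) = 1 / cr (sqrt (2 * real L)) \<cdot>\<^sub>m lin_ffd L (wave L (int L - int m))"
    "thetad L (mom L m + pi / 2) = 1 / cr (sqrt (2 * real L)) \<cdot>\<^sub>m lin_ffd L (wave L (- int m))"
    by (simp_all only: theta_eq_lin_ff thetad_eq_lin_ffd e wave_def[symmetric] lin_ff_smult lin_ffd_smult)
qed

lemma lin_ff_diff: "lin_ff L (\<lambda>k. a k - b k) = lin_ff L a - lin_ff L b"
  by (rule eq_matI) (auto simp: lin_ff_index sum_subtractf algebra_simps)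

lemma lin_ffd_diff: "lin_ffd L (\<lambda>k. a k - b k) = lin_ffd L a - lin_ffd L b"
  by (rule eq_matI) (auto simp: lin_ffd_index sum_subtractf algebra_simps)

lemma cr_div: "cr (1 / x) = 1 / cr x" by (simp add: cr_def)

lemma chi_eq_lin_ff:
  assumes "m \<in> {1..L - 1}"
  shows "chi L m = lin_ff L (mode_coeff L 1 (int m))"
proof -
  have L: "L > 0" "m \<noteq> 0" using assms by auto
  have "chi L m = lin_ff L (\<lambda>k. 1 / cr (sqrt 2) *
      (cot_root L m * (1 / cr (sqrt (2 * real L)) * wave L (int m) k)
     + tan_root L m * (1 / cr (sqrt (2 * real L)) * wave L (int m + int L) k)))"
    unfolding lin_ff_smult lin_ff_add using L
    by (simp add: chi_def Let_def theta_wave cr_div cot_root_def tan_root_def)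
  also have "\<dots> = lin_ff L (mode_coeff L 1 (int m))"
    by (rule lin_ff_cong) (simp add: mode_coeff_def algebra_simps)
  finally show ?thesis .
qed

lemma chid_eq_lin_ffd:
  assumes "m \<in> {1..L - 1}"
  shows "chid L m = lin_ffd L (mode_coeff L 1 (- int m))"
proof -
  have L: "L > 0" "m \<noteq> 0" using assms by auto
  have "chid L m = lin_ffd L (\<lambda>k. 1 / cr (sqrt 2) *
      (tan_root L m * (1 / cr (sqrt (2 * real L)) * wave L (int L - int m) k)
     + cot_root L m * (1 / cr (sqrt (2 * real L)) * wave L (- int m) k)))"
    unfolding lin_ffd_smult lin_ffd_add using L
    by (simp add: chid_def Let_def theta_wave cr_div cot_root_def tan_root_def)
  also have "\<dots> = lin_ffd L (mode_coeff L 1 (- int m))"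
    by (rule lin_ffd_cong) (simp add: mode_coeff_def algebra_simps)
  finally show ?thesis .
qed

lemma wave_int_diff: "m \<in> {1..L - 1} \<Longrightarrow> wave L (int (L - m) + int L) k = wave L (- int m) k"
proof -
  assume "m \<in> {1..L - 1}"
  then have "int (L - m) + int L = - int m + 2 * int L" "L > 0" by auto
  then show ?thesis using wave_period by metis
qed

lemma wave_int_diff': "m \<in> {1..L - 1} \<Longrightarrow> wave L (- int (L - m)) k = wave L (int m + int L) k"
proof -
  assume "m \<in> {1..L - 1}"
  then have "int m + int L = - int (L - m) + 2 * int L" "L > 0" by auto
  then show ?thesis using wave_period by metis
qed

text \<open>The barred mode is \<open>eta\<close> at \<open>L - m\<close>. Reflection swaps the
  roots, and modulo \<open>2 * L\<close> the wave indices become \<open>- m + L\<close> and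
  \<open>- m\<close>, in the order opposite to that of \<open>mode_coeff\<close>; this reversal of a
  difference produces the sign.\<close>

lemma etab_eq_lin_ff:
  assumes m: "m \<in> {1..L - 1}"
  shows "etab L m = lin_ff L (\<lambda>k. - 1 * mode_coeff L (- 1) (- int m) k)"
proof -
  have L: "L > 0" "m \<noteq> 0" "L - m \<noteq> 0" "int (L - m) = - int m + int L" using m by auto
  have "etab L m = lin_ff L (\<lambda>k. 1 / cr (sqrt 2) *
      (cot_root L (L - m) * (1 / cr (sqrt (2 * real L)) * wave L (int (L - m)) k)
     - tan_root L (L - m) * (1 / cr (sqrt (2 * real L)) * wave L (int (L - m) + int L) k)))"
    unfolding lin_ff_smult lin_ff_diff using L
    by (simp add: etab_def eta_def Let_def theta_wave cr_div cot_root_def tan_root_def)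
  also have "\<dots> = lin_ff L (\<lambda>k. - 1 * mode_coeff L (- 1) (- int m) k)"
    unfolding wave_int_diff[OF m] cot_root_reflect[OF m] unfolding mode_coeff_def L(4)
    by (rule lin_ff_cong) (simp add: algebra_simps)
  finally show ?thesis .
qed

text \<open>Here the reflected waves already come in the order of \<open>mode_coeff\<close>, so no
  sign arises, in contrast to the annihilator.\<close>

lemma etabd_eq_lin_ffd:
  assumes m: "m \<in> {1..L - 1}"
  shows "etabd L m = lin_ffd L (mode_coeff L (- 1) (int m))"
proof -
  have L: "L > 0" "m \<noteq> 0" "L - m \<noteq> 0" "int L - int (L - m) = int m" using m by auto
  have "etabd L m = lin_ffd L (\<lambda>k. 1 / cr (sqrt 2) *
      (tan_root L (L - m) * (1 / cr (sqrt (2 * real L)) * wave L (int L - int (L - m)) k)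
     - cot_root L (L - m) * (1 / cr (sqrt (2 * real L)) * wave L (- int (L - m)) k)))"
    unfolding lin_ffd_smult lin_ffd_diff using L
    by (simp add: etabd_def etad_def Let_def theta_wave cr_div cot_root_def tan_root_def)
  also have "\<dots> = lin_ffd L (mode_coeff L (- 1) (int m))"
    by (rule lin_ffd_cong) (simp add: wave_int_diff'[OF m] cot_root_reflect[OF m] mode_coeff_def L(4) algebra_simps)
  finally show ?thesis .
qed

text \<open>Modulo \<open>2 * pi\<close> the shift by \<open>pi / 2\<close> cancels the momenta in
  both definitions, so these are the uniform sums over the ring. Their partners
  \<open>chi L 0\<close> and \<open>etabd L 0\<close> alternate along the chain and do not occur in
  \<open>SN_gens\<close>.\<close>

lemma zero_modes:
  "chid L 0 = lin_ffd L (\<lambda>k. 1 / cr (sqrt (2 * real L)) * wave L 0 k)"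
  "etab L 0 = lin_ff L (\<lambda>k. 1 / cr (sqrt (2 * real L)) * wave L 0 k)"
proof -
  show "chid L 0 = lin_ffd L (\<lambda>k. 1 / cr (sqrt (2 * real L)) * wave L 0 k)"
    by (simp add: chid_def thetad_eq_lin_ffd wave_0)
  have "cis (- (real k * (3 * pi / 2 + pi / 2))) = 1" for k
    using cis_multiple_2pi[of "- of_nat k"] by (simp add: algebra_simps)
  then show "etab L 0 = lin_ff L (\<lambda>k. 1 / cr (sqrt (2 * real L)) * wave L 0 k)"
    by (simp add: etab_def eta_def theta_eq_lin_ff wave_0)
qed

text \<open>With the relative factor \<open>\<i>\<close>, the neighbour sum and the neighbour difference both become
  multiples of mode coefficients.\<close>
definition wave_pair :: "nat \<Rightarrow> int \<Rightarrow> nat \<Rightarrow> complex" where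
  "wave_pair L n k = wave L n k + \<i> * wave L (n + int L) k"

lemma cis_one_plus: "1 + cis (2 * x) = 2 * cis x * of_real (cos x)" "1 - cis (2 * x) = - 2 * \<i> * cis x * of_real (sin x)"
proof -
  have a: "cis (2 * x) = cis x * cis x" "1 = cis x * cis (- x)" by (simp_all add: cis_mult)
  have "cis (- x) + cis x = 2 * of_real (cos x)" "cis (- x) - cis x = - 2 * \<i> * of_real (sin x)"
    by (simp_all add: complex_eq_iff)
  then show "1 + cis (2 * x) = 2 * cis x * of_real (cos x)" "1 - cis (2 * x) = - 2 * \<i> * cis x * of_real (sin x)"
    unfolding a by (metis distrib_left mult.assoc mult.commute, metis right_diff_distrib mult.assoc mult.commute)
qed

text \<open>Take for \<open>\<kappa>\<close> the square root of sine times cosine: multiplying it by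
  the root of the cotangent trades the sine for a cosine, and by the root of the tangent the cosine
  for a sine.\<close>

lemma cos_sin_half_mom:
  assumes "m \<in> {1..L - 1}"
  obtains \<kappa> where "\<kappa> \<noteq> 0" "of_real (cos (mom L m / 2)) = \<kappa> * cot_root L m" "of_real (sin (mom L m / 2)) = \<kappa> * tan_root L m"
proof
  let ?x = "mom L m / 2"
  let ?k = "sqrt (sin ?x * cos ?x)"
  note p = half_mom_trig[OF assms]
  have "?k * sqrt (cot ?x) = cos ?x" "?k * sqrt (tan ?x) = sin ?x"
    using p by (simp_all add: cot_def tan_def flip: real_sqrt_mult)
  then show "of_real (cos ?x) = of_real ?k * cot_root L m" "of_real (sin ?x) = of_real ?k * tan_root L m"
    by (simp_all add: cot_root_def tan_root_def cr_def flip: of_real_mult)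
  show "of_real ?k \<noteq> (0::complex)" using p by simp
qed

text \<open>A step to the previous site multiplies the two waves by \<open>cis (2 * x)\<close> and
  by its negative. The sum thus brings in \<open>1 + cis (2 * x)\<close> and
  \<open>1 - cis (2 * x)\<close>, a cosine and \<open>- \<i>\<close> times a sine up to a common
  factor, and the relative \<open>\<i>\<close> makes their ratio real. The sine is odd in
  \<open>n\<close>, so \<open>\<sigma>\<close> becomes the sign of \<open>n\<close>. In the
  difference the alternating sign exchanges the waves, which reverses
  \<open>\<sigma>\<close>.\<close>

lemma neighbour_wave_pair:
  assumes "nat \<bar>n\<bar> \<in> {1..L - 1}"
  obtains c where "c \<noteq> 0"
    "\<And>k. k \<in> {1..2 * L} \<Longrightarrow> neighbour_sum L (wave_pair L n) k = c * mode_coeff L (of_int (sgn n)) n k"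
    "\<And>k. k \<in> {1..2 * L} \<Longrightarrow> neighbour_diff L (wave_pair L n) k = c * (\<i> * mode_coeff L (- of_int (sgn n)) n k)"
proof -
  let ?m = "nat \<bar>n\<bar>"
  let ?s = "of_int (sgn n) :: complex"
  have L: "L > 0" using assms by auto
  define x where "x = pi * of_int n / of_nat L / 2"
  define N where "N = cr (sqrt 2) * cr (sqrt (2 * real L))"
  have N0: "N \<noteq> 0" using L by (simp add: N_def cr_def)
  have mdN: "N * mode_coeff L \<sigma> n k = cot_root L ?m * wave L n k + \<sigma> * tan_root L ?m * wave L (n + int L) k" for \<sigma> k
    using N0 by (simp add: mode_coeff_def N_def)
  obtain \<kappa> where k: "\<kappa> \<noteq> 0" "of_real (cos (mom L ?m / 2)) = \<kappa> * cot_root L ?m" "of_real (sin (mom L ?m / 2)) = \<kappa> * tan_root L ?m"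
    by (rule cos_sin_half_mom[OF assms])
  have x: "x = of_int (sgn n) * (mom L ?m / 2)"
    using L by (cases "n \<ge> 0") (auto simp: x_def mom_def sgn_if field_simps)
  have "n > 0 \<or> n < 0" using assms by auto
  then have c: "of_real (cos x) = \<kappa> * cot_root L ?m" "of_real (sin x) = ?s * (\<kappa> * tan_root L ?m)"
    using k by (auto simp: x)
  have e: "cis (pi * of_int n / of_nat L) = cis (2 * x)" "cis (pi * of_int (n + int L) / of_nat L) = - cis (2 * x)"
    using L by (auto simp: x_def minus_cis add_divide_distrib algebra_simps)
  have h: "(- 1) ^ k * wave L n k = wave L (n + int L) k" "(- 1) ^ k * wave L (n + int L) k = wave L n k" for k
    using L wave_half[OF L, of k] wave_mult[of L "int L" k n] wave_mult[of L "int L" k "n + int L"] wave_period[OF L, of n k]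
    by (auto simp: algebra_simps)
  have "neighbour_sum L (wave_pair L n) k = (1 + cis (2 * x)) * wave L n k + \<i> * ((1 - cis (2 * x)) * wave L (n + int L) k)"
    if "k \<in> {1..2 * L}" for k
    by (simp only: neighbour_sum_def wave_pair_def wave_prev_site[OF L that] e) (simp add: algebra_simps)
  then have "neighbour_sum L (wave_pair L n) k = (2 * cis x * \<kappa>) * (N * mode_coeff L ?s n k)"
    if "k \<in> {1..2 * L}" for k
    unfolding mdN by (simp only: that cis_one_plus c) (simp add: algebra_simps)
  then have "neighbour_sum L (wave_pair L n) k = (2 * cis x * \<kappa> * N) * mode_coeff L ?s n k"
    if "k \<in> {1..2 * L}" for k
    using that by (simp only: mult.assoc)
  moreover
  have "neighbour_diff L (wave_pair L n) k = (1 - cis (2 * x)) * ((- 1) ^ k * wave L n k) + \<i> * ((1 + cis (2 * x)) * ((- 1) ^ k * wave L (n + int L) k))"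
    if "k \<in> {1..2 * L}" for k
    by (simp only: neighbour_diff_def wave_pair_def wave_prev_site[OF L that] e) (simp add: algebra_simps)
  then have "neighbour_diff L (wave_pair L n) k = (2 * \<i> * cis x * \<kappa>) * (N * mode_coeff L (- ?s) n k)"
    if "k \<in> {1..2 * L}" for k
    unfolding mdN by (simp only: that cis_one_plus c h) (simp add: algebra_simps)
  then have "neighbour_diff L (wave_pair L n) k = (2 * cis x * \<kappa> * N) * (\<i> * mode_coeff L (- ?s) n k)"
    if "k \<in> {1..2 * L}" for k
    using that by (simp add: mult_ac)
  moreover have "2 * cis x * \<kappa> * N \<noteq> 0" using k(1) N0 by simp
  ultimately show ?thesis using that by blast
qed

text \<open>Zero is written as 0 times a wave so that all four cases fit the scaling lemmas for
  \<open>lin_ff\<close> and \<open>lin_ffd\<close>.\<close>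

lemma neighbour_wave_zero:
  assumes "L > 0" "k \<in> {1..2 * L}"
  shows "neighbour_sum L (wave L 0) k = 2 * wave L 0 k" "neighbour_diff L (wave L 0) k = 0 * wave L 0 k"
    "neighbour_sum L (wave L (int L)) k = 0 * wave L 0 k" "neighbour_diff L (wave L (int L)) k = 2 * wave L 0 k"
proof -
  have "cis (pi * of_int (int L) / of_nat L) = -1" using assms by simp
  then have p: "wave L (int L) (prev_site L k) = - wave L (int L) k"
    using wave_prev_site[OF assms, of "int L"] by simp
  show "neighbour_sum L (wave L 0) k = 2 * wave L 0 k" "neighbour_diff L (wave L 0) k = 0 * wave L 0 k"
    "neighbour_sum L (wave L (int L)) k = 0 * wave L 0 k" "neighbour_diff L (wave L (int L)) k = 2 * wave L 0 k"
    by (simp_all add: neighbour_sum_def neighbour_diff_def p wave_0) (simp add: wave_half[OF assms(1)] flip: power_add mult_2)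
qed

section \<open>Comparison of the generators\<close>

lemma wave_induct:
  assumes "L > 0"
    and cong: "\<And>a b. (\<And>k. k \<in> {1..2 * L} \<Longrightarrow> a k = b k) \<Longrightarrow> P a \<Longrightarrow> P b"
    and add: "\<And>a b. P a \<Longrightarrow> P b \<Longrightarrow> P (\<lambda>k. a k + b k)"
    and smult: "\<And>c a. P a \<Longrightarrow> P (\<lambda>k. c * a k)"
    and base: "P (wave L 0)" "P (wave L (int L))"
    and modes: "\<And>m. m \<in> {1..L - 1} \<Longrightarrow> P (wave L (int m))" "\<And>m. m \<in> {1..L - 1} \<Longrightarrow> P (wave L (int m + int L))"
  shows "P a"
proof (rule fourier_induct[where P = P and L = L, OF assms(1) cong add smult])
  fix n assume n: "n \<in> {1..2 * L}"
  consider "n = L" | "n = 2 * L" | "n \<in> {1..L - 1}" | "n - L \<in> {1..L - 1}" "n > L" using n by force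
  then show "P (wave L (int n))"
  proof cases
    case 2
    have "wave L (int n) = wave L 0"
      using wave_period[OF assms(1), of 0] by (auto simp: 2)
    then show ?thesis using base by simp
  next
    case 4
    then have "int n = int (n - L) + int L" by simp
    then show ?thesis using modes(2)[OF 4(1)] by metis
  qed (use base modes in auto)
qed

text \<open>Within a family only equal indices pair. Between the families the coincidence
  \<open>m + n = L\<close> is possible, but the opposite values of \<open>\<sigma>\<close> make its
  contribution \<open>(1 - 1) / 2\<close>.\<close>

lemma mode_anticommutators:
  assumes "m \<in> {1..L - 1}" "n \<in> {1..L - 1}"
  shows "chi L m * chid L n + chid L n * chi L m = (if m = n then 1 else 0) \<cdot>\<^sub>m 1\<^sub>m (hdim L)"
    "etab L m * etabd L n + etabd L n * etab L m = (if m = n then 1 else 0) \<cdot>\<^sub>m 1\<^sub>m (hdim L)"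
    "chi L m * etabd L n + etabd L n * chi L m = 0 \<cdot>\<^sub>m 1\<^sub>m (hdim L)"
    "etab L m * chid L n + chid L n * etab L m = 0 \<cdot>\<^sub>m 1\<^sub>m (hdim L)"
  using assms
  by (auto simp: chi_eq_lin_ff chid_eq_lin_ffd etab_eq_lin_ff etabd_eq_lin_ffd lin_ff_lin_ffd_anticommute pairing_mode_coeff
      pairing_linear(3)[where x = "-1", simplified])

lemma pairing_zero_mode_coeff:
  assumes "nat \<bar>n\<bar> \<in> {1..L - 1}"
  shows "pairing L (wave L 0) (mode_coeff L \<sigma> n) = 0" "pairing L (wave L (int L)) (mode_coeff L \<sigma> n) = 0"
    "pairing L (mode_coeff L \<sigma> n) (wave L 0) = 0" "pairing L (mode_coeff L \<sigma> n) (wave L (int L)) = 0"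
proof -
  have L: "L > 0" using assms by auto
  have n: "\<not> int L dvd n"
  proof -
    have "\<bar>n\<bar> < int L" "n \<noteq> 0" using assms unfolding atLeastAtMost_iff by arith+
    then show ?thesis using dvd_imp_le_int[of n "int L"] by auto
  qed
  have nd: "\<not> 2 * int L dvd n + j * int L" for j
    using n by (metis dvd_add_times_triv_right_iff dvd_mult_right)
  show "pairing L (wave L 0) (mode_coeff L \<sigma> n) = 0" "pairing L (wave L (int L)) (mode_coeff L \<sigma> n) = 0"
    "pairing L (mode_coeff L \<sigma> n) (wave L 0) = 0" "pairing L (mode_coeff L \<sigma> n) (wave L (int L)) = 0"
    unfolding mode_coeff_def[abs_def] pairing_linear pairing_wave[OF L]
    using nd[of 1] nd[of 2] nd[of 3] by (simp_all add: algebra_simps)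
qed

lemma pairing_zero_zero: "L > 0 \<Longrightarrow> pairing L (wave L 0) (wave L 0) = 0"
  by (auto simp: pairing_wave dest: zdvd_imp_le)

lemma mode_carrier:
  assumes "m \<in> {1..L - 1}"
  shows "chi L m \<in> carrier_mat (hdim L) (hdim L)" "chid L m \<in> carrier_mat (hdim L) (hdim L)"
    "etab L m \<in> carrier_mat (hdim L) (hdim L)" "etabd L m \<in> carrier_mat (hdim L) (hdim L)"
  using assms by (simp_all add: chi_eq_lin_ff chid_eq_lin_ffd etab_eq_lin_ff etabd_eq_lin_ffd)

lemma mode_carrier_zero:
  "chid L 0 \<in> carrier_mat (hdim L) (hdim L)" "etab L 0 \<in> carrier_mat (hdim L) (hdim L)"
  by (simp_all add: zero_modes)

lemma mode_dim:
  assumes "m \<in> {1..L - 1}"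
  shows "dim_row (chi L m) = hdim L" "dim_row (chid L m) = hdim L"
    "dim_row (etab L m) = hdim L" "dim_row (etabd L m) = hdim L"
    "dim_col (chi L m) = hdim L" "dim_col (chid L m) = hdim L"
    "dim_col (etab L m) = hdim L" "dim_col (etabd L m) = hdim L"
  using mode_carrier[OF assms] by auto

lemma lin_ff_mode_coeff:
  assumes "m \<in> {1..L - 1}"
  shows "lin_ff L (mode_coeff L 1 (int m)) = chi L m" "lin_ffd L (mode_coeff L 1 (- int m)) = chid L m"
    "lin_ff L (mode_coeff L (- 1) (- int m)) = (- 1) \<cdot>\<^sub>m etab L m" "lin_ffd L (mode_coeff L (- 1) (int m)) = etabd L m"
  using assms unfolding chi_eq_lin_ff[OF assms] chid_eq_lin_ffd[OF assms] etab_eq_lin_ff[OF assms] etabd_eq_lin_ffd[OF assms]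
  by (simp_all only: lin_ff_smult smult_smult_mat) (simp_all add: smult_1_id)

lemma lin_ff_wave_pair:
  assumes "nat \<bar>n\<bar> \<in> {1..L - 1}"
  obtains c where "c \<noteq> 0"
    "lin_ff L (neighbour_sum L (wave_pair L n)) = c \<cdot>\<^sub>m lin_ff L (mode_coeff L (of_int (sgn n)) n)"
    "lin_ffd L (neighbour_diff L (wave_pair L n)) = (c * \<i>) \<cdot>\<^sub>m lin_ffd L (mode_coeff L (- of_int (sgn n)) n)"
proof (rule neighbour_wave_pair[OF assms])
  fix c
  assume c: "c \<noteq> 0"
    "\<And>k. k \<in> {1..2 * L} \<Longrightarrow> neighbour_sum L (wave_pair L n) k = c * mode_coeff L (of_int (sgn n)) n k"
    "\<And>k. k \<in> {1..2 * L} \<Longrightarrow> neighbour_diff L (wave_pair L n) k = c * (\<i> * mode_coeff L (- of_int (sgn n)) n k)"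
  have "lin_ff L (neighbour_sum L (wave_pair L n)) = c \<cdot>\<^sub>m lin_ff L (mode_coeff L (of_int (sgn n)) n)"
    unfolding lin_ff_smult[symmetric] by (rule lin_ff_cong) (rule c(2))
  moreover have "lin_ffd L (neighbour_diff L (wave_pair L n)) = (c * \<i>) \<cdot>\<^sub>m lin_ffd L (mode_coeff L (- of_int (sgn n)) n)"
    unfolding lin_ffd_smult[symmetric] by (rule lin_ffd_cong) (simp only: c(3) mult.assoc)
  ultimately show ?thesis using c(1) that by blast
qed

text \<open>For \<open>n > 0\<close> the vector carries \<open>chi\<close> and \<open>etabd\<close>,
  for \<open>n < 0\<close> it carries \<open>etab\<close> and \<open>chid\<close>, up to scalars.
  The signs of the two indices therefore select one of the families \<open>AA\<close>,
  \<open>BB\<close>, \<open>CC\<close>.\<close>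

lemma sym_quad_wave_pair:
  assumes "nat \<bar>n\<bar> \<in> {1..L - 1}" "nat \<bar>n'\<bar> \<in> {1..L - 1}"
  shows "\<exists>c. c \<noteq> 0 \<and> sym_quad L (wave_pair L n) (wave_pair L n') = c \<cdot>\<^sub>m
     (lin_ff L (mode_coeff L (of_int (sgn n)) n) * lin_ffd L (mode_coeff L (- of_int (sgn n')) n')
    + lin_ff L (mode_coeff L (of_int (sgn n')) n') * lin_ffd L (mode_coeff L (- of_int (sgn n)) n))"
proof -
  obtain c where c: "c \<noteq> 0" "lin_ff L (neighbour_sum L (wave_pair L n)) = c \<cdot>\<^sub>m lin_ff L (mode_coeff L (of_int (sgn n)) n)"
    "lin_ffd L (neighbour_diff L (wave_pair L n)) = (c * \<i>) \<cdot>\<^sub>m lin_ffd L (mode_coeff L (- of_int (sgn n)) n)"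
    using lin_ff_wave_pair[OF assms(1)] by blast
  obtain c' where c': "c' \<noteq> 0" "lin_ff L (neighbour_sum L (wave_pair L n')) = c' \<cdot>\<^sub>m lin_ff L (mode_coeff L (of_int (sgn n')) n')"
    "lin_ffd L (neighbour_diff L (wave_pair L n')) = (c' * \<i>) \<cdot>\<^sub>m lin_ffd L (mode_coeff L (- of_int (sgn n')) n')"
    using lin_ff_wave_pair[OF assms(2)] by blast
  have "sym_quad L (wave_pair L n) (wave_pair L n') = (c * c' * \<i>) \<cdot>\<^sub>m
     (lin_ff L (mode_coeff L (of_int (sgn n)) n) * lin_ffd L (mode_coeff L (- of_int (sgn n')) n')
    + lin_ff L (mode_coeff L (of_int (sgn n')) n') * lin_ffd L (mode_coeff L (- of_int (sgn n)) n))"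
    unfolding sym_quad_def c(2,3) c'(2,3)
    by (simp add: matrix_smult[where d = "hdim L"] smult_smult_mat)
       (intro eq_matI, auto simp: algebra_simps simp del: index_mult_mat(1))
  then show ?thesis using c(1) c'(1) by (intro exI[of _ "c * c' * \<i>"]) auto
qed

text \<open>Moving the creators to the left produces a Kronecker delta in each product. The two
  enter with opposite signs and cancel, so no multiple of the identity remains, even for
  \<open>m = n\<close>.\<close>

lemma sym_quad_AA:
  assumes "m \<in> {1..L - 1}" "n \<in> {1..L - 1}"
  shows "\<exists>c. c \<noteq> 0 \<and> sym_quad L (wave_pair L (int n)) (wave_pair L (- int m)) = c \<cdot>\<^sub>m AA L m n"
proof -
  note [simp] = mode_dim[OF assms(1)] mode_dim[OF assms(2)]
  obtain c where c: "c \<noteq> 0" "sym_quad L (wave_pair L (int n)) (wave_pair L (- int m)) = c \<cdot>\<^sub>m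
    (chi L n * chid L m + ((- 1) \<cdot>\<^sub>m etab L m) * etabd L n)"
    using sym_quad_wave_pair[of "int n" L "- int m"] assms by (auto simp: lin_ff_mode_coeff)
  have "chi L n * chid L m + ((- 1) \<cdot>\<^sub>m etab L m) * etabd L n = (- 1) \<cdot>\<^sub>m AA L m n"
    using assms
    unfolding anticommute_swap[OF mode_carrier(1)[OF assms(2)] mode_carrier(2)[OF assms(1)] mode_anticommutators(1)[OF assms(2,1)]]
      matrix_smult(1)[OF mode_carrier(3)[OF assms(1)] mode_carrier(4)[OF assms(2)]]
      anticommute_swap[OF mode_carrier(3)[OF assms(1)] mode_carrier(4)[OF assms(2)] mode_anticommutators(2)[OF assms]]
    by (intro eq_matI) (auto simp: AA_def EE_def simp del: index_mult_mat(1))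
  then show ?thesis using c by (intro exI[of _ "- c"]) (simp add: smult_smult_mat)
qed

lemma sym_quad_BB:
  assumes "m \<in> {1..L - 1}" "n \<in> {1..L - 1}"
  shows "\<exists>c. c \<noteq> 0 \<and> sym_quad L (wave_pair L (- int m)) (wave_pair L (- int n)) = c \<cdot>\<^sub>m BB L m n"
proof -
  note [simp] = mode_dim[OF assms(1)] mode_dim[OF assms(2)]
  obtain c where c: "c \<noteq> 0" "sym_quad L (wave_pair L (- int m)) (wave_pair L (- int n)) = c \<cdot>\<^sub>m
    (((- 1) \<cdot>\<^sub>m etab L m) * chid L n + ((- 1) \<cdot>\<^sub>m etab L n) * chid L m)"
    using sym_quad_wave_pair[of "- int m" L "- int n"] assms by (auto simp: lin_ff_mode_coeff)
  have "((- 1) \<cdot>\<^sub>m etab L m) * chid L n + ((- 1) \<cdot>\<^sub>m etab L n) * chid L m = BB L m n"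
    using assms
    unfolding matrix_smult(1)[OF mode_carrier(3)[OF assms(1)] mode_carrier(2)[OF assms(2)]]
      matrix_smult(1)[OF mode_carrier(3)[OF assms(2)] mode_carrier(2)[OF assms(1)]]
      anticommute_swap[OF mode_carrier(3)[OF assms(1)] mode_carrier(2)[OF assms(2)] mode_anticommutators(4)[OF assms]]
      anticommute_swap[OF mode_carrier(3)[OF assms(2)] mode_carrier(2)[OF assms(1)] mode_anticommutators(4)[OF assms(2,1)]]
    by (intro eq_matI) (auto simp: BB_def EE_def simp del: index_mult_mat(1))
  then show ?thesis using c by auto
qed

lemma sym_quad_CC:
  assumes "m \<in> {1..L - 1}" "n \<in> {1..L - 1}"
  shows "\<exists>c. c \<noteq> 0 \<and> sym_quad L (wave_pair L (int m)) (wave_pair L (int n)) = c \<cdot>\<^sub>m CC L m n"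
proof -
  note [simp] = mode_dim[OF assms(1)] mode_dim[OF assms(2)]
  obtain c where c: "c \<noteq> 0" "sym_quad L (wave_pair L (int m)) (wave_pair L (int n)) = c \<cdot>\<^sub>m
    (chi L m * etabd L n + chi L n * etabd L m)"
    using sym_quad_wave_pair[of "int m" L "int n"] assms by (auto simp: lin_ff_mode_coeff)
  have "chi L m * etabd L n + chi L n * etabd L m = (- 1) \<cdot>\<^sub>m CC L m n"
    using assms
    unfolding anticommute_swap[OF mode_carrier(1)[OF assms(1)] mode_carrier(4)[OF assms(2)] mode_anticommutators(3)[OF assms]]
      anticommute_swap[OF mode_carrier(1)[OF assms(2)] mode_carrier(4)[OF assms(1)] mode_anticommutators(3)[OF assms(2,1)]]
    by (intro eq_matI) (auto simp: CC_def EE_def simp del: index_mult_mat(1))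
  then show ?thesis using c by (intro exI[of _ "- c"]) (simp add: smult_smult_mat)
qed

section \<open>The degenerate directions and the zero modes\<close>

lemma lin_ff_wave_zero:
  assumes "L > 0"
  shows "lin_ff L (neighbour_sum L (wave L 0)) = 2 \<cdot>\<^sub>m lin_ff L (wave L 0)"
    "lin_ffd L (neighbour_diff L (wave L 0)) = 0\<^sub>m (hdim L) (hdim L)"
    "lin_ff L (neighbour_sum L (wave L (int L))) = 0\<^sub>m (hdim L) (hdim L)"
    "lin_ffd L (neighbour_diff L (wave L (int L))) = 2 \<cdot>\<^sub>m lin_ffd L (wave L 0)"
proof -
  have z: "0\<^sub>m (hdim L) (hdim L) = 0 \<cdot>\<^sub>m lin_ff L (wave L 0)" "0\<^sub>m (hdim L) (hdim L) = 0 \<cdot>\<^sub>m lin_ffd L (wave L 0)"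
    by (auto intro!: eq_matI)
  show "lin_ff L (neighbour_sum L (wave L 0)) = 2 \<cdot>\<^sub>m lin_ff L (wave L 0)"
    "lin_ff L (neighbour_sum L (wave L (int L))) = 0\<^sub>m (hdim L) (hdim L)"
    unfolding z(1) lin_ff_smult[symmetric] by (rule lin_ff_cong, rule neighbour_wave_zero[OF assms], assumption)+
  show "lin_ffd L (neighbour_diff L (wave L 0)) = 0\<^sub>m (hdim L) (hdim L)"
    "lin_ffd L (neighbour_diff L (wave L (int L))) = 2 \<cdot>\<^sub>m lin_ffd L (wave L 0)"
    unfolding z(2) lin_ffd_smult[symmetric] by (rule lin_ffd_cong, rule neighbour_wave_zero[OF assms], assumption)+
qed

text \<open>Each of these vectors keeps only one of its two fermions, the annihilator for index 0
  and the creator for index \<open>L\<close>, so one summand of the symmetric product drops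
  out.\<close>

lemma sym_quad_wave_zero:
  assumes "L > 0"
  shows "sym_quad L (wave L 0) b = 2 \<cdot>\<^sub>m (lin_ff L (wave L 0) * lin_ffd L (neighbour_diff L b))"
    "sym_quad L (wave L (int L)) b = 2 \<cdot>\<^sub>m (lin_ff L (neighbour_sum L b) * lin_ffd L (wave L 0))"
proof -
  note e = lin_ff_wave_zero[OF assms] left_mult_zero_mat[OF lin_ffd_carrier] right_mult_zero_mat[OF lin_ff_carrier]
    matrix_smult[OF lin_ff_carrier lin_ffd_carrier]
  have c: "x \<cdot>\<^sub>m (lin_ff L a * lin_ffd L b) \<in> carrier_mat (hdim L) (hdim L)" for x a b
    by (intro smult_carrier_mat mult_carrier_mat[OF lin_ff_carrier lin_ffd_carrier])
  show "sym_quad L (wave L 0) b = 2 \<cdot>\<^sub>m (lin_ff L (wave L 0) * lin_ffd L (neighbour_diff L b))"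
    unfolding sym_quad_def e by (rule right_add_zero_mat[OF c])
  show "sym_quad L (wave L (int L)) b = 2 \<cdot>\<^sub>m (lin_ff L (neighbour_sum L b) * lin_ffd L (wave L 0))"
    unfolding sym_quad_def e by (rule left_add_zero_mat[OF c])
qed

lemma wave_zero_modes:
  assumes "L > 0"
  obtains c where "c \<noteq> 0" "lin_ff L (wave L 0) = c \<cdot>\<^sub>m etab L 0" "lin_ffd L (wave L 0) = c \<cdot>\<^sub>m chid L 0"
proof
  let ?c = "cr (sqrt (2 * real L))"
  show c: "?c \<noteq> 0" using assms by (simp add: cr_def)
  show "lin_ff L (wave L 0) = ?c \<cdot>\<^sub>m etab L 0" "lin_ffd L (wave L 0) = ?c \<cdot>\<^sub>m chid L 0"
    unfolding zero_modes lin_ff_smult lin_ffd_smult using c by (simp_all add: smult_smult_mat smult_1_id)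
qed

lemma zero_mode_anticommutators:
  assumes "L > 0"
  shows "etab L 0 * chid L 0 = (- 1) \<cdot>\<^sub>m (chid L 0 * etab L 0)"
    "m \<in> {1..L - 1} \<Longrightarrow> etab L 0 * chid L m = (- 1) \<cdot>\<^sub>m (chid L m * etab L 0)"
    "m \<in> {1..L - 1} \<Longrightarrow> etab L 0 * etabd L m = (- 1) \<cdot>\<^sub>m (etabd L m * etab L 0)"
    "m \<in> {1..L - 1} \<Longrightarrow> chi L m * chid L 0 = (- 1) \<cdot>\<^sub>m (chid L 0 * chi L m)"
    "m \<in> {1..L - 1} \<Longrightarrow> etab L m * chid L 0 = (- 1) \<cdot>\<^sub>m (chid L 0 * etab L m)"
proof -
  have sw: "lin_ff L a * lin_ffd L b = (- 1) \<cdot>\<^sub>m (lin_ffd L b * lin_ff L a)" if "pairing L a b = 0" for a b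
    using anticommute_swap[OF lin_ff_carrier lin_ffd_carrier lin_ff_lin_ffd_anticommute, of L a b] that
    by (simp add: zero_smult_one) (intro eq_matI; auto simp del: index_mult_mat(1))
  show "etab L 0 * chid L 0 = (- 1) \<cdot>\<^sub>m (chid L 0 * etab L 0)"
    unfolding zero_modes by (rule sw) (simp only: pairing_linear pairing_zero_zero[OF assms], simp)
  assume m: "m \<in> {1..L - 1}"
  show "etab L 0 * chid L m = (- 1) \<cdot>\<^sub>m (chid L m * etab L 0)"
    "etab L 0 * etabd L m = (- 1) \<cdot>\<^sub>m (etabd L m * etab L 0)"
    "chi L m * chid L 0 = (- 1) \<cdot>\<^sub>m (chid L 0 * chi L m)"
    "etab L m * chid L 0 = (- 1) \<cdot>\<^sub>m (chid L 0 * etab L m)"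
    unfolding zero_modes chi_eq_lin_ff[OF m] chid_eq_lin_ffd[OF m] etab_eq_lin_ff[OF m] etabd_eq_lin_ffd[OF m]
    using m by (rule_tac [!] sw) (simp_all only: pairing_linear, simp_all add: pairing_zero_mode_coeff)
qed

lemma sym_quad_zero_wave_pair:
  assumes m: "m \<in> {1..L - 1}"
  shows "\<exists>c. c \<noteq> 0 \<and> sym_quad L (wave L 0) (wave_pair L (int m)) = c \<cdot>\<^sub>m EE L (L + m) L"
    "\<exists>c. c \<noteq> 0 \<and> sym_quad L (wave L 0) (wave_pair L (- int m)) = c \<cdot>\<^sub>m EE L m L"
    "\<exists>c. c \<noteq> 0 \<and> sym_quad L (wave L (int L)) (wave_pair L (int m)) = c \<cdot>\<^sub>m EE L 0 m"
    "\<exists>c. c \<noteq> 0 \<and> sym_quad L (wave L (int L)) (wave_pair L (- int m)) = c \<cdot>\<^sub>m EE L 0 (L + m)"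
proof -
  have L: "L > 0" and mL: "m < L" using m by auto
  obtain z where z: "z \<noteq> 0" "lin_ff L (wave L 0) = z \<cdot>\<^sub>m etab L 0" "lin_ffd L (wave L 0) = z \<cdot>\<^sub>m chid L 0"
    by (rule wave_zero_modes[OF L])
  note [simp] = mode_carrier[OF m] mode_carrier_zero
  obtain c where c: "c \<noteq> 0"
    "lin_ff L (neighbour_sum L (wave_pair L (int m))) = c \<cdot>\<^sub>m chi L m" "lin_ffd L (neighbour_diff L (wave_pair L (int m))) = (c * \<i>) \<cdot>\<^sub>m etabd L m"
    by (rule lin_ff_wave_pair[of "int m" L]) (use m lin_ff_mode_coeff[OF m] in auto)
  obtain c' where c': "c' \<noteq> 0"
    "lin_ff L (neighbour_sum L (wave_pair L (- int m))) = c' \<cdot>\<^sub>m ((- 1) \<cdot>\<^sub>m etab L m)" "lin_ffd L (neighbour_diff L (wave_pair L (- int m))) = (c' * \<i>) \<cdot>\<^sub>m chid L m"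
    by (rule lin_ff_wave_pair[of "- int m" L]) (use m lin_ff_mode_coeff[OF m] in auto)
  note s = sym_quad_wave_zero[OF L] c(2,3) c'(2,3) z(2,3) matrix_smult[where d = "hdim L"]
    smult_smult_mat zero_mode_anticommutators[OF L]
  have "sym_quad L (wave L 0) (wave_pair L (int m)) = (- 2 * c * \<i> * z) \<cdot>\<^sub>m EE L (L + m) L"
    "sym_quad L (wave L 0) (wave_pair L (- int m)) = (- 2 * c' * \<i> * z) \<cdot>\<^sub>m EE L m L"
    "sym_quad L (wave L (int L)) (wave_pair L (int m)) = (- 2 * c * z) \<cdot>\<^sub>m EE L 0 m"
    "sym_quad L (wave L (int L)) (wave_pair L (- int m)) = (2 * c' * z) \<cdot>\<^sub>m EE L 0 (L + m)"
    using m L mL by (simp_all add: s EE_def mult_ac)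
  moreover have nz: "- 2 * c * \<i> * z \<noteq> 0" "- 2 * c' * \<i> * z \<noteq> 0" "- 2 * c * z \<noteq> 0" "2 * c' * z \<noteq> 0"
    using c(1) c'(1) z(1) by simp_all
  ultimately show "\<exists>c. c \<noteq> 0 \<and> sym_quad L (wave L 0) (wave_pair L (int m)) = c \<cdot>\<^sub>m EE L (L + m) L"
    "\<exists>c. c \<noteq> 0 \<and> sym_quad L (wave L 0) (wave_pair L (- int m)) = c \<cdot>\<^sub>m EE L m L"
    "\<exists>c. c \<noteq> 0 \<and> sym_quad L (wave L (int L)) (wave_pair L (int m)) = c \<cdot>\<^sub>m EE L 0 m"
    "\<exists>c. c \<noteq> 0 \<and> sym_quad L (wave L (int L)) (wave_pair L (- int m)) = c \<cdot>\<^sub>m EE L 0 (L + m)"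
    using nz by blast+
qed

lemma sym_quad_zero_zero:
  assumes L: "L > 0"
  shows "\<exists>c. c \<noteq> 0 \<and> sym_quad L (wave L 0) (wave L (int L)) = c \<cdot>\<^sub>m EE L 0 L"
    "sym_quad L (wave L 0) (wave L 0) = 0 \<cdot>\<^sub>m 1\<^sub>m (hdim L)"
    "sym_quad L (wave L (int L)) (wave L (int L)) = 0 \<cdot>\<^sub>m 1\<^sub>m (hdim L)"
proof -
  obtain z where z: "z \<noteq> 0" "lin_ff L (wave L 0) = z \<cdot>\<^sub>m etab L 0" "lin_ffd L (wave L 0) = z \<cdot>\<^sub>m chid L 0"
    by (rule wave_zero_modes[OF L])
  note [simp] = mode_carrier_zero
  have "sym_quad L (wave L 0) (wave L (int L)) = (- 4 * z * z) \<cdot>\<^sub>m EE L 0 L"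
    using L by (simp add: sym_quad_wave_zero lin_ff_wave_zero z(2,3) matrix_smult[where d = "hdim L"] smult_smult_mat
        zero_mode_anticommutators EE_def mult_ac)
  then show "\<exists>c. c \<noteq> 0 \<and> sym_quad L (wave L 0) (wave L (int L)) = c \<cdot>\<^sub>m EE L 0 L"
    using z(1) by (intro exI[of _ "- 4 * z * z"]) auto
  show "sym_quad L (wave L 0) (wave L 0) = 0 \<cdot>\<^sub>m 1\<^sub>m (hdim L)"
    unfolding sym_quad_wave_zero(1)[OF L] lin_ff_wave_zero[OF L] right_mult_zero_mat[OF lin_ff_carrier] by (auto intro!: eq_matI)
  show "sym_quad L (wave L (int L)) (wave L (int L)) = 0 \<cdot>\<^sub>m 1\<^sub>m (hdim L)"
    unfolding sym_quad_wave_zero(2)[OF L] lin_ff_wave_zero[OF L] left_mult_zero_mat[OF lin_ffd_carrier] by (auto intro!: eq_matI)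
qed

text \<open>The vectors of index \<open>m\<close> and \<open>- (L - m)\<close> involve the same two
  waves, because \<open>- (L - m)\<close> and \<open>m + L\<close> agree modulo
  \<open>2 * L\<close>. These formulas invert the resulting 2 by 2 system.\<close>

lemma wave_pair_waves:
  assumes m: "m \<in> {1..L - 1}"
  shows "wave L (int m) k = 1 / 2 * (wave_pair L (int m) k + - \<i> * wave_pair L (- int (L - m)) k)"
    "wave L (int m + int L) k = 1 / 2 * (wave_pair L (- int (L - m)) k + - \<i> * wave_pair L (int m) k)"
proof -
  have e: "- int (L - m) + int L = int m" using m by auto
  show "wave L (int m) k = 1 / 2 * (wave_pair L (int m) k + - \<i> * wave_pair L (- int (L - m)) k)"
    unfolding wave_pair_def wave_int_diff'[OF m] e by (simp add: algebra_simps)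
  show "wave L (int m + int L) k = 1 / 2 * (wave_pair L (- int (L - m)) k + - \<i> * wave_pair L (int m) k)"
    unfolding wave_pair_def wave_int_diff'[OF m] e by (simp add: algebra_simps)
qed

lemma wave_pair_induct:
  assumes "L > 0"
    and cong: "\<And>a b. (\<And>k. k \<in> {1..2 * L} \<Longrightarrow> a k = b k) \<Longrightarrow> P a \<Longrightarrow> P b"
    and add: "\<And>a b. P a \<Longrightarrow> P b \<Longrightarrow> P (\<lambda>k. a k + b k)"
    and smult: "\<And>c a. P a \<Longrightarrow> P (\<lambda>k. c * a k)"
    and base: "P (wave L 0)" "P (wave L (int L))"
    and modes: "\<And>m. m \<in> {1..L - 1} \<Longrightarrow> P (wave_pair L (int m))" "\<And>m. m \<in> {1..L - 1} \<Longrightarrow> P (wave_pair L (- int m))"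
  shows "P a"
proof (rule wave_induct[where P = P and L = L, OF assms(1) cong add smult base])
  fix m assume m: "m \<in> {1..L - 1}"
  then have m': "L - m \<in> {1..L - 1}" by auto
  show "P (wave L (int m))"
    by (rule cong[rotated], rule smult[OF add[OF modes(1)[OF m] smult[OF modes(2)[OF m']]]])
       (rule wave_pair_waves(1)[OF m, symmetric])
  show "P (wave L (int m + int L))"
    by (rule cong[rotated], rule smult[OF add[OF modes(2)[OF m'] smult[OF modes(1)[OF m]]]])
       (rule wave_pair_waves(2)[OF m, symmetric])
qed

section \<open>Quadratic operators in terms of each set of generators\<close>

lemma SN_gens_in_assoc_alg:
  assumes "L \<ge> 2" and "\<And>j. j \<in> {1..2 * L} \<Longrightarrow> ee L j \<in> assoc_alg (hdim L) G"
    and x: "x \<in> SN_gens L"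
  shows "x \<in> assoc_alg (hdim L) G"
proof -
  have *: "y \<in> assoc_alg (hdim L) G" if "\<exists>c. c \<noteq> 0 \<and> sym_quad L a b = c \<cdot>\<^sub>m y" for a b y
    using that sym_quad_in_assoc_alg[OF assms(1,2), of a b] assoc_alg_scale_cancel by metis
  have L: "L > 0" using assms(1) by simp
  from x show ?thesis unfolding SN_gens_def
    by (auto intro: *[OF sym_quad_AA] *[OF sym_quad_BB] *[OF sym_quad_CC] *[OF sym_quad_zero_zero(1)[OF L]]
      *[OF sym_quad_zero_wave_pair(1)] *[OF sym_quad_zero_wave_pair(2)] *[OF sym_quad_zero_wave_pair(3)] *[OF sym_quad_zero_wave_pair(4)])
qed

lemma sym_quad_in_SN:
  assumes L: "L > 0"
  shows "sym_quad L a b \<in> assoc_alg (hdim L) (SN_gens L)" (is "_ \<in> ?S")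
proof -
  have *: "sym_quad L a b \<in> ?S" if "\<exists>c. c \<noteq> 0 \<and> sym_quad L a b = c \<cdot>\<^sub>m y" "y \<in> SN_gens L" for a b y
    using that by (metis assoc_alg.smult assoc_alg.gen)
  have zero: "0 \<cdot>\<^sub>m 1\<^sub>m (hdim L) \<in> ?S" by (intro assoc_alg.smult assoc_alg.one)
  \<comment> \<open>Only the first slot is expanded in the Fourier basis; the second follows by
    symmetry.\<close>
  have lin: "sym_quad L a c \<in> ?S"
    if "sym_quad L (wave L 0) c \<in> ?S" "sym_quad L (wave L (int L)) c \<in> ?S"
      "\<And>m. m \<in> {1..L - 1} \<Longrightarrow> sym_quad L (wave_pair L (int m)) c \<in> ?S" "\<And>m. m \<in> {1..L - 1} \<Longrightarrow> sym_quad L (wave_pair L (- int m)) c \<in> ?S"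
    for a c
  proof (rule wave_pair_induct[where P = "\<lambda>a. sym_quad L a c \<in> ?S" and L = L])
    show "sym_quad L b c \<in> ?S" if "\<And>k. k \<in> {1..2 * L} \<Longrightarrow> a k = b k" "sym_quad L a c \<in> ?S" for a b
      using sym_quad_cong[OF that(1), where c = c] that(2) by simp
  qed (use that L in \<open>auto simp: sym_quad_add sym_quad_smult intro: assoc_alg.intros\<close>)
  have gens: "AA L m n \<in> SN_gens L" "BB L m n \<in> SN_gens L" "CC L m n \<in> SN_gens L"
    if "m \<in> {1..L - 1}" "n \<in> {1..L - 1}" for m n
    using that unfolding SN_gens_def by blast+
  have gens0: "EE L 0 m \<in> SN_gens L" "EE L 0 (L + m) \<in> SN_gens L" "EE L m L \<in> SN_gens L" "EE L (L + m) L \<in> SN_gens L"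
    if "m \<in> {1..L - 1}" for m
    using that unfolding SN_gens_def by blast+
  have gens00: "EE L 0 L \<in> SN_gens L"
    unfolding SN_gens_def by blast
  have AA: "sym_quad L (wave_pair L (int n)) (wave_pair L (- int m)) \<in> ?S" if "m \<in> {1..L - 1}" "n \<in> {1..L - 1}" for m n
    by (rule *[OF sym_quad_AA[OF that] gens(1)[OF that]])
  then have AA': "sym_quad L (wave_pair L (- int m)) (wave_pair L (int n)) \<in> ?S" if "m \<in> {1..L - 1}" "n \<in> {1..L - 1}" for m n
    using that sym_quad_commute by metis
  have BB: "sym_quad L (wave_pair L (- int m)) (wave_pair L (- int n)) \<in> ?S" if "m \<in> {1..L - 1}" "n \<in> {1..L - 1}" for m n
    by (rule *[OF sym_quad_BB[OF that] gens(2)[OF that]])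
  have CC: "sym_quad L (wave_pair L (int m)) (wave_pair L (int n)) \<in> ?S" if "m \<in> {1..L - 1}" "n \<in> {1..L - 1}" for m n
    by (rule *[OF sym_quad_CC[OF that] gens(3)[OF that]])
  have Z: "sym_quad L (wave L 0) (wave_pair L (int m)) \<in> ?S" "sym_quad L (wave L 0) (wave_pair L (- int m)) \<in> ?S"
    "sym_quad L (wave L (int L)) (wave_pair L (int m)) \<in> ?S" "sym_quad L (wave L (int L)) (wave_pair L (- int m)) \<in> ?S"
    if "m \<in> {1..L - 1}" for m
    using *[OF sym_quad_zero_wave_pair(1)[OF that] gens0(4)[OF that]] *[OF sym_quad_zero_wave_pair(2)[OF that] gens0(3)[OF that]]
      *[OF sym_quad_zero_wave_pair(3)[OF that] gens0(1)[OF that]] *[OF sym_quad_zero_wave_pair(4)[OF that] gens0(2)[OF that]] by simp_all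
  then have Z': "sym_quad L (wave_pair L (int m)) (wave L 0) \<in> ?S" "sym_quad L (wave_pair L (- int m)) (wave L 0) \<in> ?S"
    "sym_quad L (wave_pair L (int m)) (wave L (int L)) \<in> ?S" "sym_quad L (wave_pair L (- int m)) (wave L (int L)) \<in> ?S"
    if "m \<in> {1..L - 1}" for m
    using that sym_quad_commute by metis+
  have ZZ: "sym_quad L (wave L 0) (wave L (int L)) \<in> ?S"
    by (rule *[OF sym_quad_zero_zero(1)[OF L] gens00])
  then have ZZ': "sym_quad L (wave L (int L)) (wave L 0) \<in> ?S"
    using sym_quad_commute by metis
  have diag: "sym_quad L (wave L 0) (wave L 0) \<in> ?S" "sym_quad L (wave L (int L)) (wave L (int L)) \<in> ?S"
    using zero sym_quad_zero_zero(2,3)[OF L] by simp_all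
  have W: "sym_quad L b (wave L 0) \<in> ?S" "sym_quad L b (wave L (int L)) \<in> ?S" for b
    by (rule lin; fact diag ZZ ZZ' Z')+
  have P: "sym_quad L b (wave_pair L (int m)) \<in> ?S" "sym_quad L b (wave_pair L (- int m)) \<in> ?S" if "m \<in> {1..L - 1}" for b m
    using that by (auto intro!: lin AA AA' BB CC Z)
  have W': "sym_quad L (wave L 0) b \<in> ?S" "sym_quad L (wave L (int L)) b \<in> ?S"
    using W[of b] sym_quad_commute[of L b] by metis+
  have P': "sym_quad L (wave_pair L (int m)) b \<in> ?S" "sym_quad L (wave_pair L (- int m)) b \<in> ?S" if "m \<in> {1..L - 1}" for m
    using P[OF that, of b] sym_quad_commute[of L b] by metis+
  show ?thesis by (rule lin; fact W' P')
qed

lemma ee_in_SN: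
  assumes "L > 0" "j \<in> {1..2 * L}"
  shows "ee L j \<in> assoc_alg (hdim L) (SN_gens L)"
proof (rule assoc_alg_scale_cancel)
  show "(2 * (- 1) ^ j) \<cdot>\<^sub>m ee L j \<in> assoc_alg (hdim L) (SN_gens L)"
    using sym_quad_in_SN[OF assms(1), of "delta j" "delta j"] assms
    by (simp add: sym_quad_self delta_generator smult_smult_mat)
qed simp

section \<open>Phase operators\<close>

definition intertwines :: "complex mat \<Rightarrow> complex mat \<Rightarrow> complex \<Rightarrow> bool" where
  "intertwines V M z \<longleftrightarrow> V * M = z \<cdot>\<^sub>m (M * V)"

text \<open>With \<open>X\<close> a creator and \<open>Y\<close> its annihilator,
  \<open>X * Y\<close> is a number operator with values 0 and 1, and this is \<open>z\<close> raised
  to that operator.\<close>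

definition phase_op :: "nat \<Rightarrow> complex mat \<Rightarrow> complex mat \<Rightarrow> complex \<Rightarrow> complex mat" where
  "phase_op d X Y z = 1\<^sub>m d + (z - 1) \<cdot>\<^sub>m (X * Y)"

lemma intertwines_mult:
  assumes "A \<in> carrier_mat d d" "B \<in> carrier_mat d d" "M \<in> carrier_mat d d"
    and "intertwines A M z" "intertwines B M w"
  shows "intertwines (A * B) M (z * w)"
proof -
  note ring = matrix_distrib[where d = d] matrix_smult[where d = d] mult_carrier_mat[where n = d and nr = d and nc = d]
  have "A * B * M = A * (B * M)" using assms by (simp add: ring)
  also have "\<dots> = w \<cdot>\<^sub>m ((A * M) * B)" using assms(1-3,5) by (simp add: intertwines_def ring)
  also have "\<dots> = (z * w) \<cdot>\<^sub>m (M * (A * B))"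
    using assms(1-4) by (simp add: intertwines_def ring smult_smult_mat mult.commute)
  finally show ?thesis by (simp add: intertwines_def)
qed

text \<open>A single mode with \<open>X\<close> as creator. The squares appear doubled because the
  general anticommutators deliver them in this form.\<close>

locale fermion_pair =
  fixes d :: nat and X Y :: "complex mat"
  assumes carrier: "X \<in> carrier_mat d d" "Y \<in> carrier_mat d d"
    and anticommute: "Y * X + X * Y = 1 \<cdot>\<^sub>m 1\<^sub>m d" "X * X + X * X = 0\<^sub>m d d" "Y * Y + Y * Y = 0\<^sub>m d d"
begin

lemmas ring = matrix_distrib[where d = d] matrix_smult[where d = d] mult_carrier_mat[where n = d and nr = d and nc = d]
  left_mult_one_mat[where nr = d and nc = d] right_mult_one_mat[where nr = d and nc = d]
  left_mult_zero_mat[where nr = d and nc = d and n = d] right_mult_zero_mat[where nr = d and nc = d and n = d]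

lemma square_zero: "X * X = 0\<^sub>m d d" "Y * Y = 0\<^sub>m d d"
proof -
  have z: "A = 0\<^sub>m d d" if "A + A = 0\<^sub>m d d" "A \<in> carrier_mat d d" for A :: "complex mat"
  proof (rule eq_matI)
    fix i j assume "i < dim_row (0\<^sub>m d d :: complex mat)" "j < dim_col (0\<^sub>m d d :: complex mat)"
    then show "A $$ (i,j) = 0\<^sub>m d d $$ (i,j)"
      using arg_cong[OF that(1), of "\<lambda>M. M $$ (i,j)"] that(2) by (auto simp: double_zero simp flip: mult_2)
  qed (use that in auto)
  show "X * X = 0\<^sub>m d d" "Y * Y = 0\<^sub>m d d"
    by (rule z[OF anticommute(2) mult_carrier_mat[OF carrier(1,1)]], rule z[OF anticommute(3) mult_carrier_mat[OF carrier(2,2)]])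
qed

lemma swap: "Y * X = 1\<^sub>m d - X * Y"
  using anticommute_swap[OF carrier(2,1) anticommute(1)] by (simp add: smult_1_id)

lemma XYX: "X * (Y * X) = X" and YXY: "Y * (X * Y) = Y"
proof -
  have "X * (Y * X) = X - (X * X) * Y" unfolding swap using carrier by (simp add: ring)
  then show "X * (Y * X) = X" using carrier by (simp add: square_zero ring) (auto intro!: eq_matI)
  have "Y * (X * Y) = (Y * X) * Y" using carrier by (simp add: ring)
  also have "\<dots> = Y - X * (Y * Y)" unfolding swap using carrier by (simp add: ring)
  also have "\<dots> = Y" using carrier by (simp add: square_zero ring) (auto intro!: eq_matI)
  finally show "Y * (X * Y) = Y" .
qed

lemma number_idempotent: "(X * Y) * (X * Y) = X * Y"
  using carrier by (simp add: ring YXY)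

lemma phase_op_carrier: "phase_op d X Y z \<in> carrier_mat d d"
  using carrier by (simp add: phase_op_def ring)

text \<open>The number operator \<open>X * Y\<close> acts on \<open>X\<close> as the identity from
  the left and as 0 from the right, so only one side acquires the phase.\<close>

lemma phase_op_intertwines_creator: "intertwines (phase_op d X Y z) X z"
proof -
  have 1: "phase_op d X Y z * X = X + (z - 1) \<cdot>\<^sub>m X"
    using carrier by (simp add: phase_op_def ring XYX)
  have 2: "X * phase_op d X Y z = X + (z - 1) \<cdot>\<^sub>m ((X * X) * Y)"
    using carrier by (simp add: phase_op_def ring)
  have 3: "X * phase_op d X Y z = X"
    unfolding 2 using carrier by (simp add: square_zero ring)
  show ?thesis unfolding intertwines_def 1 3 using carrier by (auto intro!: eq_matI simp: algebra_simps)
qed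

lemma phase_op_intertwines_annihilator: "z \<noteq> 0 \<Longrightarrow> intertwines (phase_op d X Y z) Y (1 / z)"
proof -
  assume z: "z \<noteq> 0"
  have 1: "phase_op d X Y z * Y = Y"
    using carrier by (simp add: phase_op_def ring square_zero)
  have 2: "Y * phase_op d X Y z = Y + (z - 1) \<cdot>\<^sub>m Y"
    using carrier by (simp add: phase_op_def ring YXY)
  show ?thesis unfolding intertwines_def 1 2 using carrier z by (auto intro!: eq_matI simp: field_simps)
qed

text \<open>\<open>M\<close> anticommutes with both factors of the number operator, so the two signs
  cancel and it commutes with the product.\<close>

lemma phase_op_intertwines_other:
  assumes M: "M \<in> carrier_mat d d" and "X * M + M * X = 0\<^sub>m d d" "Y * M + M * Y = 0\<^sub>m d d"
  shows "intertwines (phase_op d X Y z) M 1"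
proof -
  have X: "X * M = (- 1) \<cdot>\<^sub>m (M * X)" and Y: "Y * M = (- 1) \<cdot>\<^sub>m (M * Y)"
    using anticommute_swap[OF carrier(1) M, of 0] anticommute_swap[OF carrier(2) M, of 0] assms carrier
    by (auto simp: zero_smult_one intro!: eq_matI simp del: index_mult_mat(1))
  have "X * Y * M = X * (Y * M)" using carrier M by (simp add: ring)
  also have "\<dots> = (- 1) \<cdot>\<^sub>m ((X * M) * Y)" unfolding Y using carrier M by (simp add: ring)
  also have "\<dots> = M * (X * Y)" unfolding X using carrier M by (simp add: ring smult_smult_mat smult_1_id)
  finally have "X * Y * M = M * (X * Y)" .
  moreover have "phase_op d X Y z * M = M + (z - 1) \<cdot>\<^sub>m (X * Y * M)"
    using carrier M by (simp add: phase_op_def ring)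
  moreover have "M * phase_op d X Y z = M + (z - 1) \<cdot>\<^sub>m (M * (X * Y))"
    using carrier M by (simp add: phase_op_def ring)
  ultimately show ?thesis by (simp add: intertwines_def smult_1_id)
qed

lemma phase_op_inverse:
  assumes "z * w = 1"
  shows "phase_op d X Y z * phase_op d X Y w = 1\<^sub>m d"
proof -
  define n where "n = X * Y"
  have n: "n \<in> carrier_mat d d" "n * n = n" using carrier number_idempotent by (simp_all add: n_def ring)
  have "phase_op d X Y z * phase_op d X Y w = (1\<^sub>m d + (z - 1) \<cdot>\<^sub>m n) + (w - 1) \<cdot>\<^sub>m (n + (z - 1) \<cdot>\<^sub>m n)"
    using n unfolding phase_op_def n_def[symmetric] by (simp add: ring smult_smult_mat)
  also have "\<dots> = 1\<^sub>m d"
  proof (rule eq_matI)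
    fix i j assume "i < dim_row (1\<^sub>m d :: complex mat)" "j < dim_col (1\<^sub>m d :: complex mat)"
    then have ij: "i < d" "j < d" by auto
    have "(1\<^sub>m d + (z - 1) \<cdot>\<^sub>m n + (w - 1) \<cdot>\<^sub>m (n + (z - 1) \<cdot>\<^sub>m n)) $$ (i, j)
      = 1\<^sub>m d $$ (i, j) + ((z - 1) * n $$ (i, j) + (w - 1) * (n $$ (i, j) + (z - 1) * n $$ (i, j)))"
      using n(1) ij by (simp add: add.assoc del: index_one_mat(1))
    also have "(z - 1) * x + (w - 1) * (x + (z - 1) * x) = (z * w - 1) * x" for x
      by (simp add: algebra_simps)
    finally show "(1\<^sub>m d + (z - 1) \<cdot>\<^sub>m n + (w - 1) \<cdot>\<^sub>m (n + (z - 1) \<cdot>\<^sub>m n)) $$ (i, j) = 1\<^sub>m d $$ (i, j)"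
      unfolding assms by simp
  qed (use n in auto)
  finally show ?thesis .
qed

end

text \<open>Interpolation of \<open>z\<close> to the power \<open>x\<close> at -1, 0 and 1, the
  possible eigenvalues of a difference \<open>D\<close> of commuting idempotents: the coefficients
  of \<open>D\<close> and of its square are \<open>(z - 1 / z) / 2\<close> and
  \<open>(z + 1 / z) / 2 - 1\<close>. The variables \<open>p\<close>, \<open>q\<close>,
  \<open>r\<close> stand for entries of the two idempotents and of their product.\<close>

lemma phase_polynomial:
  fixes z p q r :: complex
  assumes "z \<noteq> 0"
  shows "(z - 1) * p + (1 / z - 1) * (q + (z - 1) * r)
    = ((z - 1 / z) / 2) * (p - q) + ((z + 1 / z) / 2 - 1) * (p - r - (r - q))"
proof -
  define y where "y = 1 / z"
  have e: "y * z = 1" using assms by (simp add: y_def)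
  have "(z - 1) * p + (y - 1) * (q + (z - 1) * r)
      - (((z - y) / 2) * (p - q) + ((z + y) / 2 - 1) * (p - r - (r - q))) = (y * z - 1) * r"
    by (simp add: algebra_simps add_divide_distrib diff_divide_distrib)
  then show ?thesis unfolding y_def using e by (simp add: y_def)
qed

text \<open>For commuting idempotents with difference \<open>D\<close>, one has \<open>D * D * D = D\<close>, so the product of
  opposite phases is a quadratic polynomial in \<open>D\<close>.\<close>
lemma phase_product_in_assoc_alg:
  assumes "fermion_pair d X Y" "fermion_pair d X' Y'"
    and comm: "(X * Y) * (X' * Y') = (X' * Y') * (X * Y)"
    and D: "X * Y - X' * Y' \<in> assoc_alg d G" and z: "z \<noteq> 0"
  shows "phase_op d X Y z * phase_op d X' Y' (1 / z) \<in> assoc_alg d G"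
proof -
  interpret a: fermion_pair d X Y by fact
  interpret b: fermion_pair d X' Y' by fact
  define N N' where "N = X * Y" and "N' = X' * Y'"
  have c: "N \<in> carrier_mat d d" "N' \<in> carrier_mat d d"
    using a.carrier b.carrier by (simp_all add: N_def N'_def a.ring)
  have i: "N * N = N" "N' * N' = N'" "N' * N = N * N'"
    using a.number_idempotent b.number_idempotent comm by (simp_all add: N_def N'_def)
  have DD: "(N - N') * (N - N') = N - N * N' - (N * N' - N')"
    using c i by (simp add: a.ring minus_carrier_mat[where nr = d and nc = d])
  let ?s = "(z - 1 / z) / 2" and ?t = "(z + 1 / z) / 2 - 1"
  have "phase_op d X Y z * phase_op d X' Y' (1 / z)
     = (1\<^sub>m d + (z - 1) \<cdot>\<^sub>m N) + (1 / z - 1) \<cdot>\<^sub>m (N' + (z - 1) \<cdot>\<^sub>m (N * N'))"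
    using c i unfolding phase_op_def N_def[symmetric] N'_def[symmetric] by (simp add: a.ring smult_smult_mat)
  also have "\<dots> = 1\<^sub>m d + (?s \<cdot>\<^sub>m (N - N') + ?t \<cdot>\<^sub>m ((N - N') * (N - N')))"
    unfolding DD
  proof (rule eq_matI)
    fix i j assume "i < dim_row (1\<^sub>m d + (?s \<cdot>\<^sub>m (N - N') + ?t \<cdot>\<^sub>m (N - N * N' - (N * N' - N'))))"
      "j < dim_col (1\<^sub>m d + (?s \<cdot>\<^sub>m (N - N') + ?t \<cdot>\<^sub>m (N - N * N' - (N * N' - N'))))"
    then have ij: "i < d" "j < d" using c by auto
    have "(z - 1) * p + (1 / z - 1) * (q + (z - 1) * r) = ?s * (p - q) + ?t * (p - r - (r - q))" for p q r
      by (rule phase_polynomial[OF z])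
    then show "(1\<^sub>m d + (z - 1) \<cdot>\<^sub>m N + (1 / z - 1) \<cdot>\<^sub>m (N' + (z - 1) \<cdot>\<^sub>m (N * N'))) $$ (i, j)
      = (1\<^sub>m d + (?s \<cdot>\<^sub>m (N - N') + ?t \<cdot>\<^sub>m (N - N * N' - (N * N' - N')))) $$ (i, j)"
      using c ij by (simp add: add.assoc del: index_mult_mat(1) index_one_mat(1))
  qed (use c in auto)
  also have "\<dots> \<in> assoc_alg d G"
    using D unfolding N_def N'_def by (intro assoc_alg.add assoc_alg.one assoc_alg.smult assoc_alg.mult)
  finally show ?thesis .
qed

lemma chi_fermion_pair:
  assumes "m \<in> {1..L - 1}"
  shows "fermion_pair (hdim L) (chid L m) (chi L m)"
proof
  show "chi L m * chid L m + chid L m * chi L m = 1 \<cdot>\<^sub>m 1\<^sub>m (hdim L)"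
    using mode_anticommutators(1)[OF assms assms] by simp
qed (simp_all only: chi_eq_lin_ff[OF assms] chid_eq_lin_ffd[OF assms] lin_ff_anticommute lin_ffd_anticommute lin_ff_carrier lin_ffd_carrier)

lemma etab_fermion_pair:
  assumes "m \<in> {1..L - 1}"
  shows "fermion_pair (hdim L) (etabd L m) (etab L m)"
proof
  show "etab L m * etabd L m + etabd L m * etab L m = 1 \<cdot>\<^sub>m 1\<^sub>m (hdim L)"
    using mode_anticommutators(2)[OF assms assms] by simp
qed (simp_all only: etab_eq_lin_ff[OF assms] etabd_eq_lin_ffd[OF assms] lin_ff_anticommute lin_ffd_anticommute lin_ff_carrier lin_ffd_carrier)

lemma phase_op_lin_ff:
  assumes "fermion_pair (hdim L) (lin_ffd L b) (lin_ff L a)" "pairing L c b = 0"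
  shows "intertwines (phase_op (hdim L) (lin_ffd L b) (lin_ff L a) z) (lin_ff L c) 1"
proof -
  interpret fermion_pair "hdim L" "lin_ffd L b" "lin_ff L a" by fact
  show ?thesis
  proof (rule phase_op_intertwines_other[OF lin_ff_carrier])
    have "lin_ff L c * lin_ffd L b + lin_ffd L b * lin_ff L c = 0\<^sub>m (hdim L) (hdim L)"
      using lin_ff_lin_ffd_anticommute[of L c b] assms(2) by (simp add: zero_smult_one)
    then show "lin_ffd L b * lin_ff L c + lin_ff L c * lin_ffd L b = 0\<^sub>m (hdim L) (hdim L)"
      by (subst comm_add_mat[where nr = "hdim L" and nc = "hdim L"]) (auto simp: ring)
  qed (rule lin_ff_anticommute)
qed

lemma phase_op_lin_ffd:
  assumes "fermion_pair (hdim L) (lin_ffd L b) (lin_ff L a)" "pairing L a c = 0"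
  shows "intertwines (phase_op (hdim L) (lin_ffd L b) (lin_ff L a) z) (lin_ffd L c) 1"
proof -
  interpret fermion_pair "hdim L" "lin_ffd L b" "lin_ff L a" by fact
  show ?thesis
    by (rule phase_op_intertwines_other[OF lin_ffd_carrier])
       (use lin_ff_lin_ffd_anticommute[of L a c] assms(2) in \<open>simp_all add: zero_smult_one lin_ffd_anticommute\<close>)
qed

text \<open>\<open>w\<close> is the phase of the annihilator \<open>etab\<close>, while
  \<open>z\<close> is that of the creator \<open>chid\<close>; with this convention the translation
  has \<open>w = z\<close>. The waves of index 0 and \<open>L\<close> are listed so that all
  fermions are covered.\<close>

definition mode_phases :: "nat \<Rightarrow> complex mat \<Rightarrow> (nat \<Rightarrow> complex) \<Rightarrow> (nat \<Rightarrow> complex) \<Rightarrow> bool" where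
  "mode_phases L V z w \<longleftrightarrow>
     (\<forall>m\<in>{1..L - 1}. intertwines V (chid L m) (z m) \<and> intertwines V (chi L m) (1 / z m) \<and>
        intertwines V (etab L m) (w m) \<and> intertwines V (etabd L m) (1 / w m)) \<and>
     (\<forall>a\<in>{wave L 0, wave L (int L)}. intertwines V (lin_ff L a) 1 \<and> intertwines V (lin_ffd L a) 1)"

lemma mode_phases_mult:
  assumes "V \<in> carrier_mat (hdim L) (hdim L)" "W \<in> carrier_mat (hdim L) (hdim L)"
    and "mode_phases L V z w" "mode_phases L W z' w'"
  shows "mode_phases L (V * W) (\<lambda>m. z m * z' m) (\<lambda>m. w m * w' m)"
proof -
  note i = intertwines_mult[OF assms(1,2)]
  have V: "intertwines V (chid L m) (z m)" "intertwines V (chi L m) (1 / z m)"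
    "intertwines V (etab L m) (w m)" "intertwines V (etabd L m) (1 / w m)" if "m \<in> {1..L - 1}" for m
    using assms(3) that unfolding mode_phases_def by blast+
  have W: "intertwines W (chid L m) (z' m)" "intertwines W (chi L m) (1 / z' m)"
    "intertwines W (etab L m) (w' m)" "intertwines W (etabd L m) (1 / w' m)" if "m \<in> {1..L - 1}" for m
    using assms(4) that unfolding mode_phases_def by blast+
  have V0: "intertwines V (lin_ff L a) 1" "intertwines V (lin_ffd L a) 1" if "a \<in> {wave L 0, wave L (int L)}" for a
    using assms(3) that unfolding mode_phases_def by blast+
  have W0: "intertwines W (lin_ff L a) 1" "intertwines W (lin_ffd L a) 1" if "a \<in> {wave L 0, wave L (int L)}" for a
    using assms(4) that unfolding mode_phases_def by blast+
  have q: "1 / (x * y) = 1 / x * (1 / y)" for x y :: complex by simp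
  have "intertwines (V * W) (chid L m) (z m * z' m) \<and> intertwines (V * W) (chi L m) (1 / (z m * z' m)) \<and>
        intertwines (V * W) (etab L m) (w m * w' m) \<and> intertwines (V * W) (etabd L m) (1 / (w m * w' m))"
    if "m \<in> {1..L - 1}" for m
    unfolding q by (intro conjI i V[OF that] W[OF that] mode_carrier[OF that])
  moreover have "intertwines (V * W) (lin_ff L a) 1 \<and> intertwines (V * W) (lin_ffd L a) 1"
    if "a \<in> {wave L 0, wave L (int L)}" for a
    using i[OF lin_ff_carrier V0(1)[OF that] W0(1)[OF that]] i[OF lin_ffd_carrier V0(2)[OF that] W0(2)[OF that]] by simp
  ultimately show ?thesis unfolding mode_phases_def by blast
qed

lemma pairing_uminus: "pairing L (\<lambda>k. - a k) b = - pairing L a b"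
  by (simp add: pairing_def sum_negf)

lemma mode_phases_chi:
  assumes n: "n \<in> {1..L - 1}" and z: "z \<noteq> 0"
  shows "mode_phases L (phase_op (hdim L) (chid L n) (chi L n) z) (\<lambda>m. if m = n then z else 1) (\<lambda>_. 1)"
proof -
  interpret fermion_pair "hdim L" "chid L n" "chi L n" by (rule chi_fermion_pair[OF n])
  let ?K = "phase_op (hdim L) (chid L n) (chi L n) z"
  note f = phase_op_lin_ff[OF chi_fermion_pair[OF n, unfolded chi_eq_lin_ff[OF n] chid_eq_lin_ffd[OF n]]]
    phase_op_lin_ffd[OF chi_fermion_pair[OF n, unfolded chi_eq_lin_ff[OF n] chid_eq_lin_ffd[OF n]]]
  have K: "?K = phase_op (hdim L) (lin_ffd L (mode_coeff L 1 (- int n))) (lin_ff L (mode_coeff L 1 (int n))) z"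
    using n by (simp add: chi_eq_lin_ff chid_eq_lin_ffd)
  have "intertwines ?K (chid L m) 1" "intertwines ?K (chi L m) 1" if "m \<in> {1..L - 1}" "m \<noteq> n" for m
    using n that unfolding K chi_eq_lin_ff[OF that(1)] chid_eq_lin_ffd[OF that(1)] by (auto intro!: f simp: pairing_mode_coeff)
  moreover have "intertwines ?K (etabd L m) 1" "intertwines ?K (etab L m) 1" if "m \<in> {1..L - 1}" for m
    using n that unfolding K etab_eq_lin_ff[OF that(1)] etabd_eq_lin_ffd[OF that(1)]
    by (auto intro!: f simp: pairing_mode_coeff pairing_uminus)
  moreover have "intertwines ?K (lin_ff L a) 1" "intertwines ?K (lin_ffd L a) 1" if "a \<in> {wave L 0, wave L (int L)}" for a
    using n that unfolding K by (auto intro!: f simp: pairing_zero_mode_coeff)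
  ultimately show ?thesis
    using phase_op_intertwines_creator[of z] phase_op_intertwines_annihilator[OF z]
    unfolding mode_phases_def by auto
qed

lemma etab_eq_lin_ff': "m \<in> {1..L - 1} \<Longrightarrow> etab L m = lin_ff L (\<lambda>k. - mode_coeff L (- 1) (- int m) k)"
  using etab_eq_lin_ff by simp

text \<open>The inverse phase is put on the creator \<open>etabd\<close>, so that the annihilator
  \<open>etab\<close> receives \<open>z\<close>.\<close>

lemma mode_phases_etab:
  assumes n: "n \<in> {1..L - 1}" and z: "z \<noteq> 0"
  shows "mode_phases L (phase_op (hdim L) (etabd L n) (etab L n) (1 / z)) (\<lambda>_. 1) (\<lambda>m. if m = n then z else 1)"
proof -
  interpret fermion_pair "hdim L" "etabd L n" "etab L n" by (rule etab_fermion_pair[OF n])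
  let ?K = "phase_op (hdim L) (etabd L n) (etab L n) (1 / z)"
  note f = phase_op_lin_ff[OF etab_fermion_pair[OF n, unfolded etab_eq_lin_ff'[OF n] etabd_eq_lin_ffd[OF n]]]
    phase_op_lin_ffd[OF etab_fermion_pair[OF n, unfolded etab_eq_lin_ff'[OF n] etabd_eq_lin_ffd[OF n]]]
  have K: "?K = phase_op (hdim L) (lin_ffd L (mode_coeff L (- 1) (int n))) (lin_ff L (\<lambda>k. - mode_coeff L (- 1) (- int n) k)) (1 / z)"
    by (simp only: etab_eq_lin_ff'[OF n] etabd_eq_lin_ffd[OF n])
  have "intertwines ?K (etabd L m) 1" "intertwines ?K (etab L m) 1" if "m \<in> {1..L - 1}" "m \<noteq> n" for m
    using n that unfolding K etab_eq_lin_ff'[OF that(1)] etabd_eq_lin_ffd[OF that(1)]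
    by (auto intro!: f simp: pairing_mode_coeff pairing_uminus)
  moreover have "intertwines ?K (chid L m) 1" "intertwines ?K (chi L m) 1" if "m \<in> {1..L - 1}" for m
    using n that unfolding K chi_eq_lin_ff[OF that(1)] chid_eq_lin_ffd[OF that(1)]
    by (auto intro!: f simp: pairing_mode_coeff pairing_uminus)
  moreover have "intertwines ?K (lin_ff L a) 1" "intertwines ?K (lin_ffd L a) 1" if "a \<in> {wave L 0, wave L (int L)}" for a
    using n that unfolding K by (auto intro!: f simp: pairing_zero_mode_coeff pairing_uminus)
  ultimately show ?thesis
    using phase_op_intertwines_creator[of "1 / z"] phase_op_intertwines_annihilator[of "1 / z"] z
    unfolding mode_phases_def by auto
qed

lemma number_commute:
  assumes n: "n \<in> {1..L - 1}"
  shows "(chid L n * chi L n) * (etabd L n * etab L n) = (etabd L n * etab L n) * (chid L n * chi L n)"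
proof -
  note c = mode_carrier[OF n]
  have "(chid L n * chi L n) * (etabd L n * etab L n) - (etabd L n * etab L n) * (chid L n * chi L n)
      = 0 \<cdot>\<^sub>m (chid L n * etab L n) - 0 \<cdot>\<^sub>m (etabd L n * chi L n)"
    by (rule commutator_bilinear[OF c(2,1,4,3)])
       (use mode_anticommutators(3,4)[OF n n] in \<open>simp_all add: chi_eq_lin_ff[OF n] chid_eq_lin_ffd[OF n] etab_eq_lin_ff[OF n]
          etabd_eq_lin_ffd[OF n] lin_ff_anticommute lin_ffd_anticommute\<close>)
  then have "((chid L n * chi L n) * (etabd L n * etab L n) - (etabd L n * etab L n) * (chid L n * chi L n)) $$ (i, j) = 0"
    if "i < hdim L" "j < hdim L" for i j
    using that mode_dim[OF n] by simp
  then show ?thesis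
    using mode_dim[OF n] by (intro eq_matI) (auto simp del: index_mult_mat(1))
qed

text \<open>Induction over the modes, each contributing one factor with opposite phases on its two
  number operators. The inverse is kept inside the algebra because it is what will represent
  \<open>Uinv\<close>.\<close>

lemma mode_phases_in_SN:
  assumes z: "\<And>m. z m \<noteq> 0" and "n \<le> L - 1"
  shows "\<exists>V VI. V \<in> assoc_alg (hdim L) (SN_gens L) \<and> VI \<in> assoc_alg (hdim L) (SN_gens L) \<and>
     V \<in> carrier_mat (hdim L) (hdim L) \<and> VI \<in> carrier_mat (hdim L) (hdim L) \<and>
     V * VI = 1\<^sub>m (hdim L) \<and> VI * V = 1\<^sub>m (hdim L) \<and> mode_phases L V (\<lambda>m. if m \<le> n then z m else 1) (\<lambda>m. if m \<le> n then z m else 1)"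
  using assms(2)
proof (induction n)
  case 0
  have "intertwines (1\<^sub>m (hdim L)) M 1" if "M \<in> carrier_mat (hdim L) (hdim L)" for M
    using that by (simp add: intertwines_def smult_1_id)
  then have "mode_phases L (1\<^sub>m (hdim L)) (\<lambda>m. if m \<le> 0 then z m else 1) (\<lambda>m. if m \<le> 0 then z m else 1)"
    using mode_carrier by (auto simp: mode_phases_def)
  then show ?case
    by (intro exI[of _ "1\<^sub>m (hdim L)"]) (auto intro: assoc_alg.one)
next
  case (Suc n)
  let ?S = "assoc_alg (hdim L) (SN_gens L)" and ?d = "hdim L"
  obtain V VI where V: "V \<in> ?S" "VI \<in> ?S" "V \<in> carrier_mat ?d ?d" "VI \<in> carrier_mat ?d ?d"
    "V * VI = 1\<^sub>m ?d" "VI * V = 1\<^sub>m ?d" "mode_phases L V (\<lambda>m. if m \<le> n then z m else 1) (\<lambda>m. if m \<le> n then z m else 1)"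
    using Suc by auto
  define k where "k = Suc n"
  have k: "k \<in> {1..L - 1}" "k < L" using Suc.prems by (auto simp: k_def)
  interpret a: fermion_pair ?d "chid L k" "chi L k" by (rule chi_fermion_pair[OF k(1)])
  interpret b: fermion_pair ?d "etabd L k" "etab L k" by (rule etab_fermion_pair[OF k(1)])
  define A where "A x = phase_op ?d (chid L k) (chi L k) x" for x
  define B where "B x = phase_op ?d (etabd L k) (etab L k) x" for x
  have c: "A x \<in> carrier_mat ?d ?d" "B x \<in> carrier_mat ?d ?d" for x
    unfolding A_def B_def by (rule a.phase_op_carrier b.phase_op_carrier)+
  have "AA L k k \<in> ?S"
    by (rule assoc_alg.gen) (use k in \<open>auto simp: SN_gens_def\<close>)
  then have D: "chid L k * chi L k - etabd L k * etab L k \<in> ?S"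
    using k by (simp add: AA_def EE_def)
  have "etabd L k * etab L k - chid L k * chi L k = (- 1) \<cdot>\<^sub>m (chid L k * chi L k - etabd L k * etab L k)"
    using mode_dim[OF k(1)] by (intro eq_matI) (auto simp del: index_mult_mat(1))
  then have D': "etabd L k * etab L k - chid L k * chi L k \<in> ?S"
    using assoc_alg.smult[OF D] by simp
  \<comment> \<open>The second product is the inverse of the first. It has the roles of the two
    number operators exchanged and so rests on the negated difference \<open>D'\<close>.\<close>
  have P: "A (z k) * B (1 / z k) \<in> ?S" "B (z k) * A (1 / z k) \<in> ?S"
    unfolding A_def B_def
    by (rule phase_product_in_assoc_alg[OF a.fermion_pair_axioms b.fermion_pair_axioms number_commute[OF k(1)] D z],
        rule phase_product_in_assoc_alg[OF b.fermion_pair_axioms a.fermion_pair_axioms number_commute[OF k(1), symmetric] D' z])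
  have inv: "A (z k) * A (1 / z k) = 1\<^sub>m ?d" "A (1 / z k) * A (z k) = 1\<^sub>m ?d"
    "B (z k) * B (1 / z k) = 1\<^sub>m ?d" "B (1 / z k) * B (z k) = 1\<^sub>m ?d"
    unfolding A_def B_def using z[of k] by (auto intro!: a.phase_op_inverse b.phase_op_inverse)
  have cancel: "(p * q) * (r * s) = 1\<^sub>m ?d"
    if "q * r = 1\<^sub>m ?d" "p * s = 1\<^sub>m ?d" "p \<in> carrier_mat ?d ?d" "q \<in> carrier_mat ?d ?d" "r \<in> carrier_mat ?d ?d" "s \<in> carrier_mat ?d ?d"
    for p q r s :: "complex mat"
  proof -
    have "(p * q) * (r * s) = p * ((q * r) * s)" using that(3-) by (simp add: a.ring)
    then show ?thesis using that by simp
  qed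
  let ?P = "A (z k) * B (1 / z k)" and ?Q = "B (z k) * A (1 / z k)"
  have cP: "?P \<in> carrier_mat ?d ?d" "?Q \<in> carrier_mat ?d ?d" using c by (simp_all add: a.ring)
  have PQ: "?P * ?Q = 1\<^sub>m ?d" "?Q * ?P = 1\<^sub>m ?d" using c inv by (auto intro!: cancel)
  have "mode_phases L (A (z k)) (\<lambda>m. if m = k then z k else 1) (\<lambda>_. 1)"
    unfolding A_def by (rule mode_phases_chi[OF k(1) z])
  moreover have "mode_phases L (B (1 / z k)) (\<lambda>_. 1) (\<lambda>m. if m = k then z k else 1)"
    unfolding B_def by (rule mode_phases_etab[OF k(1) z])
  ultimately have "mode_phases L ?P (\<lambda>m. (if m = k then z k else 1) * 1) (\<lambda>m. 1 * (if m = k then z k else 1))"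
    by (rule mode_phases_mult[OF c])
  from mode_phases_mult[OF cP(1) V(3) this V(7)]
  have "mode_phases L (?P * V) (\<lambda>m. (if m = k then z k else 1) * 1 * (if m \<le> n then z m else 1))
      (\<lambda>m. 1 * (if m = k then z k else 1) * (if m \<le> n then z m else 1))" .
  moreover have "(\<lambda>m. (if m = k then z k else 1) * 1 * (if m \<le> n then z m else 1)) = (\<lambda>m. if m \<le> Suc n then z m else 1)"
    "(\<lambda>m. 1 * (if m = k then z k else 1) * (if m \<le> n then z m else 1)) = (\<lambda>m. if m \<le> Suc n then z m else 1)"
    by (auto simp: k_def le_Suc_eq fun_eq_iff)
  ultimately have "mode_phases L (?P * V) (\<lambda>m. if m \<le> Suc n then z m else 1) (\<lambda>m. if m \<le> Suc n then z m else 1)"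
    by simp
  moreover have "(?P * V) * (VI * ?Q) = 1\<^sub>m ?d" "(VI * ?Q) * (?P * V) = 1\<^sub>m ?d"
    using V cP PQ by (auto intro!: cancel)
  moreover have "?P * V \<in> ?S" "VI * ?Q \<in> ?S" using P V by (auto intro: assoc_alg.mult)
  moreover have "?P * V \<in> carrier_mat ?d ?d" "VI * ?Q \<in> carrier_mat ?d ?d" using V cP by (simp_all add: a.ring)
  ultimately show ?case by blast
qed

section \<open>The translation operator\<close>

lemma mat_mult_msum:
  assumes "A \<in> carrier_mat d d" "\<And>k. k \<in> K \<Longrightarrow> F k \<in> carrier_mat d d"
  shows "A * msum d F K = msum d (\<lambda>k. A * F k) K" "msum d F K * A = msum d (\<lambda>k. F k * A) K"
proof -
  show "A * msum d F K = msum d (\<lambda>k. A * F k) K"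
  proof (rule eq_matI)
    fix r s assume "r < dim_row (msum d (\<lambda>k. A * F k) K)" "s < dim_col (msum d (\<lambda>k. A * F k) K)"
    then have rs: "r < d" "s < d" by (auto simp: msum_def)
    have "(A * msum d F K) $$ (r, s) = (\<Sum>t<d. \<Sum>k\<in>K. A $$ (r, t) * F k $$ (t, s))"
      using rs assms(1) by (simp add: msum_def scalar_prod_def lessThan_atLeast0 sum_distrib_left)
    also have "\<dots> = (\<Sum>k\<in>K. \<Sum>t<d. A $$ (r, t) * F k $$ (t, s))" by (rule sum.swap)
    also have "\<dots> = (\<Sum>k\<in>K. (A * F k) $$ (r, s))"
    proof (rule sum.cong[OF refl])
      fix k assume "k \<in> K"
      from assms(2)[OF this] show "(\<Sum>t<d. A $$ (r, t) * F k $$ (t, s)) = (A * F k) $$ (r, s)"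
        using rs assms(1) by (simp add: scalar_prod_def lessThan_atLeast0)
    qed
    finally show "(A * msum d F K) $$ (r, s) = msum d (\<lambda>k. A * F k) K $$ (r, s)"
      using rs by (simp add: msum_def)
  qed (use assms(1) in \<open>auto simp: msum_def\<close>)
  show "msum d F K * A = msum d (\<lambda>k. F k * A) K"
  proof (rule eq_matI)
    fix r s assume "r < dim_row (msum d (\<lambda>k. F k * A) K)" "s < dim_col (msum d (\<lambda>k. F k * A) K)"
    then have rs: "r < d" "s < d" by (auto simp: msum_def)
    have "(msum d F K * A) $$ (r, s) = (\<Sum>t<d. \<Sum>k\<in>K. F k $$ (r, t) * A $$ (t, s))"
      using rs assms(1) by (simp add: msum_def scalar_prod_def lessThan_atLeast0 sum_distrib_right)
    also have "\<dots> = (\<Sum>k\<in>K. \<Sum>t<d. F k $$ (r, t) * A $$ (t, s))" by (rule sum.swap)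
    also have "\<dots> = (\<Sum>k\<in>K. (F k * A) $$ (r, s))"
    proof (rule sum.cong[OF refl])
      fix k assume "k \<in> K"
      from assms(2)[OF this] show "(\<Sum>t<d. F k $$ (r, t) * A $$ (t, s)) = (F k * A) $$ (r, s)"
        using rs assms(1) by (simp add: scalar_prod_def lessThan_atLeast0)
    qed
    finally show "(msum d F K * A) $$ (r, s) = msum d (\<lambda>k. F k * A) K $$ (r, s)"
      using rs by (simp add: msum_def)
  qed (use assms(1) in \<open>auto simp: msum_def\<close>)
qed

lemma shift2_eq:
  assumes "L \<ge> 2" "k \<in> {1..2 * L}"
  shows "shift2 L k = (if k \<le> 2 * L - 2 then k + 2 else k + 2 - 2 * L)"
proof (cases "k \<le> 2 * L - 2")
  case True
  then have "(k + 1) mod (2 * L) = k + 1" using assms by (intro mod_less) auto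
  then show ?thesis using True by (simp add: shift2_def)
next
  case False
  then have "k + 1 = (k + 1 - 2 * L) + 2 * L" using assms by auto
  then have "(k + 1) mod (2 * L) = (k + 1 - 2 * L) mod (2 * L)" by (metis mod_add_self2)
  also have "\<dots> = k + 1 - 2 * L" using assms by (intro mod_less) auto
  finally show ?thesis using False assms by (simp add: shift2_def)
qed

lemma sum_shift2:
  assumes "L \<ge> 2"
  shows "(\<Sum>k\<in>{1..2 * L}. g (shift2 L k)) = (\<Sum>k\<in>{1..2 * L}. g k)"
proof (rule sum.reindex_bij_witness[where i = "\<lambda>k. if k \<le> 2 then k + 2 * L - 2 else k - 2" and j = "shift2 L"])
  fix k assume k: "k \<in> {1..2 * L}"
  let ?i = "if k \<le> 2 then k + 2 * L - 2 else k - 2"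
  show i: "?i \<in> {1..2 * L}" using k assms by auto
  show "shift2 L ?i = k" unfolding shift2_eq[OF assms i] using k assms by auto
  show "(if shift2 L k \<le> 2 then shift2 L k + 2 * L - 2 else shift2 L k - 2) = k" "shift2 L k \<in> {1..2 * L}"
    unfolding shift2_eq[OF assms k] using k assms by auto
qed simp

text \<open>Conjugation carries the term at site \<open>k\<close> to \<open>shift2 L k\<close>, so
  the coefficients travel along with the shift.\<close>

lemma conjugate_msum:
  assumes "L \<ge> 2" "A \<in> carrier_mat d d" "B \<in> carrier_mat d d"
    and F: "\<And>k. F k \<in> carrier_mat d d"
    and conj: "\<And>k. k \<in> {1..2 * L} \<Longrightarrow> A * F k * B = F (shift2 L k)"
    and b: "\<And>k. k \<in> {1..2 * L} \<Longrightarrow> b (shift2 L k) = a k"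
  shows "A * msum d (\<lambda>k. a k \<cdot>\<^sub>m F k) {1..2 * L} * B = msum d (\<lambda>k. b k \<cdot>\<^sub>m F k) {1..2 * L}"
proof -
  have "A * msum d (\<lambda>k. a k \<cdot>\<^sub>m F k) {1..2 * L} * B = msum d (\<lambda>k. A * (a k \<cdot>\<^sub>m F k) * B) {1..2 * L}"
    using assms(2,3) F by (simp add: mat_mult_msum)
  also have "\<dots> = msum d (\<lambda>k. b k \<cdot>\<^sub>m F k) {1..2 * L}"
    unfolding msum_def
  proof (rule cong_mat[OF refl refl])
    fix r s :: nat assume "r < d" "s < d"
    have "(\<Sum>k\<in>{1..2 * L}. (A * (a k \<cdot>\<^sub>m F k) * B) $$ (r, s)) = (\<Sum>k\<in>{1..2 * L}. (b (shift2 L k) \<cdot>\<^sub>m F (shift2 L k)) $$ (r, s))"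
    proof (rule sum.cong[OF refl])
      fix k assume k: "k \<in> {1..2 * L}"
      have "A * (a k \<cdot>\<^sub>m F k) * B = a k \<cdot>\<^sub>m (A * F k * B)"
        using assms(2,3) F by (simp add: matrix_smult[where d = d] mult_carrier_mat[where n = d])
      then show "(A * (a k \<cdot>\<^sub>m F k) * B) $$ (r, s) = (b (shift2 L k) \<cdot>\<^sub>m F (shift2 L k)) $$ (r, s)"
        using conj[OF k] b[OF k] by simp
    qed
    also have "\<dots> = (\<Sum>k\<in>{1..2 * L}. (b k \<cdot>\<^sub>m F k) $$ (r, s))"
      by (rule sum_shift2[OF assms(1)])
    finally show "(\<lambda>ij. \<Sum>k\<in>{1..2 * L}. (A * (a k \<cdot>\<^sub>m F k) * B) $$ ij) (r, s)
       = (\<lambda>ij. \<Sum>k\<in>{1..2 * L}. (b k \<cdot>\<^sub>m F k) $$ ij) (r, s)" .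
  qed
  finally show ?thesis .
qed

lemma wave_shift2:
  assumes "L \<ge> 2" "k \<in> {1..2 * L}"
  shows "wave L n (shift2 L k) = cis (- (2 * pi * of_int n / of_nat L)) * wave L n k"
proof -
  have 1: "wave L n (j + 2) = cis (- (2 * pi * of_int n / of_nat L)) * wave L n j" for j
    using assms(1) by (simp add: wave_def cis_mult add_divide_distrib algebra_simps)
  have 2: "wave L n (j + 2 * L) = wave L n j" for j
  proof -
    have "- (pi * of_int n * of_nat (j + 2 * L) / of_nat L) = - (pi * of_int n * of_nat j / of_nat L) + 2 * pi * of_int (- n)"
      using assms(1) by (simp add: add_divide_distrib algebra_simps)
    then show ?thesis unfolding wave_def by (simp only: cis_mult[symmetric] cis_multiple_2pi Ints_of_int mult_1_right)
  qed
  show ?thesis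
  proof (cases "k \<le> 2 * L - 2")
    case False
    then have "k + 2 - 2 * L + 2 * L = k + 2" by auto
    then show ?thesis using False 1[of k] 2[of "k + 2 - 2 * L"] by (simp add: shift2_eq[OF assms])
  next
    case True
    then show ?thesis using 1[of k] by (simp add: shift2_eq[OF assms])
  qed
qed

text \<open>A shift by two sites does not separate the waves \<open>n\<close> and
  \<open>n + L\<close>, whose factors differ by a full turn. Hence every mode is an eigenvector of
  the translation.\<close>

lemma mode_coeff_shift2:
  assumes "L \<ge> 2" "k \<in> {1..2 * L}"
  shows "mode_coeff L \<sigma> n (shift2 L k) = cis (- (2 * pi * of_int n / of_nat L)) * mode_coeff L \<sigma> n k"
proof -
  have "- (2 * pi * of_int (n + int L) / of_nat L) = - (2 * pi * of_int n / of_nat L) + 2 * pi * of_int (- 1)"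
    using assms(1) by (simp add: add_divide_distrib algebra_simps)
  then have "cis (- (2 * pi * of_int (n + int L) / of_nat L)) = cis (- (2 * pi * of_int n / of_nat L))"
    by (simp only: cis_mult[symmetric] cis_multiple_2pi Ints_of_int mult_1_right)
  then show ?thesis unfolding mode_coeff_def wave_shift2[OF assms] by (simp add: algebra_simps)
qed

text \<open>Both sides combine the same two waves, with the roots swapped by reflection. This makes
  \<open>etab\<close> at \<open>L - m\<close> the partner of \<open>chi\<close> at \<open>m\<close>:
  together they span the waves \<open>m\<close> and \<open>m + L\<close>.\<close>

lemma mode_coeff_reflect:
  assumes "m \<in> {1..L - 1}" "\<sigma> * \<sigma> = 1"
  shows "mode_coeff L \<sigma> (- int (L - m)) k = \<sigma> * mode_coeff L \<sigma> (int m) k"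
proof -
  have e: "- int (L - m) + int L = int m" "nat \<bar>- int (L - m)\<bar> = L - m" using assms by auto
  have "\<sigma> * (\<sigma> * x) = x" for x using assms(2) by (simp flip: mult.assoc)
  then show ?thesis
    unfolding mode_coeff_def e wave_int_diff'[OF assms(1)] cot_root_reflect[OF assms(1)] by (simp add: algebra_simps)
qed

lemma commute_all:
  assumes L: "L > 0" and W: "W \<in> carrier_mat (hdim L) (hdim L)"
    and modes: "\<And>m. m \<in> {1..L - 1} \<Longrightarrow> intertwines W (chi L m) 1 \<and> intertwines W (etab L m) 1
        \<and> intertwines W (chid L m) 1 \<and> intertwines W (etabd L m) 1"
    and zero: "\<And>a. a \<in> {wave L 0, wave L (int L)} \<Longrightarrow> intertwines W (lin_ff L a) 1 \<and> intertwines W (lin_ffd L a) 1"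
  shows "W * lin_ff L a = lin_ff L a * W" "W * lin_ffd L a = lin_ffd L a * W"
proof -
  note ring = matrix_distrib[where d = "hdim L"] matrix_smult[where d = "hdim L"]
  \<comment> \<open>Solves for the two waves from the coefficients with \<open>\<sigma>\<close>
    equal to 1 and -1. The roots may be divided by, as their product is 1.\<close>
  have md1: "wave L (int m) k = cr (sqrt 2) * cr (sqrt (2 * real L)) / (2 * cot_root L m) * (mode_coeff L 1 (int m) k + mode_coeff L (- 1) (int m) k)"
    "wave L (int m + int L) k = cr (sqrt 2) * cr (sqrt (2 * real L)) / (2 * tan_root L m) * (mode_coeff L 1 (int m) k + - 1 * mode_coeff L (- 1) (int m) k)"
    if "m \<in> {1..L - 1}" for m k
  proof -
    have "cot_root L m \<noteq> 0" "tan_root L m \<noteq> 0" using cot_root_tan_root[OF that] by auto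
    moreover have "cr (sqrt 2) * cr (sqrt (2 * real L)) \<noteq> 0" using L by (simp add: cr_def)
    ultimately show "wave L (int m) k = cr (sqrt 2) * cr (sqrt (2 * real L)) / (2 * cot_root L m) * (mode_coeff L 1 (int m) k + mode_coeff L (- 1) (int m) k)"
      "wave L (int m + int L) k = cr (sqrt 2) * cr (sqrt (2 * real L)) / (2 * tan_root L m) * (mode_coeff L 1 (int m) k + - 1 * mode_coeff L (- 1) (int m) k)"
      by (simp_all add: mode_coeff_def field_simps)
  qed
  have refl: "L - m \<in> {1..L - 1}" if "m \<in> {1..L - 1}" for m using that by auto
  have int1: "W * X = X * W" if "intertwines W X 1" for X
    using that by (simp add: intertwines_def smult_1_id)
  have add: "W * (X + Y) = (X + Y) * W" if "W * X = X * W" "W * Y = Y * W"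
      "X \<in> carrier_mat (hdim L) (hdim L)" "Y \<in> carrier_mat (hdim L) (hdim L)" for X Y
    using that W by (simp add: ring)
  have smult: "W * (c \<cdot>\<^sub>m X) = (c \<cdot>\<^sub>m X) * W" if "W * X = X * W" "X \<in> carrier_mat (hdim L) (hdim L)" for c X
    using that W by (simp add: ring)
  define P where "P a \<longleftrightarrow> W * lin_ff L a = lin_ff L a * W" for a
  define Q where "Q a \<longleftrightarrow> W * lin_ffd L a = lin_ffd L a * W" for a
  have Pcong: "P b" if "\<And>k. k \<in> {1..2 * L} \<Longrightarrow> a k = b k" "P a" for a b
    using lin_ff_cong[of L a b, OF that(1)] that(2) by (simp add: P_def)
  have Qcong: "Q b" if "\<And>k. k \<in> {1..2 * L} \<Longrightarrow> a k = b k" "Q a" for a b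
    using lin_ffd_cong[of L a b, OF that(1)] that(2) by (simp add: Q_def)
  have Padd: "P (\<lambda>k. a k + b k)" if "P a" "P b" for a b
    using that unfolding P_def lin_ff_add by (intro add lin_ff_carrier)
  have Qadd: "Q (\<lambda>k. a k + b k)" if "Q a" "Q b" for a b
    using that unfolding Q_def lin_ffd_add by (intro add lin_ffd_carrier)
  have Psmult: "P (\<lambda>k. c * a k)" if "P a" for c a
    using that unfolding P_def lin_ff_smult by (intro smult lin_ff_carrier)
  have Qsmult: "Q (\<lambda>k. c * a k)" if "Q a" for c a
    using that unfolding Q_def lin_ffd_smult by (intro smult lin_ffd_carrier)
  have P1: "P (mode_coeff L 1 (int m))" if m: "m \<in> {1..L - 1}" for m
    using modes[OF m] int1 by (simp add: P_def chi_eq_lin_ff[OF m])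
  have P2: "P (mode_coeff L (- 1) (int m))" if m: "m \<in> {1..L - 1}" for m
  proof (rule Pcong)
    show "P (\<lambda>k. - 1 * mode_coeff L (- 1) (- int (L - m)) k)"
      using modes[OF refl[OF m]] int1 unfolding P_def etab_eq_lin_ff[OF refl[OF m]] by blast
  qed (simp add: mode_coeff_reflect[OF m])
  have Q2: "Q (mode_coeff L (- 1) (int m))" if m: "m \<in> {1..L - 1}" for m
    using modes[OF m] int1 by (simp add: Q_def etabd_eq_lin_ffd[OF m])
  have Q1: "Q (mode_coeff L 1 (int m))" if m: "m \<in> {1..L - 1}" for m
  proof (rule Qcong)
    show "Q (mode_coeff L 1 (- int (L - m)))"
      using modes[OF refl[OF m]] int1 unfolding Q_def chid_eq_lin_ffd[OF refl[OF m]] by blast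
  qed (simp add: mode_coeff_reflect[OF m])
  have "P a"
  proof (rule wave_induct[OF L, where P = P])
    show "P b" if "\<And>k. k \<in> {1..2 * L} \<Longrightarrow> a k = b k" "P a" for a b using that by (rule Pcong)
    show "P (\<lambda>k. a k + b k)" if "P a" "P b" for a b using that by (rule Padd)
    show "P (\<lambda>k. c * a k)" if "P a" for c a using that by (rule Psmult)
    show "P (wave L 0)" "P (wave L (int L))" using zero int1 by (auto simp: P_def)
    fix m assume m: "m \<in> {1..L - 1}"
    show "P (wave L (int m))"
      by (rule Pcong[OF md1(1)[OF m, symmetric]]) (intro Psmult Padd P1 P2 m)
    show "P (wave L (int m + int L))"
      by (rule Pcong[OF md1(2)[OF m, symmetric]]) (rule Psmult[OF Padd[OF P1[OF m] Psmult[OF P2[OF m]]]])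
  qed
  then show "W * lin_ff L a = lin_ff L a * W" by (simp add: P_def)
  have "Q a"
  proof (rule wave_induct[OF L, where P = Q])
    show "Q b" if "\<And>k. k \<in> {1..2 * L} \<Longrightarrow> a k = b k" "Q a" for a b using that by (rule Qcong)
    show "Q (\<lambda>k. a k + b k)" if "Q a" "Q b" for a b using that by (rule Qadd)
    show "Q (\<lambda>k. c * a k)" if "Q a" for c a using that by (rule Qsmult)
    show "Q (wave L 0)" "Q (wave L (int L))" using zero int1 by (auto simp: Q_def)
    fix m assume m: "m \<in> {1..L - 1}"
    show "Q (wave L (int m))"
      by (rule Qcong[OF md1(1)[OF m, symmetric]]) (intro Qsmult Qadd Q1 Q2 m)
    show "Q (wave L (int m + int L))"
      by (rule Qcong[OF md1(2)[OF m, symmetric]]) (rule Qsmult[OF Qadd[OF Q1[OF m] Qsmult[OF Q2[OF m]]]])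
  qed
  then show "W * lin_ffd L a = lin_ffd L a * W" by (simp add: Q_def)
qed

lemma intertwines_cancel:
  assumes c: "V \<in> carrier_mat d d" "VI \<in> carrier_mat d d" "U \<in> carrier_mat d d" "M \<in> carrier_mat d d"
    and inv: "V * VI = 1\<^sub>m d" "VI * V = 1\<^sub>m d"
    and "intertwines V M z" "intertwines U M z"
  shows "intertwines (VI * U) M 1"
proof -
  note ring = matrix_distrib[where d = d] matrix_smult[where d = d] mult_carrier_mat[where n = d and nr = d and nc = d]
    left_mult_one_mat[where nr = d and nc = d] right_mult_one_mat[where nr = d and nc = d]
  have V: "V * M = z \<cdot>\<^sub>m (M * V)" and U: "U * M = z \<cdot>\<^sub>m (M * U)" using assms by (simp_all add: intertwines_def)
  have "M * VI = (VI * V) * (M * VI)" using c by (simp add: inv ring)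
  also have "\<dots> = VI * ((V * M) * VI)" using c by (simp add: ring)
  also have "\<dots> = z \<cdot>\<^sub>m (VI * (M * (V * VI)))" unfolding V using c by (simp add: ring)
  also have "\<dots> = z \<cdot>\<^sub>m (VI * M)" using c by (simp add: inv ring)
  finally have M: "M * VI = z \<cdot>\<^sub>m (VI * M)" .
  have "VI * U * M = VI * (U * M)" using c by (simp add: ring)
  also have "\<dots> = (z \<cdot>\<^sub>m (VI * M)) * U" unfolding U using c by (simp add: ring)
  also have "\<dots> = M * (VI * U)" unfolding M[symmetric] using c by (simp add: ring)
  finally show ?thesis by (simp add: intertwines_def smult_1_id)
qed

lemma conjugation_intertwines:
  assumes c: "U \<in> carrier_mat d d" "Uinv \<in> carrier_mat d d" "M \<in> carrier_mat d d"
    and "Uinv * U = 1\<^sub>m d" "U * M * Uinv = z \<cdot>\<^sub>m M"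
  shows "intertwines U M z"
proof -
  note ring = matrix_distrib[where d = d] matrix_smult[where d = d] mult_carrier_mat[where n = d and nr = d and nc = d]
    left_mult_one_mat[where nr = d and nc = d] right_mult_one_mat[where nr = d and nc = d]
  have "U * M = (U * M) * (Uinv * U)" using c by (simp add: assms(4) ring)
  also have "\<dots> = (U * M * Uinv) * U" using c by (simp add: ring)
  also have "\<dots> = z \<cdot>\<^sub>m (M * U)" unfolding assms(5) using c by (simp add: ring)
  finally show ?thesis by (simp add: intertwines_def)
qed

lemma translation_in_assoc_alg:
  assumes L: "L \<ge> 2"
    and U: "U \<in> carrier_mat (hdim L) (hdim L)" and Ui: "Uinv \<in> carrier_mat (hdim L) (hdim L)"
    and inv: "U * Uinv = 1\<^sub>m (hdim L)" "Uinv * U = 1\<^sub>m (hdim L)"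
    and ff: "\<And>j. j \<in> {1..2 * L} \<Longrightarrow> U * ff L j * Uinv = ff L (shift2 L j)"
    and ffd: "\<And>j. j \<in> {1..2 * L} \<Longrightarrow> U * ffd L j * Uinv = ffd L (shift2 L j)"
  shows "U \<in> assoc_alg (hdim L) (SN_gens L)" "Uinv \<in> assoc_alg (hdim L) (SN_gens L)"
proof -
  let ?d = "hdim L" and ?S = "assoc_alg (hdim L) (SN_gens L)"
  note ring = matrix_distrib[where d = ?d] matrix_smult[where d = ?d] mult_carrier_mat[where n = ?d and nr = ?d and nc = ?d]
    left_mult_one_mat[where nr = ?d and nc = ?d] right_mult_one_mat[where nr = ?d and nc = ?d]
  have L0: "L > 0" using L by simp
  have Ulf: "intertwines U (lin_ff L a) z" if "\<And>k. k \<in> {1..2 * L} \<Longrightarrow> z * a (shift2 L k) = a k" for z a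
  proof (rule conjugation_intertwines[OF U Ui lin_ff_carrier inv(2)])
    show "U * lin_ff L a * Uinv = z \<cdot>\<^sub>m lin_ff L a"
      unfolding lin_ff_smult[symmetric] unfolding lin_ff_def
      by (rule conjugate_msum[where F = "ff L" and a = a and b = "\<lambda>k. z * a k", OF L U Ui])
        (fact ff_carrier | erule ff | erule that)+
  qed
  have Ulfd: "intertwines U (lin_ffd L a) z" if "\<And>k. k \<in> {1..2 * L} \<Longrightarrow> z * a (shift2 L k) = a k" for z a
  proof (rule conjugation_intertwines[OF U Ui lin_ffd_carrier inv(2)])
    show "U * lin_ffd L a * Uinv = z \<cdot>\<^sub>m lin_ffd L a"
      unfolding lin_ffd_smult[symmetric] unfolding lin_ffd_def
      by (rule conjugate_msum[where F = "ffd L" and a = a and b = "\<lambda>k. z * a k", OF L U Ui])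
        (fact ffd_carrier | erule ffd | erule that)+
  qed
  \<comment> \<open>The inverse of the factor that a two-site shift gives at index
    \<open>- m\<close>, which is the index of \<open>chid\<close> and \<open>etab\<close>.\<close>
  define z where "z m = cis (- (2 * pi * of_nat m / of_nat L))" for m
  have z0: "z m \<noteq> 0" for m by (simp add: z_def)
  have zi: "1 / z m = cis (2 * pi * of_nat m / of_nat L)" for m
    by (simp add: z_def flip: cis_inverse inverse_eq_divide)
  have sh: "cis (2 * pi * of_nat m / of_nat L) * mode_coeff L \<sigma> (int m) (shift2 L k) = mode_coeff L \<sigma> (int m) k"
    "z m * mode_coeff L \<sigma> (- int m) (shift2 L k) = mode_coeff L \<sigma> (- int m) k" if "k \<in> {1..2 * L}" for m \<sigma> k
    unfolding mode_coeff_shift2[OF L that] z_def by (simp_all add: cis_mult flip: mult.assoc)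
  have modes: "intertwines U (chi L m) (1 / z m)" "intertwines U (chid L m) (z m)"
    "intertwines U (etab L m) (z m)" "intertwines U (etabd L m) (1 / z m)" if m: "m \<in> {1..L - 1}" for m
    unfolding zi chi_eq_lin_ff[OF m] chid_eq_lin_ffd[OF m] etab_eq_lin_ff'[OF m] etabd_eq_lin_ffd[OF m]
    by (rule Ulf Ulfd; simp add: sh)+
  have zero: "intertwines U (lin_ff L a) 1" "intertwines U (lin_ffd L a) 1" if a: "a \<in> {wave L 0, wave L (int L)}" for a
  proof -
    \<comment> \<open>Two sites turn the wave of index \<open>L\<close> by a full circle, so it is
      fixed just as the constant wave is.\<close>
    have "cis (- (2 * pi)) = 1" using cis_multiple_2pi[of "- 1"] by simp
    then have "1 * a (shift2 L k) = a k" if "k \<in> {1..2 * L}" for k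
      using a wave_shift2[OF L that, of 0] wave_shift2[OF L that, of "int L"] L0 by auto
    then show "intertwines U (lin_ff L a) 1" "intertwines U (lin_ffd L a) 1" using Ulf Ulfd by blast+
  qed
  obtain V VI where V: "V \<in> ?S" "VI \<in> ?S" "V \<in> carrier_mat ?d ?d" "VI \<in> carrier_mat ?d ?d"
    "V * VI = 1\<^sub>m ?d" "VI * V = 1\<^sub>m ?d"
    and ph: "mode_phases L V (\<lambda>m. if m \<le> L - 1 then z m else 1) (\<lambda>m. if m \<le> L - 1 then z m else 1)"
    using mode_phases_in_SN[of z "L - 1" L, OF z0] by blast
  have Vm: "intertwines V (chi L m) (1 / z m)" "intertwines V (chid L m) (z m)"
    "intertwines V (etab L m) (z m)" "intertwines V (etabd L m) (1 / z m)" if m: "m \<in> {1..L - 1}" for m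
    using ph m unfolding mode_phases_def by auto
  have V0: "intertwines V (lin_ff L a) 1" "intertwines V (lin_ffd L a) 1" if a: "a \<in> {wave L 0, wave L (int L)}" for a
    using ph a unfolding mode_phases_def by auto
  \<comment> \<open>\<open>U\<close> and \<open>V\<close> have equal phases on every mode, so in
    \<open>?W\<close> the phases cancel and it commutes with all fermions.\<close>
  let ?W = "VI * U"
  have W: "?W \<in> carrier_mat ?d ?d" using V U by (simp add: ring)
  note cancel = intertwines_cancel[OF V(3,4) U _ V(5,6)]
  have Wm: "intertwines ?W (chi L m) 1 \<and> intertwines ?W (etab L m) 1
        \<and> intertwines ?W (chid L m) 1 \<and> intertwines ?W (etabd L m) 1" if m: "m \<in> {1..L - 1}" for m
    using cancel[OF mode_carrier(1)[OF m] Vm(1)[OF m] modes(1)[OF m]]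
      cancel[OF mode_carrier(2)[OF m] Vm(2)[OF m] modes(2)[OF m]]
      cancel[OF mode_carrier(3)[OF m] Vm(3)[OF m] modes(3)[OF m]]
      cancel[OF mode_carrier(4)[OF m] Vm(4)[OF m] modes(4)[OF m]] by blast
  have W0: "intertwines ?W (lin_ff L a) 1 \<and> intertwines ?W (lin_ffd L a) 1" if a: "a \<in> {wave L 0, wave L (int L)}" for a
    using cancel[OF lin_ff_carrier V0(1)[OF a] zero(1)[OF a]] cancel[OF lin_ffd_carrier V0(2)[OF a] zero(2)[OF a]] by blast
  note comm = commute_all[OF L0 W Wm W0]
  have "\<exists>c. ?W = c \<cdot>\<^sub>m 1\<^sub>m ?d"
  proof (rule jw_op_commutant_scalar[OF W])
    fix j assume j: "j \<in> {1..2 * L}"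
    show "?W * cop L j = cop L j * ?W"
      using comm(1)[of "\<lambda>k. if k = j then 1 else 0"] unfolding lin_ff_delta[OF j] ff_def .
    have t: "transpose_mat (cop L j) = (- 1) ^ j \<cdot>\<^sub>m ffd L j"
      by (simp add: ffd_def smult_smult_mat smult_1_id flip: power_mult_distrib)
    have "?W * ffd L j = ffd L j * ?W"
      using comm(2)[of "\<lambda>k. if k = j then 1 else 0"] unfolding lin_ffd_delta[OF j] .
    then show "?W * transpose_mat (cop L j) = transpose_mat (cop L j) * ?W"
      unfolding t matrix_smult(2)[OF W ffd_carrier] matrix_smult(1)[OF ffd_carrier W] by simp
  qed
  then obtain c where c: "?W = c \<cdot>\<^sub>m 1\<^sub>m ?d" by blast
  have "U = (V * VI) * U" using V U by simp
  also have "\<dots> = V * ?W" by (rule matrix_distrib(5)[OF V(3,4) U])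
  also have "\<dots> = c \<cdot>\<^sub>m V" unfolding c using V by (simp add: ring)
  finally have Uc: "U = c \<cdot>\<^sub>m V" .
  then show "U \<in> ?S" using V(1) by (auto intro: assoc_alg.smult)
  have "VI = VI * (U * Uinv)" using V by (simp add: inv)
  also have "\<dots> = ?W * Uinv" by (rule matrix_distrib(5)[OF V(4) U Ui, symmetric])
  also have "\<dots> = c \<cdot>\<^sub>m Uinv" unfolding c using Ui by (simp add: ring)
  finally have VIc: "VI = c \<cdot>\<^sub>m Uinv" .
  \<comment> \<open>Invertibility of \<open>U\<close> excludes 0; dividing by \<open>c\<close> then
    passes from \<open>VI\<close> to \<open>Uinv\<close>.\<close>
  have "c \<noteq> 0"
  proof
    assume "c = 0"
    then have "U $$ (0, 0) = 0" and "U = 0 \<cdot>\<^sub>m V" using Uc V(3) by (auto simp: hdim_def)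
    then have "U * Uinv = 0 \<cdot>\<^sub>m (V * Uinv)" using V(3) Ui by (simp add: ring)
    then have "1\<^sub>m ?d $$ (0, 0) = (0 \<cdot>\<^sub>m (V * Uinv)) $$ (0, 0)" using inv(1) by simp
    then show False using V(3) Ui by (simp add: hdim_def)
  qed
  then show "Uinv \<in> ?S" using V(2) VIc assoc_alg_scale_cancel by metis
qed

theorem theorem4p5:
  fixes L :: nat and U Uinv :: "complex mat"
  assumes "L \<ge> 2"
    and "U \<in> carrier_mat (hdim L) (hdim L)" and "Uinv \<in> carrier_mat (hdim L) (hdim L)"
    and "U * Uinv = 1\<^sub>m (hdim L)" and "Uinv * U = 1\<^sub>m (hdim L)"
    and "\<forall>j\<in>{1..2 * L}. U * ff L j * Uinv = ff L (shift2 L j)"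
    and "\<forall>j\<in>{1..2 * L}. U * ffd L j * Uinv = ffd L (shift2 L j)"
  shows "alg_isomorphic (hdim L)
           (assoc_alg (hdim L) (lie_alg (SN_gens L)))
           (assoc_alg (hdim L) (JTL_gens L U Uinv))"
proof -
  let ?A = "assoc_alg (hdim L) (SN_gens L)" and ?B = "assoc_alg (hdim L) (JTL_gens L U Uinv)"
  have "?A \<subseteq> ?B"
  proof (rule assoc_alg_subset, rule SN_gens_in_assoc_alg[OF assms(1)])
    show "ee L j \<in> ?B" if "j \<in> {1..2 * L}" for j
      using that by (intro assoc_alg.gen) (auto simp: JTL_gens_def)
  qed
  moreover have "?B \<subseteq> ?A"
    using ee_in_SN[of L] translation_in_assoc_alg[OF assms(1-5)] assms(1,6,7)
    by (intro assoc_alg_subset) (auto simp: JTL_gens_def)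
  ultimately have "?A = ?B" by blast
  then have "bij_betw id (assoc_alg (hdim L) (lie_alg (SN_gens L))) ?B"
    by (simp add: assoc_alg_lie_alg)
  then show ?thesis
    unfolding alg_isomorphic_def by (intro exI[of _ id]) simp
qed

end
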